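(* Suppose the $m_2\times m_1$ matrix function $R$ is rational, contractive on $\mathbb{R}$ and tends to zero at infinity, and let $$R(\lambda)=C(\lambda I_n-A)^{-1}B$$ be a minimal realization of $R$. Then there is a unique Hermitian solution $X=X^*$ of the Riccati equation $$i(XA-A^*X)=C^*C+XBB^*X$$ such that $\sigma(A+iBB^*X)\subset\overline{\mathbb{C}}_-$. This solution $X$ is always invertible. It is strictly positive if and only if $R$ is contractive in $\mathbb{C}_+$.
   Context: $\mathbb{C}_+$ is the open upper half-plane, $\overline{\mathbb{C}}_-$ is the closed lower half-plane, $\sigma$ denotes spectrum, and $^*$ denotes conjugate transpose. A rational matrix function $R$ is contractive on $\mathbb{R}$ (in $\mathbb{C}_+$) if it has no poles there and $R(\lambda)^*R(\lambda)\le I$ there. The realization $R(\lambda)=C(\lambda I_n-A)^{-1}B$, with complex matrices $A$ ($n\times n$), $B$ ($n\times m_1$), $C$ ($m_2\times n$), is minimal if $n$ is minimal among all such realizations of $R$. *)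

theory Defs
  imports
    "HOL-Complex_Analysis.Complex_Analysis"
    "Jordan_Normal_Form.Spectral_Radius"
begin

definition hermitian_mat :: "complex mat \<Rightarrow> bool" where
  "hermitian_mat M \<longleftrightarrow> square_mat M \<and> mat_adjoint M = M"

text \<open>The comparisons below are in the order of \<^theory>\<open>HOL-Library.Complex_Order\<close>,
  where \<open>0 \<le> z\<close> includes that \<open>z\<close> is real.\<close>

definition psd_mat :: "complex mat \<Rightarrow> bool" where
  "psd_mat M \<longleftrightarrow> hermitian_mat M \<and>
     (\<forall>v \<in> carrier_vec (dim_row M). 0 \<le> (M *\<^sub>v v) \<bullet>c v)"

definition pos_def_mat :: "complex mat \<Rightarrow> bool" where
  "pos_def_mat M \<longleftrightarrow> hermitian_mat M \<and>
     (\<forall>v \<in> carrier_vec (dim_row M). v \<noteq> 0\<^sub>v (dim_row M) \<longrightarrow> 0 < (M *\<^sub>v v) \<bullet>c v)"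

definition loewner_le :: "complex mat \<Rightarrow> complex mat \<Rightarrow> bool" where
  "loewner_le M N \<longleftrightarrow> psd_mat (N - M)"

text \<open>A rational function is represented by a total function whose values at its poles are
  irrelevant. Since the fraction is reduced, the zeros of \<open>q\<close> are exactly the poles, and the
  values at all other points (removable singularities included) are the correct ones.\<close>

definition rational_function :: "(complex \<Rightarrow> complex) \<Rightarrow> bool" where
  "rational_function f \<longleftrightarrow>
     (\<exists>p q. q \<noteq> 0 \<and> coprime p q \<and> (\<forall>z. poly q z \<noteq> 0 \<longrightarrow> f z = poly p z / poly q z))"

definition rational_mat_function :: "nat \<Rightarrow> nat \<Rightarrow> (complex \<Rightarrow> complex mat) \<Rightarrow> bool" where
  "rational_mat_function m2 m1 R \<longleftrightarrow>
     (\<forall>z. R z \<in> carrier_mat m2 m1) \<and>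
     (\<forall>i<m2. \<forall>j<m1. rational_function (\<lambda>z. R z $$ (i, j)))"

definition has_pole_at :: "nat \<Rightarrow> nat \<Rightarrow> (complex \<Rightarrow> complex mat) \<Rightarrow> complex \<Rightarrow> bool" where
  "has_pole_at m2 m1 R z \<longleftrightarrow> (\<exists>i<m2. \<exists>j<m1. is_pole (\<lambda>w. R w $$ (i, j)) z)"

definition contractive_on ::
    "nat \<Rightarrow> nat \<Rightarrow> complex set \<Rightarrow> (complex \<Rightarrow> complex mat) \<Rightarrow> bool" where
  "contractive_on m2 m1 S R \<longleftrightarrow>
     (\<forall>z\<in>S. \<not> has_pole_at m2 m1 R z \<and> loewner_le (mat_adjoint (R z) * R z) (1\<^sub>m m1))"

definition vanishes_at_infinity ::
    "nat \<Rightarrow> nat \<Rightarrow> (complex \<Rightarrow> complex mat) \<Rightarrow> bool" where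
  "vanishes_at_infinity m2 m1 R \<longleftrightarrow>
     (\<forall>i<m2. \<forall>j<m1. ((\<lambda>z. R z $$ (i, j)) \<longlongrightarrow> 0) at_infinity)"

text \<open>The equation \<open>R(z) = C (z I - A)\<^sup>-\<^sup>1 B\<close> is required at every \<open>z\<close> where the inverse
  exists. For rational \<open>R\<close> this is the identity of rational matrix functions: if it holds at all
  but finitely many points, then \<open>R\<close> has no pole outside the spectrum of \<open>A\<close> and
  the equation holds at each such point.\<close>

definition realization ::
    "nat \<Rightarrow> nat \<Rightarrow> nat \<Rightarrow> complex mat \<Rightarrow> complex mat \<Rightarrow> complex mat \<Rightarrow>
     (complex \<Rightarrow> complex mat) \<Rightarrow> bool" where
  "realization m2 m1 n A B C R \<longleftrightarrow>
     A \<in> carrier_mat n n \<and> B \<in> carrier_mat n m1 \<and> C \<in> carrier_mat m2 n \<and>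
     (\<forall>z. z \<notin> spectrum A \<longrightarrow> R z = C * the (mat_inverse (z \<cdot>\<^sub>m 1\<^sub>m n - A)) * B)"

definition minimal_realization ::
    "nat \<Rightarrow> nat \<Rightarrow> nat \<Rightarrow> complex mat \<Rightarrow> complex mat \<Rightarrow> complex mat \<Rightarrow>
     (complex \<Rightarrow> complex mat) \<Rightarrow> bool" where
  "minimal_realization m2 m1 n A B C R \<longleftrightarrow>
     realization m2 m1 n A B C R \<and>
     (\<forall>n' A' B' C'. realization m2 m1 n' A' B' C' R \<longrightarrow> n \<le> n')"

definition riccati_equation ::
    "complex mat \<Rightarrow> complex mat \<Rightarrow> complex mat \<Rightarrow> complex mat \<Rightarrow> bool" where
  "riccati_equation A B C X \<longleftrightarrow>
     \<i> \<cdot>\<^sub>m (X * A - mat_adjoint A * X) =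
       mat_adjoint C * C + X * B * mat_adjoint B * X"

definition spectral_riccati_solution ::
    "nat \<Rightarrow> complex mat \<Rightarrow> complex mat \<Rightarrow> complex mat \<Rightarrow> complex mat \<Rightarrow> bool" where
  "spectral_riccati_solution n A B C X \<longleftrightarrow>
     X \<in> carrier_mat n n \<and> hermitian_mat X \<and> riccati_equation A B C X \<and>
     spectrum (A + \<i> \<cdot>\<^sub>m (B * mat_adjoint B * X)) \<subseteq> {z. Im z \<le> 0}"

end

theory Submission
  imports Defs
begin

text \<open>
  Put \<open>G = -\<i> A\<close>, \<open>S = B B\<^sup>*\<close> and \<open>Q = C\<^sup>* C\<close>. The factor \<open>-\<i>\<close> turns the upper half-plane into
  the right half-plane, and the equation becomes \<open>X G + G\<^sup>* X + Q + X S X = 0\<close> with closed loop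
  matrix \<open>G + S X\<close>, whose spectrum is to lie in the closed left half-plane. The function \<open>R\<close> enters
  only through pairs \<open>(x, u)\<close> with \<open>z x = G x + B u\<close>: contractivity of \<open>R\<close> at \<open>\<i> z\<close> amounts to
  \<open>\<langle>Q x, x\<rangle> \<le> |u|\<^sup>2\<close> for all of them, a condition that makes sense even at eigenvalues of \<open>G\<close> and
  extends to them by continuity (\<open>contractive_imp_gain_le\<close>). Minimality enters only through its
  consequence that no nonzero \<open>p\<close> satisfies \<open>G\<^sup>* p = \<mu> p\<close>, \<open>B\<^sup>* p = 0\<close>, and no nonzero \<open>x\<close> satisfies
  \<open>G x = \<mu> x\<close>, \<open>C x = 0\<close>; such a vector would allow a realization of smaller dimension.

  \<^emph>\<open>Existence.\<close> Replace \<open>Q\<close> by \<open>r Q\<close> with \<open>0 < r < 1\<close>. The strict inequality keeps the eigenvalues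
  of the Hamiltonian matrix \<open>[G, S; -r Q, -G\<^sup>*]\<close> away from the imaginary axis. The invariant
  subspaces for its eigenvalues in the left and in the right half-plane are isotropic for the
  symplectic form, so by controllability each of them projects injectively to the state
  component. Hence both have dimension \<open>n\<close>, and they are graphs of Hermitian solutions, one with
  closed loop spectrum in the left and one in the right half-plane (\<open>hamiltonian_solutions\<close>).
  By a Lyapunov argument (\<open>lyapunov_nonneg\<close>, \<open>riccati_comparison\<close>) the stabilizing solutions
  \<open>X\<^sub>r\<close> increase with \<open>r\<close>, lie below a fixed antistabilizing solution, and lie below every
  solution for \<open>r = 1\<close>. Their limit for \<open>r \<rightarrow> 1\<close> is the smallest Hermitian solution, and its closed
  loop spectrum is in the closed left half-plane (\<open>riccati_minimal_solution\<close>).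

  \<^emph>\<open>Uniqueness.\<close> The difference \<open>D \<ge> 0\<close> of another solution with this spectral property and the
  smallest one would have an eigenvector of the adjoint closed loop matrix in its range, and that
  vector would be uncontrollable (\<open>riccati_solution_unique\<close>).

  \<^emph>\<open>Invertibility.\<close> The kernel of a solution is invariant under \<open>G\<close> and contained in the kernel of
  \<open>C\<close>, so it is zero by observability (\<open>riccati_solution_injective\<close>).

  \<^emph>\<open>Definiteness.\<close> If \<open>X > 0\<close>, completing the square gives
  \<open>|u|\<^sup>2 - \<langle>Q x, x\<rangle> = |u - B\<^sup>* X x|\<^sup>2 + 2 Re z \<langle>X x, x\<rangle> \<ge> 0\<close> for \<open>Re z \<ge> 0\<close>
  (\<open>riccati_dissipation\<close>). Conversely, contractivity in the open half-plane leaves no room for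
  eigenvalues of \<open>G\<close> with \<open>Re z \<ge> 0\<close>: an eigenvector is a state with input \<open>0\<close>, so it would have
  \<open>C x = 0\<close>. Thus \<open>G\<close> is a Hurwitz matrix, and the Riccati equation is a Lyapunov inequality for
  \<open>X\<close> (\<open>riccati_solution_psd\<close>).
\<close>

section \<open>Adjoints and the complex inner product\<close>

lemma mat_adjoint_dim [simp]:
  "dim_row (mat_adjoint M) = dim_col M" "dim_col (mat_adjoint M) = dim_row M"
  by (simp_all add: mat_adjoint_def)

lemma carrier_mat_simps [simp]:
  fixes M N :: "complex mat"
  shows "M + N \<in> carrier_mat k m \<longleftrightarrow> N \<in> carrier_mat k m"
    and "M - N \<in> carrier_mat k m \<longleftrightarrow> N \<in> carrier_mat k m"
    and "a \<cdot>\<^sub>m M \<in> carrier_mat k m \<longleftrightarrow> M \<in> carrier_mat k m"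
    and "- M \<in> carrier_mat k m \<longleftrightarrow> M \<in> carrier_mat k m"
    and "M * N \<in> carrier_mat k m \<longleftrightarrow> dim_row M = k \<and> dim_col N = m"
    and "mat_adjoint M \<in> carrier_mat k m \<longleftrightarrow> M \<in> carrier_mat m k"
  unfolding carrier_mat_def by auto

lemma carrier_vec_simps [simp]:
  fixes x y :: "complex Matrix.vec"
  shows "x + y \<in> carrier_vec k \<longleftrightarrow> y \<in> carrier_vec k"
    and "x - y \<in> carrier_vec k \<longleftrightarrow> y \<in> carrier_vec k"
    and "a \<cdot>\<^sub>v x \<in> carrier_vec k \<longleftrightarrow> x \<in> carrier_vec k"
    and "- x \<in> carrier_vec k \<longleftrightarrow> x \<in> carrier_vec k"
    and "M *\<^sub>v x \<in> carrier_vec k \<longleftrightarrow> dim_row M = k"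
  unfolding carrier_vec_def by auto

lemma zero_vec_simps [simp]:
  shows "a \<cdot>\<^sub>v 0\<^sub>v n = (0\<^sub>v n :: complex Matrix.vec)"
    and "- 0\<^sub>v n = (0\<^sub>v n :: complex Matrix.vec)"
    and "dim_vec (x :: complex Matrix.vec) = n \<Longrightarrow> 0\<^sub>m k n *\<^sub>v x = 0\<^sub>v k"
  by (intro eq_vecI; simp add: scalar_prod_def)+

lemma mat_adjoint_index [simp]:
  "i < dim_col M \<Longrightarrow> j < dim_row M \<Longrightarrow> mat_adjoint M $$ (i, j) = cnj (M $$ (j, i))"
  by (simp add: mat_adjoint_def mat_of_rows_def)

lemma cprod_sum:
  fixes x y :: "complex Matrix.vec"
  shows "x \<bullet>c y = (\<Sum>i<dim_vec y. vec_index x i * cnj (vec_index y i))"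
  by (simp add: scalar_prod_def lessThan_atLeast0)

lemma mult_mat_vec_index:
  fixes M :: "complex mat"
  assumes "i < dim_row M" "dim_vec x = dim_col M"
  shows "vec_index (M *\<^sub>v x) i = (\<Sum>j<dim_vec x. M $$ (i, j) * vec_index x j)"
  using assms by (simp add: scalar_prod_def lessThan_atLeast0)

lemma cprod_linear:
  fixes x y z :: "complex Matrix.vec"
  shows "dim_vec y = dim_vec z \<Longrightarrow> (x + y) \<bullet>c z = x \<bullet>c z + y \<bullet>c z"
    and "dim_vec y = dim_vec z \<Longrightarrow> (x - y) \<bullet>c z = x \<bullet>c z - y \<bullet>c z"
    and "dim_vec x = dim_vec z \<Longrightarrow> (a \<cdot>\<^sub>v x) \<bullet>c z = a * (x \<bullet>c z)"
    and "dim_vec x = dim_vec z \<Longrightarrow> (- x) \<bullet>c z = - (x \<bullet>c z)"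
    and "dim_vec x = dim_vec y \<Longrightarrow> z \<bullet>c (x + y) = z \<bullet>c x + z \<bullet>c y"
    and "dim_vec x = dim_vec y \<Longrightarrow> z \<bullet>c (x - y) = z \<bullet>c x - z \<bullet>c y"
    and "z \<bullet>c (a \<cdot>\<^sub>v x) = cnj a * (z \<bullet>c x)"
    and "z \<bullet>c (- x) = - (z \<bullet>c x)"
    and "dim_vec z = n \<Longrightarrow> 0\<^sub>v n \<bullet>c z = 0"
    and "dim_vec z = n \<Longrightarrow> z \<bullet>c 0\<^sub>v n = 0"
  by (simp_all add: cprod_sum sum.distrib sum_subtractf sum_distrib_left sum_negf
      algebra_simps del: conjugate_zero_vec)

lemma cprod_commute:
  fixes x y :: "complex Matrix.vec"
  shows "dim_vec x = dim_vec y \<Longrightarrow> x \<bullet>c y = cnj (y \<bullet>c x)"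
  by (simp add: cprod_sum mult.commute)

lemma mat_vec_linear:
  fixes M N :: "complex mat"
  shows "dim_vec x = dim_col M \<Longrightarrow> dim_vec y = dim_col M \<Longrightarrow>
      M *\<^sub>v (x + y) = M *\<^sub>v x + M *\<^sub>v y"
    and "dim_vec x = dim_col M \<Longrightarrow> dim_vec y = dim_col M \<Longrightarrow>
      M *\<^sub>v (x - y) = M *\<^sub>v x - M *\<^sub>v y"
    and "dim_vec x = dim_col M \<Longrightarrow> M *\<^sub>v (a \<cdot>\<^sub>v x) = a \<cdot>\<^sub>v (M *\<^sub>v x)"
    and "dim_vec x = dim_col M \<Longrightarrow> M *\<^sub>v (- x) = - (M *\<^sub>v x)"
    and "dim_col M = n \<Longrightarrow> M *\<^sub>v 0\<^sub>v n = 0\<^sub>v (dim_row M)"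
    and "dim_row M = dim_row N \<Longrightarrow> dim_vec x = dim_col M \<Longrightarrow> dim_vec x = dim_col N \<Longrightarrow>
      (M + N) *\<^sub>v x = M *\<^sub>v x + N *\<^sub>v x"
    and "dim_row M = dim_row N \<Longrightarrow> dim_vec x = dim_col M \<Longrightarrow> dim_vec x = dim_col N \<Longrightarrow>
      (M - N) *\<^sub>v x = M *\<^sub>v x - N *\<^sub>v x"
    and "dim_vec x = dim_col M \<Longrightarrow> (a \<cdot>\<^sub>m M) *\<^sub>v x = a \<cdot>\<^sub>v (M *\<^sub>v x)"
    and "dim_vec x = dim_col M \<Longrightarrow> (- M) *\<^sub>v x = - (M *\<^sub>v x)"
    and "dim_vec x = dim_col N \<Longrightarrow> dim_row N = dim_col M \<Longrightarrow>
      (M * N) *\<^sub>v x = M *\<^sub>v (N *\<^sub>v x)"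
    and "dim_vec x = n \<Longrightarrow> 1\<^sub>m n *\<^sub>v x = x"
proof -
  show "dim_vec x = dim_col N \<Longrightarrow> dim_row N = dim_col M \<Longrightarrow>
      (M * N) *\<^sub>v x = M *\<^sub>v (N *\<^sub>v x)"
    by (intro assoc_mult_mat_vec[of _ "dim_row M" "dim_col M" _ "dim_col N"] carrier_matI
        carrier_vecI; simp)
  show "dim_vec x = n \<Longrightarrow> 1\<^sub>m n *\<^sub>v x = x"
    by (intro one_mult_mat_vec carrier_vecI; simp)
qed (intro eq_vecI; simp add: mult_mat_vec_index sum.distrib sum_subtractf sum_distrib_left sum_negf
      distrib_left distrib_right left_diff_distrib right_diff_distrib mult.left_commute mult.assoc
      del: index_mult_mat_vec)+

lemma cprod_adjoint:
  fixes M :: "complex mat"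
  assumes "dim_vec x = dim_col M" "dim_vec y = dim_row M"
  shows "(M *\<^sub>v x) \<bullet>c y = x \<bullet>c (mat_adjoint M *\<^sub>v y)"
proof -
  have "(M *\<^sub>v x) \<bullet>c y = (\<Sum>i<dim_row M. \<Sum>j<dim_col M. M $$ (i, j) * vec_index x j * cnj (vec_index y i))"
    using assms by (simp add: cprod_sum mult_mat_vec_index sum_distrib_right del: index_mult_mat_vec)
  also have "\<dots> = (\<Sum>j<dim_col M. \<Sum>i<dim_row M. M $$ (i, j) * vec_index x j * cnj (vec_index y i))"
    by (rule sum.swap)
  also have "\<dots> = x \<bullet>c (mat_adjoint M *\<^sub>v y)"
    using assms by (simp add: cprod_sum mult_mat_vec_index sum_distrib_left algebra_simps del: index_mult_mat_vec)
  finally show ?thesis .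
qed

lemma cprod_self_Re:
  fixes x :: "complex Matrix.vec"
  shows "0 \<le> Re (x \<bullet>c x)" "Im (x \<bullet>c x) = 0"
  using conjugate_square_ge_0_vec[of x] by (auto simp: less_eq_complex_def)

lemma cprod_self_eq_0:
  fixes x :: "complex Matrix.vec"
  shows "x \<bullet>c x = 0 \<longleftrightarrow> x = 0\<^sub>v (dim_vec x)"
    "Re (x \<bullet>c x) = 0 \<longleftrightarrow> x = 0\<^sub>v (dim_vec x)"
proof -
  show *: "x \<bullet>c x = 0 \<longleftrightarrow> x = 0\<^sub>v (dim_vec x)"
    by (rule conjugate_square_eq_0_vec) simp
  have "Re (x \<bullet>c x) = 0 \<longleftrightarrow> x \<bullet>c x = 0"
    by (simp add: complex_eq_iff cprod_self_Re(2))
  with * show "Re (x \<bullet>c x) = 0 \<longleftrightarrow> x = 0\<^sub>v (dim_vec x)" by simp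
qed

lemma mat_eq_by_mult_vec:
  fixes M N :: "complex mat"
  assumes "M \<in> carrier_mat k m" "N \<in> carrier_mat k m"
    and "\<And>x. x \<in> carrier_vec m \<Longrightarrow> M *\<^sub>v x = N *\<^sub>v x"
  shows "M = N"
proof (rule eq_matI)
  fix i j assume ij: "i < dim_row N" "j < dim_col N"
  have "M $$ (i, j) = vec_index (M *\<^sub>v unit_vec m j) i" if "M \<in> carrier_mat k m" for M :: "complex mat"
    using that ij assms(2) by auto
  from this[OF assms(1)] this[OF assms(2)] assms(3)[of "unit_vec m j"]
  show "M $$ (i, j) = N $$ (i, j)" by simp
qed (use assms in auto)

lemma vec_eq_by_cprod:
  fixes x y :: "complex Matrix.vec"
  assumes "x \<in> carrier_vec n" "y \<in> carrier_vec n"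
    and "\<And>z. z \<in> carrier_vec n \<Longrightarrow> x \<bullet>c z = y \<bullet>c z"
  shows "x = y"
proof -
  have "(x - y) \<bullet>c (x - y) = 0"
    using assms(1,2) assms(3)[of "x - y"] by (simp add: cprod_linear(2))
  hence xy: "x - y = 0\<^sub>v n"
    using assms(1,2) by (simp add: cprod_self_eq_0(1))
  show ?thesis
  proof (rule eq_vecI)
    fix i assume "i < dim_vec y"
    hence "vec_index (x - y) i = 0" using assms(1,2) xy by auto
    thus "vec_index x i = vec_index y i" using assms(1,2) \<open>i < dim_vec y\<close> by auto
  qed (use assms in \<open>auto\<close>)
qed

lemma mat_adjoint_adjoint [simp]: "mat_adjoint (mat_adjoint (M :: complex mat)) = M"
  by (rule eq_matI) auto

lemma mat_adjoint_mult:
  fixes M N :: "complex mat"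
  assumes "dim_row N = dim_col M"
  shows "mat_adjoint (M * N) = mat_adjoint N * mat_adjoint M"
  using assms by (intro eq_matI) (auto simp: scalar_prod_def row_def col_def mult.commute)

lemma mat_adjoint_linear:
  fixes M N :: "complex mat"
  shows "dim_row M = dim_row N \<Longrightarrow> dim_col M = dim_col N \<Longrightarrow>
      mat_adjoint (M + N) = mat_adjoint M + mat_adjoint N"
    and "dim_row M = dim_row N \<Longrightarrow> dim_col M = dim_col N \<Longrightarrow>
      mat_adjoint (M - N) = mat_adjoint M - mat_adjoint N"
    and "mat_adjoint (a \<cdot>\<^sub>m M) = cnj a \<cdot>\<^sub>m mat_adjoint M"
    and "mat_adjoint (- M) = - mat_adjoint M"
    and "mat_adjoint (1\<^sub>m k) = (1\<^sub>m k :: complex mat)"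
  by (auto intro!: eq_matI)

abbreviation qform :: "complex mat \<Rightarrow> complex Matrix.vec \<Rightarrow> real" where
  "qform M x \<equiv> Re ((M *\<^sub>v x) \<bullet>c x)"

lemma hermitian_cprod:
  assumes "hermitian_mat M" "M \<in> carrier_mat n n" "x \<in> carrier_vec n" "y \<in> carrier_vec n"
  shows "(M *\<^sub>v x) \<bullet>c y = x \<bullet>c (M *\<^sub>v y)"
  using assms by (simp add: hermitian_mat_def cprod_adjoint)

lemma hermitian_matI:
  assumes "M \<in> carrier_mat n n"
    and "\<And>x y. x \<in> carrier_vec n \<Longrightarrow> y \<in> carrier_vec n \<Longrightarrow> (M *\<^sub>v x) \<bullet>c y = x \<bullet>c (M *\<^sub>v y)"
  shows "hermitian_mat M"
proof -
  have "mat_adjoint M *\<^sub>v y = M *\<^sub>v y" if y: "y \<in> carrier_vec n" for y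
  proof (rule vec_eq_by_cprod[of _ n])
    fix z :: "complex Matrix.vec" assume z: "z \<in> carrier_vec n"
    show "(mat_adjoint M *\<^sub>v y) \<bullet>c z = (M *\<^sub>v y) \<bullet>c z"
      using assms(1) assms(2)[OF y z] y z cprod_adjoint[of y "mat_adjoint M" z]
      by auto
  qed (use assms(1) in auto)
  hence "mat_adjoint M = M"
    using assms(1) by (intro mat_eq_by_mult_vec[of _ n n]) auto
  thus ?thesis using assms(1) by (auto simp: hermitian_mat_def)
qed

lemma hermitian_form_real:
  assumes "hermitian_mat M" "M \<in> carrier_mat n n" "x \<in> carrier_vec n"
  shows "Im ((M *\<^sub>v x) \<bullet>c x) = 0"
proof -
  have "(M *\<^sub>v x) \<bullet>c x = cnj (x \<bullet>c (M *\<^sub>v x))"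
    using assms by (intro cprod_commute) simp
  also have "x \<bullet>c (M *\<^sub>v x) = (M *\<^sub>v x) \<bullet>c x"
    using hermitian_cprod[OF assms assms(3)] by simp
  finally have "Im ((M *\<^sub>v x) \<bullet>c x) = Im (cnj ((M *\<^sub>v x) \<bullet>c x))" by simp
  thus ?thesis by simp
qed

lemma psd_mat_iff:
  assumes "M \<in> carrier_mat n n"
  shows "psd_mat M \<longleftrightarrow> hermitian_mat M \<and> (\<forall>x\<in>carrier_vec n. 0 \<le> qform M x)"
proof -
  have "dim_row M = n" using assms by auto
  thus ?thesis
    unfolding psd_mat_def using hermitian_form_real[OF _ assms]
    by (metis less_eq_complex_def zero_complex.sel)
qed

text \<open>A point where a nonnegative form vanishes is a minimum, so the gradient vanishes there.\<close>
lemma psd_mat_form_eq_0: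
  assumes M: "M \<in> carrier_mat n n" and psd: "psd_mat M" and x: "x \<in> carrier_vec n"
    and "qform M x = 0"
  shows "M *\<^sub>v x = 0\<^sub>v n"
proof (rule ccontr)
  assume ne: "M *\<^sub>v x \<noteq> 0\<^sub>v n"
  define y where "y = M *\<^sub>v x"
  have y: "y \<in> carrier_vec n" using M x by (simp add: y_def)
  have herm: "hermitian_mat M" using psd by (simp add: psd_mat_def)
  define a where "a = Re (y \<bullet>c y)"
  define b where "b = qform M y"
  have a: "a > 0"
    using ne y cprod_self_Re(1)[of y] cprod_self_eq_0(2)[of y]
    by (auto simp: a_def y_def[symmetric])
  have b: "b \<ge> 0" using psd y M by (simp add: psd_mat_iff[OF M] b_def)
  have key: "0 \<le> 2 * t * a + t\<^sup>2 * b" for t :: real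
  proof -
    have "0 \<le> Re ((M *\<^sub>v (x + of_real t \<cdot>\<^sub>v y)) \<bullet>c (x + of_real t \<cdot>\<^sub>v y))"
      using psd x y psd_mat_iff[OF M] by auto
    also have "(M *\<^sub>v (x + of_real t \<cdot>\<^sub>v y)) \<bullet>c (x + of_real t \<cdot>\<^sub>v y) =
        (M *\<^sub>v x) \<bullet>c x + t * (y \<bullet>c y) + t * ((M *\<^sub>v y) \<bullet>c x) + t\<^sup>2 * ((M *\<^sub>v y) \<bullet>c y)"
      using M x y by (simp add: mat_vec_linear cprod_linear y_def algebra_simps power2_eq_square)
    also have "(M *\<^sub>v y) \<bullet>c x = y \<bullet>c y"
      using hermitian_cprod[OF herm M y x] by (simp add: y_def)
    finally show ?thesis
      using assms(4) by (simp add: a_def b_def power2_eq_square)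
  qed
  define t where "t = a / (b + 1)"
  have t: "t > 0" "t * b \<le> a" using a b by (auto simp: t_def field_simps)
  have "0 \<le> - t * (2 * a - t * b)"
    using key[of "- t"] by (simp add: algebra_simps power2_eq_square)
  hence "2 * a - t * b \<le> 0" using t(1) by (simp add: mult_le_0_iff)
  with t(2) a show False by linarith
qed

section \<open>Eigenvalues\<close>

lemma spectrum_iff:
  assumes "M \<in> carrier_mat n n"
  shows "\<mu> \<in> spectrum M \<longleftrightarrow> (\<exists>v\<in>carrier_vec n. v \<noteq> 0\<^sub>v n \<and> M *\<^sub>v v = \<mu> \<cdot>\<^sub>v v)"
  using assms by (auto simp: spectrum_def eigenvalue_def eigenvector_def)

text \<open>This is the triangular form of a matrix as an induction principle: by the factorization of the
  characteristic polynomial, some product of factors \<open>T - \<mu>\<close> with \<open>\<mu>\<close> in the spectrum annihilates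
  the space, so a property of \<open>x0\<close> that fails at \<open>0\<close> is lost at one particular factor. With
  \<open>P x\<close> taken as \<open>K x \<noteq> 0\<close> it gives eigenvectors of \<open>T\<close> modulo the kernel of \<open>K\<close>.\<close>
lemma eigen_step:
  fixes T :: "complex mat"
  assumes T: "T \<in> carrier_mat n n" and x0: "x0 \<in> carrier_vec n"
    and P: "P x0" and P0: "\<not> P (0\<^sub>v n)"
  obtains x \<mu> where "x \<in> carrier_vec n" "\<mu> \<in> spectrum T" "P x" "\<not> P (T *\<^sub>v x - \<mu> \<cdot>\<^sub>v x)"
proof -
  obtain as where as: "char_poly T = (\<Prod>a\<leftarrow>as. [:- a, 1:])"
    using char_poly_factorized[OF T] by blast
  obtain U V W where schur: "schur_decomposition T as = (U, V, W)"
    by (cases "schur_decomposition T as") auto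
  note sch = schur_decomposition[OF T as schur]
  hence wit: "similar_mat_wit T U V W" and ut: "upper_triangular U" and dg: "diag_mat U = as" by auto
  note wd = similar_mat_witD2[OF T wit]
  have U: "U \<in> carrier_mat n n" and V: "V \<in> carrier_mat n n" and W: "W \<in> carrier_mat n n"
    and TV: "T = V * U * W" and VW: "V * W = 1\<^sub>m n" and WV: "W * V = 1\<^sub>m n" using wd by auto
  have diag_spec: "U $$ (k, k) \<in> spectrum T" if "k < n" for k
  proof -
    have "U $$ (k, k) \<in> set as"
      using that U unfolding dg[symmetric] diag_mat_def by auto
    hence "poly (char_poly T) (U $$ (k, k)) = 0"
      unfolding as by (rule linear_poly_root)
    thus ?thesis using spectrum_root_char_poly[OF T] by auto
  qed
  \<comment> \<open>The vector \<open>V v\<close> lies in the span of the first \<open>k\<close> vectors of the triangularizing basis,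
    and \<open>T - U\<^sub>k\<^sub>k\<close> maps this span to the span of one vector less.\<close>
  have descent: "\<exists>x\<in>carrier_vec n. \<exists>\<mu>\<in>spectrum T. P x \<and> \<not> P (T *\<^sub>v x - \<mu> \<cdot>\<^sub>v x)"
    if "k \<le> n" "v \<in> carrier_vec n" "\<And>i. k \<le> i \<Longrightarrow> i < n \<Longrightarrow> vec_index v i = 0" "P (V *\<^sub>v v)" for k v
    using that
  proof (induction k arbitrary: v)
    case 0
    have "v = 0\<^sub>v n" using 0 by (intro eq_vecI) auto
    with 0 P0 V show ?case by (simp add: mat_vec_linear)
  next
    case (Suc k)
    define \<mu> where "\<mu> = U $$ (k, k)"
    define w where "w = U *\<^sub>v v - \<mu> \<cdot>\<^sub>v v"
    have w: "w \<in> carrier_vec n" using U Suc.prems by (simp add: w_def)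
    have w0: "vec_index w i = 0" if "k \<le> i" "i < n" for i
    proof -
      have "vec_index (U *\<^sub>v v) i = (\<Sum>j<n. U $$ (i, j) * vec_index v j)"
        using U Suc.prems that by (subst mult_mat_vec_index) auto
      also have "\<dots> = (\<Sum>j<n. if j = i then U $$ (i, i) * vec_index v i else 0)"
      proof (rule sum.cong)
        fix j assume j: "j \<in> {..<n}"
        consider "j < i" | "j = i" | "j > i" by linarith
        thus "U $$ (i, j) * vec_index v j = (if j = i then U $$ (i, i) * vec_index v i else 0)"
        proof cases
          case 1 thus ?thesis using ut U \<open>i < n\<close> by (auto simp: upper_triangular_def)
        next
          case 3 thus ?thesis using Suc.prems(3)[of j] j that by auto
        qed simp
      qed simp
      also have "\<dots> = U $$ (i, i) * vec_index v i" using that by simp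
      finally have "vec_index (U *\<^sub>v v) i = U $$ (i, i) * vec_index v i" .
      moreover have "i > k \<Longrightarrow> vec_index v i = 0" using Suc.prems(3)[of i] that by simp
      ultimately show ?thesis
        using that Suc.prems(2) U by (cases "i = k") (auto simp: w_def \<mu>_def simp del: index_mult_mat_vec)
    qed
    have Vw: "V *\<^sub>v w = T *\<^sub>v (V *\<^sub>v v) - \<mu> \<cdot>\<^sub>v (V *\<^sub>v v)"
    proof -
      have "T *\<^sub>v (V *\<^sub>v v) = V *\<^sub>v (U *\<^sub>v ((W * V) *\<^sub>v v))"
        using U V W Suc.prems(2) unfolding TV by (simp add: mat_vec_linear)
      also have "\<dots> = V *\<^sub>v (U *\<^sub>v v)" using WV Suc.prems(2) by simp
      finally show ?thesis using U V Suc.prems(2) by (simp add: w_def mat_vec_linear)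
    qed
    show ?case
    proof (cases "P (V *\<^sub>v w)")
      case True
      thus ?thesis using Suc.IH[OF _ w w0] Suc.prems(1) by simp
    next
      case False
      hence "\<not> P (T *\<^sub>v (V *\<^sub>v v) - \<mu> \<cdot>\<^sub>v (V *\<^sub>v v))" by (simp add: Vw)
      thus ?thesis
        using Suc.prems diag_spec[of k] V unfolding \<mu>_def
        by (intro bexI[of _ "V *\<^sub>v v"] bexI[of _ "U $$ (k, k)"]) auto
    qed
  qed
  have "V *\<^sub>v (W *\<^sub>v x0) = (V * W) *\<^sub>v x0"
    using V W x0 by (simp add: mat_vec_linear)
  hence "P (V *\<^sub>v (W *\<^sub>v x0))" using VW x0 P by simp
  with descent[of n "W *\<^sub>v x0"] W x0 that show thesis by auto
qed

lemma injective_mat_inverse: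
  fixes M :: "complex mat"
  assumes M: "M \<in> carrier_mat n n"
    and inj: "\<And>x. x \<in> carrier_vec n \<Longrightarrow> M *\<^sub>v x = 0\<^sub>v n \<Longrightarrow> x = 0\<^sub>v n"
  obtains N where "N \<in> carrier_mat n n" "M * N = 1\<^sub>m n" "N * M = 1\<^sub>m n"
proof -
  have "Determinant.det M \<noteq> 0"
    using det_0_iff_vec_prod_zero[OF M] inj by blast
  from det_non_zero_imp_unit[OF M this, of "()"]
  show thesis using that by (auto simp: Units_def ring_mat_def)
qed

lemma spectrum_adjoint:
  fixes M :: "complex mat"
  assumes M: "M \<in> carrier_mat n n"
  shows "\<mu> \<in> spectrum (mat_adjoint M) \<longleftrightarrow> cnj \<mu> \<in> spectrum M"
proof -
  have dir: "cnj \<mu> \<in> spectrum M" if M: "M \<in> carrier_mat n n" and mu: "\<mu> \<in> spectrum (mat_adjoint M)"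
    for M :: "complex mat" and \<mu>
  proof (rule ccontr)
    assume nspec: "cnj \<mu> \<notin> spectrum M"
    define K where "K = M - cnj \<mu> \<cdot>\<^sub>m 1\<^sub>m n"
    have K: "K \<in> carrier_mat n n" using M by (simp add: K_def)
    have Kx: "K *\<^sub>v x = M *\<^sub>v x - cnj \<mu> \<cdot>\<^sub>v x" if "x \<in> carrier_vec n" for x
      using that M by (simp add: K_def mat_vec_linear)
    have "x = 0\<^sub>v n" if x: "x \<in> carrier_vec n" "K *\<^sub>v x = 0\<^sub>v n" for x
    proof -
      have "M *\<^sub>v x = cnj \<mu> \<cdot>\<^sub>v x"
      proof (rule eq_vecI)
        fix i assume "i < dim_vec (cnj \<mu> \<cdot>\<^sub>v x)"
        moreover have "vec_index (M *\<^sub>v x - cnj \<mu> \<cdot>\<^sub>v x) i = vec_index (0\<^sub>v n) i"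
          using x Kx by simp
        ultimately show "vec_index (M *\<^sub>v x) i = vec_index (cnj \<mu> \<cdot>\<^sub>v x) i"
          using x M by (simp del: index_mult_mat_vec)
      qed (use x M in auto)
      thus ?thesis using nspec x by (auto simp: spectrum_iff[OF M])
    qed
    from injective_mat_inverse[OF K this] obtain N where
      N: "N \<in> carrier_mat n n" "K * N = 1\<^sub>m n" by metis
    obtain w where w: "w \<in> carrier_vec n" "w \<noteq> 0\<^sub>v n" "mat_adjoint M *\<^sub>v w = \<mu> \<cdot>\<^sub>v w"
      using mu M spectrum_iff[of "mat_adjoint M" n] by auto
    have "w \<bullet>c w = (K *\<^sub>v (N *\<^sub>v w)) \<bullet>c w"
      using N K w by (simp flip: mat_vec_linear(10))
    also have "\<dots> = (N *\<^sub>v w) \<bullet>c (mat_adjoint M *\<^sub>v w) - cnj \<mu> * ((N *\<^sub>v w) \<bullet>c w)"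
      using N(1) M w by (simp add: Kx cprod_linear cprod_adjoint)
    also have "\<dots> = 0" unfolding w(3) by (simp add: cprod_linear)
    finally show False using w cprod_self_eq_0(1)[of w] by simp
  qed
  show ?thesis
    using dir[OF M, of \<mu>] dir[of "mat_adjoint M" "cnj \<mu>"] M by auto
qed

section \<open>Lyapunov inequalities\<close>

definition hurwitz_mat :: "complex mat \<Rightarrow> bool" where
  "hurwitz_mat M \<longleftrightarrow> spectrum M \<subseteq> {z. Re z < 0}"

lemma tendsto_0_of_contracting_recursion:
  fixes a b :: "nat \<Rightarrow> complex"
  assumes rec: "\<And>k. a (Suc k) = q * a k + b k" and q: "cmod q < 1" and b: "b \<longlonglongrightarrow> 0"
  shows "a \<longlonglongrightarrow> 0"
proof (rule LIMSEQ_I)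
  fix r :: real assume r: "r > 0"
  define e where "e = r / 2"
  have e: "e > 0" using r by (simp add: e_def)
  have "e * (1 - cmod q) > 0" using e q by simp
  from LIMSEQ_D[OF b this] obtain N where N: "\<And>k. k \<ge> N \<Longrightarrow> cmod (b k) < e * (1 - cmod q)"
    by auto
  have bound: "cmod (a (N + j)) \<le> e + cmod q ^ j * cmod (a N)" for j
  proof (induction j)
    case 0 thus ?case using e by simp
  next
    case (Suc j)
    have "cmod (a (N + Suc j)) \<le> cmod q * cmod (a (N + j)) + cmod (b (N + j))"
      by (simp add: rec norm_triangle_le norm_mult)
    also have "\<dots> \<le> cmod q * (e + cmod q ^ j * cmod (a N)) + e * (1 - cmod q)"
      using Suc N[of "N + j"] by (intro add_mono mult_left_mono) auto
    also have "\<dots> = e + cmod q ^ Suc j * cmod (a N)" by (simp add: algebra_simps)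
    finally show ?case .
  qed
  have "(\<lambda>j. cmod q ^ j * cmod (a N)) \<longlonglongrightarrow> 0 * cmod (a N)"
    using q by (intro tendsto_intros LIMSEQ_power_zero) auto
  hence "\<forall>\<^sub>F j in sequentially. cmod q ^ j * cmod (a N) < e"
    using e by (intro order_tendstoD) auto
  then obtain J where J: "\<And>j. j \<ge> J \<Longrightarrow> cmod q ^ j * cmod (a N) < e"
    by (auto simp: eventually_sequentially)
  show "\<exists>no. \<forall>n\<ge>no. norm (a n - 0) < r"
  proof (intro exI[of _ "N + J"] allI impI)
    fix n assume "n \<ge> N + J"
    hence "cmod (a n) \<le> e + cmod q ^ (n - N) * cmod (a N)" "n - N \<ge> J"
      using bound[of "n - N"] by auto
    with J[of "n - N"] show "norm (a n - 0) < r" by (simp add: e_def)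
  qed
qed

text \<open>The Cayley transform \<open>(I + M)(I - M)\<^sup>-\<^sup>1\<close> maps the open left half-plane to the unit disc, so its
  powers tend to zero, and it turns the Lyapunov inequality into monotonicity of the form along
  these powers. A form that decreases to zero is nonnegative.\<close>
lemma lyapunov_nonneg:
  assumes M: "M \<in> carrier_mat n n" and stable: "hurwitz_mat M"
    and D: "D \<in> carrier_mat n n" and herm: "hermitian_mat D"
    and decr: "\<And>x. x \<in> carrier_vec n \<Longrightarrow> Re ((M *\<^sub>v x) \<bullet>c (D *\<^sub>v x)) \<le> 0"
    and x: "x \<in> carrier_vec n"
  shows "0 \<le> qform D x"
proof -
  define E F where "E = 1\<^sub>m n - M" and "F = 1\<^sub>m n + M"
  have E: "E \<in> carrier_mat n n" and F: "F \<in> carrier_mat n n" using M by (auto simp: E_def F_def)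
  have Ev: "E *\<^sub>v v = v - M *\<^sub>v v" and Fv: "F *\<^sub>v v = v + M *\<^sub>v v" if "v \<in> carrier_vec n" for v
    using that M by (simp_all add: E_def F_def mat_vec_linear)
  have "v = 0\<^sub>v n" if v: "v \<in> carrier_vec n" "E *\<^sub>v v = 0\<^sub>v n" for v
  proof (rule ccontr)
    assume "v \<noteq> 0\<^sub>v n"
    moreover have "M *\<^sub>v v = 1 \<cdot>\<^sub>v v"
    proof (rule eq_vecI)
      fix i assume "i < dim_vec (1 \<cdot>\<^sub>v v)"
      moreover have "vec_index (v - M *\<^sub>v v) i = vec_index (0\<^sub>v n) i" using v Ev by simp
      ultimately show "vec_index (M *\<^sub>v v) i = vec_index (1 \<cdot>\<^sub>v v) i"
        using v M by (simp del: index_mult_mat_vec)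
    qed (use v M in auto)
    ultimately have "1 \<in> spectrum M" using v by (auto simp: spectrum_iff[OF M])
    thus False using stable by (auto simp: hurwitz_mat_def)
  qed
  from injective_mat_inverse[OF E this] obtain H where
    H: "H \<in> carrier_mat n n" and EH: "E * H = 1\<^sub>m n" and HE: "H * E = 1\<^sub>m n" by metis
  define \<Phi> where "\<Phi> = F * H"
  have Phi: "\<Phi> \<in> carrier_mat n n" using F H by (simp add: \<Phi>_def)
  have PhiE: "\<Phi> *\<^sub>v (E *\<^sub>v v) = F *\<^sub>v v" if "v \<in> carrier_vec n" for v
  proof -
    have "\<Phi> *\<^sub>v (E *\<^sub>v v) = F *\<^sub>v ((H * E) *\<^sub>v v)"
      using that E F H by (simp add: \<Phi>_def mat_vec_linear)
    thus ?thesis using HE that by simp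
  qed
  have EHv: "E *\<^sub>v (H *\<^sub>v v) = v" if "v \<in> carrier_vec n" for v
    using that E H EH by (simp flip: mat_vec_linear(10))
  have spec: "cmod \<phi> < 1" if "\<phi> \<in> spectrum \<Phi>" for \<phi>
  proof -
    obtain y where y: "y \<in> carrier_vec n" "y \<noteq> 0\<^sub>v n" "\<Phi> *\<^sub>v y = \<phi> \<cdot>\<^sub>v y"
      using \<open>\<phi> \<in> spectrum \<Phi>\<close> spectrum_iff[OF Phi] by blast
    define z where "z = H *\<^sub>v y"
    have z: "z \<in> carrier_vec n" "E *\<^sub>v z = y" using y H EHv by (auto simp: z_def)
    have z0: "z \<noteq> 0\<^sub>v n" using z y E by (auto simp: mat_vec_linear)
    have eq: "z + M *\<^sub>v z = \<phi> \<cdot>\<^sub>v (z - M *\<^sub>v z)"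
      using PhiE[OF z(1)] y z by (simp add: Ev Fv)
    have eqi: "(1 + \<phi>) * vec_index (M *\<^sub>v z) i = (\<phi> - 1) * vec_index z i" if "i < n" for i
    proof -
      have "vec_index (z + M *\<^sub>v z) i = vec_index (\<phi> \<cdot>\<^sub>v (z - M *\<^sub>v z)) i" by (simp only: eq)
      thus ?thesis using that z M by (simp add: algebra_simps del: index_mult_mat_vec)
    qed
    have "\<phi> \<noteq> -1"
    proof
      assume "\<phi> = -1"
      hence "z = 0\<^sub>v n" using eqi z by (intro eq_vecI) auto
      with z0 show False by simp
    qed
    hence nz: "1 + \<phi> \<noteq> 0" by (metis add.commute add_eq_0_iff)
    define \<mu> where "\<mu> = (\<phi> - 1) / (1 + \<phi>)"
    have "M *\<^sub>v z = \<mu> \<cdot>\<^sub>v z"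
    proof (rule eq_vecI)
      fix i assume "i < dim_vec (\<mu> \<cdot>\<^sub>v z)"
      thus "vec_index (M *\<^sub>v z) i = vec_index (\<mu> \<cdot>\<^sub>v z) i"
        using eqi[of i] nz z by (simp add: \<mu>_def field_simps del: index_mult_mat_vec)
    qed (use z M in auto)
    hence "\<mu> \<in> spectrum M" using z z0 by (auto simp: spectrum_iff[OF M])
    hence mu: "Re \<mu> < 0" using stable by (auto simp: hurwitz_mat_def)
    have "Re \<mu> * (cmod (1 + \<phi>))\<^sup>2 = (cmod \<phi>)\<^sup>2 - 1"
    proof -
      have "\<mu> * (cmod (1 + \<phi>))\<^sup>2 = (\<phi> - 1) * cnj (1 + \<phi>)"
        using nz unfolding \<mu>_def complex_norm_square by (simp add: field_simps)
      hence "Re (\<mu> * (cmod (1 + \<phi>))\<^sup>2) = Re ((\<phi> - 1) * cnj (1 + \<phi>))" by simp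
      thus ?thesis unfolding cmod_power2[of \<phi>] by (simp add: algebra_simps power2_eq_square)
    qed
    moreover have "Re \<mu> * (cmod (1 + \<phi>))\<^sup>2 < 0" using mu nz by (simp add: mult_neg_pos)
    ultimately have "(cmod \<phi>)\<^sup>2 < 1\<^sup>2" by simp
    thus ?thesis by (rule power_less_imp_less_base) simp
  qed
  \<comment> \<open>Modulo the vectors with orbit tending to zero, some vector would be an eigenvector of \<open>\<Phi>\<close>; but then
    its orbit satisfies a contracting recursion with a null sequence as perturbation.\<close>
  define orb where "orb v k = ((\<lambda>u. \<Phi> *\<^sub>v u) ^^ k) v" for v k
  have orb_carrier: "orb v k \<in> carrier_vec n" if "v \<in> carrier_vec n" for v k
    using that Phi by (induction k) (auto simp: orb_def)
  have orb_Suc: "orb v (Suc k) = \<Phi> *\<^sub>v orb v k" for v k by (simp add: orb_def)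
  have orb_lim: "(\<lambda>k. vec_index (orb v k) i) \<longlonglongrightarrow> 0" if v: "v \<in> carrier_vec n" and i: "i < n" for v i
  proof (rule ccontr)
    define P where "P u \<longleftrightarrow> \<not> (\<forall>i<n. (\<lambda>k. vec_index (orb u k) i) \<longlonglongrightarrow> 0)" for u
    assume "\<not> (\<lambda>k. vec_index (orb v k) i) \<longlonglongrightarrow> 0"
    hence Pv: "P v" using i by (auto simp: P_def)
    have "orb (0\<^sub>v n) k = 0\<^sub>v n" for k
      using Phi by (induction k) (auto simp: orb_def mat_vec_linear)
    hence P0: "\<not> P (0\<^sub>v n)" by (simp add: P_def)
    from eigen_step[OF Phi v, of P, OF Pv P0] obtain y \<phi> where
      y: "y \<in> carrier_vec n" and phi: "\<phi> \<in> spectrum \<Phi>" and "P y" "\<not> P (\<Phi> *\<^sub>v y - \<phi> \<cdot>\<^sub>v y)" by metis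
    define r where "r = \<Phi> *\<^sub>v y - \<phi> \<cdot>\<^sub>v y"
    have r: "r \<in> carrier_vec n" using y by (simp add: r_def)
    have rlim: "(\<lambda>k. vec_index (orb r k) j) \<longlonglongrightarrow> 0" if "j < n" for j
      using \<open>\<not> P (\<Phi> *\<^sub>v y - \<phi> \<cdot>\<^sub>v y)\<close> that by (auto simp: P_def r_def)
    have rel: "orb y (Suc k) = \<phi> \<cdot>\<^sub>v orb y k + orb r k" for k
    proof (induction k)
      case 0
      show ?case using y Phi by (intro eq_vecI) (auto simp: orb_def r_def simp del: index_mult_mat_vec)
    next
      case (Suc k)
      have "orb y (Suc (Suc k)) = \<Phi> *\<^sub>v (\<phi> \<cdot>\<^sub>v orb y k + orb r k)"
        using Suc by (simp add: orb_Suc)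
      thus ?case using orb_carrier[OF y, of k] orb_carrier[OF r, of k] Phi
        by (simp add: mat_vec_linear orb_Suc)
    qed
    have "(\<lambda>k. vec_index (orb y k) j) \<longlonglongrightarrow> 0" if "j < n" for j
    proof (rule tendsto_0_of_contracting_recursion[OF _ spec[OF phi] rlim[OF that]])
      fix k show "vec_index (orb y (Suc k)) j = \<phi> * vec_index (orb y k) j + vec_index (orb r k) j"
        using that orb_carrier[OF y, of k] orb_carrier[OF r, of k] by (simp add: rel)
    qed
    with \<open>P y\<close> show False by (simp add: P_def)
  qed
  define f where "f v = qform D v" for v
  have mono: "f (\<Phi> *\<^sub>v v) \<le> f v" if v: "v \<in> carrier_vec n" for v
  proof -
    define z where "z = H *\<^sub>v v"
    have z: "z \<in> carrier_vec n" "E *\<^sub>v z = v" using v H EHv by (auto simp: z_def)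
    have Mz: "M *\<^sub>v z \<in> carrier_vec n" using M by simp
    have sw: "(D *\<^sub>v (M *\<^sub>v z)) \<bullet>c z = (M *\<^sub>v z) \<bullet>c (D *\<^sub>v z)"
      by (rule hermitian_cprod[OF herm D Mz z(1)])
    have cc: "Re ((D *\<^sub>v z) \<bullet>c (M *\<^sub>v z)) = Re ((M *\<^sub>v z) \<bullet>c (D *\<^sub>v z))"
      using cprod_commute[of "D *\<^sub>v z" "M *\<^sub>v z"] D M by simp
    have "f (\<Phi> *\<^sub>v v) - f v = f (z + M *\<^sub>v z) - f (z - M *\<^sub>v z)"
      using PhiE[OF z(1)] z by (simp add: Ev Fv)
    also have "\<dots> = 4 * Re ((M *\<^sub>v z) \<bullet>c (D *\<^sub>v z))"
      using D M z sw cc by (simp add: f_def mat_vec_linear cprod_linear)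
    also have "\<dots> \<le> 0" using decr[OF z(1)] by simp
    finally show ?thesis by simp
  qed
  have below: "f (orb x k) \<le> f x" for k
  proof (induction k)
    case (Suc k)
    thus ?case using mono[OF orb_carrier[OF x, of k]] by (simp add: orb_Suc)
  qed (simp add: orb_def)
  have f_sum: "f v = Re (\<Sum>i<n. (\<Sum>j<n. D $$ (i, j) * vec_index v j) * cnj (vec_index v i))"
    if "v \<in> carrier_vec n" for v
    using that D by (simp add: f_def cprod_sum mult_mat_vec_index del: index_mult_mat_vec)
  have "(\<lambda>k. Re (\<Sum>i<n. (\<Sum>j<n. D $$ (i, j) * vec_index (orb x k) j) * cnj (vec_index (orb x k) i)))
      \<longlonglongrightarrow> Re (\<Sum>i<n. (\<Sum>j<n. D $$ (i, j) * 0) * cnj 0)"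
    using x by (intro tendsto_intros orb_lim) auto
  hence "(\<lambda>k. f (orb x k)) \<longlonglongrightarrow> 0" using f_sum[OF orb_carrier[OF x]] by simp
  from LIMSEQ_le_const2[OF this] below show ?thesis unfolding f_def by blast
qed

section \<open>The Hamiltonian matrix of a Riccati equation\<close>

text \<open>The eigenvector test of Hautus for controllability. For \<open>S = B B\<^sup>*\<close> the condition \<open>S p = 0\<close>
  says \<open>B\<^sup>* p = 0\<close>.\<close>
definition controllable_pair :: "nat \<Rightarrow> complex mat \<Rightarrow> complex mat \<Rightarrow> bool" where
  "controllable_pair n G S \<longleftrightarrow>
     (\<forall>p\<in>carrier_vec n. \<forall>\<mu>. mat_adjoint G *\<^sub>v p = \<mu> \<cdot>\<^sub>v p \<longrightarrow> S *\<^sub>v p = 0\<^sub>v n \<longrightarrow> p = 0\<^sub>v n)"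

text \<open>The sign convention is that of the closed loop matrix \<open>G + S X\<close>, which is stable if its spectrum
  lies in the left half-plane.\<close>
definition riccati_residual ::
    "complex mat \<Rightarrow> complex mat \<Rightarrow> complex mat \<Rightarrow> complex mat \<Rightarrow>
     complex mat" where
  "riccati_residual G S Q X = X * G + mat_adjoint G * X + Q + X * S * X"

lemma vec_diff_eq_0_iff:
  fixes x y :: "complex Matrix.vec"
  assumes "x \<in> carrier_vec n" "y \<in> carrier_vec n"
  shows "x - y = 0\<^sub>v n \<longleftrightarrow> x = y"
proof
  assume eq: "x - y = 0\<^sub>v n"
  show "x = y"
  proof (rule eq_vecI)
    fix i assume "i < dim_vec y"
    moreover have "vec_index (x - y) i = vec_index (0\<^sub>v n) i" by (simp only: eq)
    ultimately show "vec_index x i = vec_index y i" using assms by simp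
  qed (use assms in auto)
qed (use assms in auto)

text \<open>The eigenvalues may be put on the diagonal of a triangular form in any order, so every initial
  segment of a factorization of the characteristic polynomial has an invariant subspace. The
  columns of \<open>V\<close> are a basis of it.\<close>
lemma leading_invariant_subspace:
  fixes M :: "complex mat"
  assumes M: "M \<in> carrier_mat m m"
    and cp: "char_poly M = (\<Prod>e\<leftarrow>es1 @ es2. [:- e, 1:])"
  defines "a \<equiv> length es1"
  obtains V T where "V \<in> carrier_mat m a" "T \<in> carrier_mat a a" "spectrum T \<subseteq> set es1"
    and "\<And>x. x \<in> carrier_vec a \<Longrightarrow> M *\<^sub>v (V *\<^sub>v x) = V *\<^sub>v (T *\<^sub>v x)"
    and "\<And>x. x \<in> carrier_vec a \<Longrightarrow> V *\<^sub>v x = 0\<^sub>v m \<Longrightarrow> x = 0\<^sub>v a"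
proof -
  obtain U P W where schur: "schur_decomposition M (es1 @ es2) = (U, P, W)"
    by (cases "schur_decomposition M (es1 @ es2)") auto
  note sch = schur_decomposition[OF M cp schur]
  hence wit: "similar_mat_wit M U P W" and ut: "upper_triangular U"
    and dg: "diag_mat U = es1 @ es2" by auto
  note wd = similar_mat_witD2[OF M wit]
  have U: "U \<in> carrier_mat m m" and P: "P \<in> carrier_mat m m" and W: "W \<in> carrier_mat m m"
    and MP: "M = P * U * W" and WP: "W * P = 1\<^sub>m m" using wd by auto
  have am: "a \<le> m" using arg_cong[OF dg, of length] U by (simp add: diag_mat_def a_def)
  define V where "V = Matrix.mat m a (\<lambda>ij. P $$ ij)"
  define T where "T = Matrix.mat a a (\<lambda>ij. U $$ ij)"
  have V: "V \<in> carrier_mat m a" and T: "T \<in> carrier_mat a a" by (auto simp: V_def T_def)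
  have split: "(\<Sum>j<m. f j) = (\<Sum>j<a. f j)" if "\<And>j. a \<le> j \<Longrightarrow> j < m \<Longrightarrow> f j = 0"
    for f :: "nat \<Rightarrow> complex"
    using that am by (intro sum.mono_neutral_right) auto
  \<comment> \<open>the coordinates of a vector of the subspace, filled up with zeros\<close>
  define pad where "pad x = Matrix.vec m (\<lambda>i. if i < a then vec_index x i else 0)"
    for x :: "complex Matrix.vec"
  have pad: "pad x \<in> carrier_vec m" for x by (simp add: pad_def)
  have Vx: "V *\<^sub>v x = P *\<^sub>v pad x" if "x \<in> carrier_vec a" for x
  proof (rule eq_vecI)
    fix i assume "i < dim_vec (P *\<^sub>v pad x)"
    thus "vec_index (V *\<^sub>v x) i = vec_index (P *\<^sub>v pad x) i"
      using that P V pad[of x] am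
      by (simp add: mult_mat_vec_index split V_def pad_def del: index_mult_mat_vec)
  qed (use P V in auto)
  have Upad: "U *\<^sub>v pad x = pad (T *\<^sub>v x)" if x: "x \<in> carrier_vec a" for x
  proof (rule eq_vecI)
    fix i assume "i < dim_vec (pad (T *\<^sub>v x))"
    hence i: "i < m" by (simp add: pad_def)
    have "vec_index (U *\<^sub>v pad x) i = (\<Sum>j<a. U $$ (i, j) * vec_index x j)"
      using i U pad[of x] am by (simp add: mult_mat_vec_index split pad_def del: index_mult_mat_vec)
    also have "\<dots> = vec_index (pad (T *\<^sub>v x)) i"
    proof (cases "i < a")
      case True
      thus ?thesis using i T x
        by (simp add: mult_mat_vec_index pad_def T_def del: index_mult_mat_vec)
    next
      case False
      hence "U $$ (i, j) = 0" if "j < a" for j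
        using ut i U that by (auto simp: upper_triangular_def)
      thus ?thesis using i False by (simp add: pad_def)
    qed
    finally show "vec_index (U *\<^sub>v pad x) i = vec_index (pad (T *\<^sub>v x)) i" .
  qed (use U in \<open>auto simp: pad_def\<close>)
  have WPv: "W *\<^sub>v (P *\<^sub>v v) = v" if "v \<in> carrier_vec m" for v
    using that W P WP by (simp flip: mat_vec_linear(10))
  show thesis
  proof (rule that[OF V T])
    have utT: "upper_triangular T"
      using ut U am by (auto simp: upper_triangular_def T_def)
    have "diag_mat T = take a (diag_mat U)"
      using am U by (intro nth_equalityI) (auto simp: diag_mat_def T_def)
    hence dT: "diag_mat T = es1" by (simp add: dg a_def)
    show "spectrum T \<subseteq> set es1"
    proof
      fix \<mu> assume "\<mu> \<in> spectrum T"
      hence "poly (\<Prod>e\<leftarrow>es1. [:- e, 1:]) \<mu> = 0"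
        using spectrum_root_char_poly[OF T] char_poly_upper_triangular[OF T utT] dT by simp
      thus "\<mu> \<in> set es1" by (auto simp: poly_prod_list prod_list_zero_iff)
    qed
  next
    fix x :: "complex Matrix.vec" assume x: "x \<in> carrier_vec a"
    have "M *\<^sub>v (V *\<^sub>v x) = P *\<^sub>v (U *\<^sub>v (W *\<^sub>v (P *\<^sub>v pad x)))"
      using P U W pad[of x] unfolding Vx[OF x] MP by (simp add: mat_vec_linear)
    also have "\<dots> = V *\<^sub>v (T *\<^sub>v x)"
      using T WPv[OF pad] by (simp add: Upad[OF x] Vx)
    finally show "M *\<^sub>v (V *\<^sub>v x) = V *\<^sub>v (T *\<^sub>v x)" .
    assume "V *\<^sub>v x = 0\<^sub>v m"
    hence "pad x = 0\<^sub>v m" using WPv[OF pad[of x]] W by (simp add: Vx[OF x] mat_vec_linear)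
    hence "vec_index (pad x) i = 0" if "i < a" for i using that am by simp
    thus "x = 0\<^sub>v a" using x am by (intro eq_vecI) (auto simp: pad_def)
  qed
qed

text \<open>An invariant subspace of the Hamiltonian matrix on which no two eigenvalues satisfy
  \<open>\<mu> + cnj \<nu> = 0\<close> is isotropic for the form \<open>\<langle>p, x'\<rangle> - \<langle>x, p'\<rangle>\<close>, because the Hamiltonian matrix is
  skew for this form. By controllability an isotropic invariant subspace has no nonzero vector
  with zero state component.\<close>
lemma hamiltonian_subspace:
  fixes G S Q :: "complex mat"
  assumes G: "G \<in> carrier_mat n n" and S: "S \<in> carrier_mat n n" and Q: "Q \<in> carrier_mat n n"
    and psd: "psd_mat S" and hermQ: "hermitian_mat Q" and ctrb: "controllable_pair n G S"
    and V1: "V1 \<in> carrier_mat n a" and V2: "V2 \<in> carrier_mat n a" and T: "T \<in> carrier_mat a a"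
    and inv1: "\<And>x. x \<in> carrier_vec a \<Longrightarrow> G *\<^sub>v (V1 *\<^sub>v x) + S *\<^sub>v (V2 *\<^sub>v x) = V1 *\<^sub>v (T *\<^sub>v x)"
    and inv2: "\<And>x. x \<in> carrier_vec a \<Longrightarrow>
      - (Q *\<^sub>v (V1 *\<^sub>v x)) - mat_adjoint G *\<^sub>v (V2 *\<^sub>v x) = V2 *\<^sub>v (T *\<^sub>v x)"
    and inj: "\<And>x. x \<in> carrier_vec a \<Longrightarrow> V1 *\<^sub>v x = 0\<^sub>v n \<Longrightarrow> V2 *\<^sub>v x = 0\<^sub>v n \<Longrightarrow> x = 0\<^sub>v a"
    and nonres: "\<And>\<mu> \<nu>. \<mu> \<in> spectrum T \<Longrightarrow> \<nu> \<in> spectrum T \<Longrightarrow> \<mu> + cnj \<nu> \<noteq> 0"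
  shows "\<And>x y. x \<in> carrier_vec a \<Longrightarrow> y \<in> carrier_vec a \<Longrightarrow>
      (V2 *\<^sub>v x) \<bullet>c (V1 *\<^sub>v y) = (V1 *\<^sub>v x) \<bullet>c (V2 *\<^sub>v y)"
    and "\<And>x. x \<in> carrier_vec a \<Longrightarrow> V1 *\<^sub>v x = 0\<^sub>v n \<Longrightarrow> x = 0\<^sub>v a"
proof -
  have hermS: "hermitian_mat S" using psd by (simp add: psd_mat_def)
  define \<Omega> where "\<Omega> = mat_adjoint V1 * V2 - mat_adjoint V2 * V1"
  have Om: "\<Omega> \<in> carrier_mat a a" using V1 V2 by (simp add: \<Omega>_def)
  have form: "(\<Omega> *\<^sub>v x) \<bullet>c y = (V2 *\<^sub>v x) \<bullet>c (V1 *\<^sub>v y) - (V1 *\<^sub>v x) \<bullet>c (V2 *\<^sub>v y)"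
    if "x \<in> carrier_vec a" "y \<in> carrier_vec a" for x y
    using that V1 V2 by (simp add: \<Omega>_def mat_vec_linear cprod_linear cprod_adjoint)
  have skew: "\<Omega> *\<^sub>v (T *\<^sub>v x) = - (mat_adjoint T *\<^sub>v (\<Omega> *\<^sub>v x))" if x: "x \<in> carrier_vec a" for x
  proof (rule vec_eq_by_cprod[of _ a])
    fix y :: "complex Matrix.vec" assume y: "y \<in> carrier_vec a"
    define u p v q where "u = V1 *\<^sub>v x" and "p = V2 *\<^sub>v x" and "v = V1 *\<^sub>v y" and "q = V2 *\<^sub>v y"
    have c: "u \<in> carrier_vec n" "p \<in> carrier_vec n" "v \<in> carrier_vec n" "q \<in> carrier_vec n"
      using V1 V2 by (auto simp: u_def p_def v_def q_def)
    have ux: "V1 *\<^sub>v (T *\<^sub>v x) = G *\<^sub>v u + S *\<^sub>v p" "V2 *\<^sub>v (T *\<^sub>v x) = - (Q *\<^sub>v u) - mat_adjoint G *\<^sub>v p"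
      using inv1[OF x] inv2[OF x] by (simp_all add: u_def p_def)
    have uy: "V1 *\<^sub>v (T *\<^sub>v y) = G *\<^sub>v v + S *\<^sub>v q" "V2 *\<^sub>v (T *\<^sub>v y) = - (Q *\<^sub>v v) - mat_adjoint G *\<^sub>v q"
      using inv1[OF y] inv2[OF y] by (simp_all add: v_def q_def)
    have *: "(S *\<^sub>v p) \<bullet>c q = p \<bullet>c (S *\<^sub>v q)" "(Q *\<^sub>v u) \<bullet>c v = u \<bullet>c (Q *\<^sub>v v)"
      "(G *\<^sub>v u) \<bullet>c q = u \<bullet>c (mat_adjoint G *\<^sub>v q)" "(mat_adjoint G *\<^sub>v p) \<bullet>c v = p \<bullet>c (G *\<^sub>v v)"
      using hermitian_cprod[OF hermS S] hermitian_cprod[OF hermQ Q] c G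
      by (simp_all add: cprod_adjoint)
    have Tx: "T *\<^sub>v x \<in> carrier_vec a" "T *\<^sub>v y \<in> carrier_vec a" using T by simp_all
    have "(- (mat_adjoint T *\<^sub>v (\<Omega> *\<^sub>v x))) \<bullet>c y = - ((\<Omega> *\<^sub>v x) \<bullet>c (T *\<^sub>v y))"
      using y T Om by (simp add: cprod_linear cprod_adjoint)
    also have "\<dots> = - (p \<bullet>c (V1 *\<^sub>v (T *\<^sub>v y)) - u \<bullet>c (V2 *\<^sub>v (T *\<^sub>v y)))"
      using form[OF x Tx(2)] by (simp add: u_def p_def)
    also have "\<dots> = (V2 *\<^sub>v (T *\<^sub>v x)) \<bullet>c v - (V1 *\<^sub>v (T *\<^sub>v x)) \<bullet>c q"
      unfolding ux uy using c G S Q * by (simp add: cprod_linear)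
    also have "\<dots> = (\<Omega> *\<^sub>v (T *\<^sub>v x)) \<bullet>c y"
      using form[OF Tx(1) y] by (simp add: v_def q_def)
    finally show "(\<Omega> *\<^sub>v (T *\<^sub>v x)) \<bullet>c y = (- (mat_adjoint T *\<^sub>v (\<Omega> *\<^sub>v x))) \<bullet>c y" by simp
  qed (use Om T in auto)
  have Om0: "\<Omega> *\<^sub>v x = 0\<^sub>v a" if x: "x \<in> carrier_vec a" for x
  proof (rule ccontr)
    assume "\<Omega> *\<^sub>v x \<noteq> 0\<^sub>v a"
    then obtain y \<mu> where y: "y \<in> carrier_vec a" and mu: "\<mu> \<in> spectrum T"
      and ne: "\<Omega> *\<^sub>v y \<noteq> 0\<^sub>v a" and "\<Omega> *\<^sub>v (T *\<^sub>v y - \<mu> \<cdot>\<^sub>v y) = 0\<^sub>v a"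
      using eigen_step[OF T x, of "\<lambda>x. \<Omega> *\<^sub>v x \<noteq> 0\<^sub>v a"] Om mat_vec_linear(5)[of \<Omega> a]
      by (metis carrier_matD)
    hence "\<Omega> *\<^sub>v (T *\<^sub>v y) - \<mu> \<cdot>\<^sub>v (\<Omega> *\<^sub>v y) = 0\<^sub>v a" using Om T by (simp add: mat_vec_linear)
    hence "\<Omega> *\<^sub>v (T *\<^sub>v y) = \<mu> \<cdot>\<^sub>v (\<Omega> *\<^sub>v y)" using Om by (simp add: vec_diff_eq_0_iff)
    hence eq: "- (mat_adjoint T *\<^sub>v (\<Omega> *\<^sub>v y)) = \<mu> \<cdot>\<^sub>v (\<Omega> *\<^sub>v y)" using skew[OF y] by simp
    have "mat_adjoint T *\<^sub>v (\<Omega> *\<^sub>v y) = - (- (mat_adjoint T *\<^sub>v (\<Omega> *\<^sub>v y)))" by simp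
    also have "\<dots> = (- \<mu>) \<cdot>\<^sub>v (\<Omega> *\<^sub>v y)" unfolding eq by (intro eq_vecI) auto
    finally have "mat_adjoint T *\<^sub>v (\<Omega> *\<^sub>v y) = (- \<mu>) \<cdot>\<^sub>v (\<Omega> *\<^sub>v y)" .
    moreover have "\<Omega> *\<^sub>v y \<in> carrier_vec a" "mat_adjoint T \<in> carrier_mat a a" using Om T by simp_all
    ultimately have "- \<mu> \<in> spectrum (mat_adjoint T)"
      using ne spectrum_iff[of "mat_adjoint T" a] by blast
    hence "cnj (- \<mu>) \<in> spectrum T" by (simp only: spectrum_adjoint[OF T])
    from nonres[OF mu this] show False by simp
  qed
  show iso: "(V2 *\<^sub>v x) \<bullet>c (V1 *\<^sub>v y) = (V1 *\<^sub>v x) \<bullet>c (V2 *\<^sub>v y)"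
    if "x \<in> carrier_vec a" "y \<in> carrier_vec a" for x y
    using form[OF that] Om0[OF that(1)] that by (simp add: cprod_linear)
  show "x = 0\<^sub>v a" if x: "x \<in> carrier_vec a" and V1x: "V1 *\<^sub>v x = 0\<^sub>v n" for x
  proof (rule ccontr)
    assume ne: "x \<noteq> 0\<^sub>v a"
    have ker: "S *\<^sub>v (V2 *\<^sub>v y) = 0\<^sub>v n" "V1 *\<^sub>v (T *\<^sub>v y) = 0\<^sub>v n"
      if y: "y \<in> carrier_vec a" "V1 *\<^sub>v y = 0\<^sub>v n" for y
    proof -
      have V1T: "S *\<^sub>v (V2 *\<^sub>v y) = V1 *\<^sub>v (T *\<^sub>v y)"
        using inv1[OF y(1)] y(2) G S by (simp add: mat_vec_linear)
      have "(S *\<^sub>v (V2 *\<^sub>v y)) \<bullet>c (V2 *\<^sub>v y) = (V2 *\<^sub>v (T *\<^sub>v y)) \<bullet>c (V1 *\<^sub>v y)"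
        using iso[of "T *\<^sub>v y" y] y T by (simp add: V1T)
      also have "\<dots> = 0" using V2 by (simp add: y(2) cprod_linear)
      finally show "S *\<^sub>v (V2 *\<^sub>v y) = 0\<^sub>v n"
        using V2 by (intro psd_mat_form_eq_0[OF S psd]) auto
      thus "V1 *\<^sub>v (T *\<^sub>v y) = 0\<^sub>v n" using V1T by simp
    qed
    define P where "P y \<longleftrightarrow> y \<in> carrier_vec a \<and> V1 *\<^sub>v y = 0\<^sub>v n \<and> y \<noteq> 0\<^sub>v a" for y
    obtain y \<mu> where Py: "P y" and nP: "\<not> P (T *\<^sub>v y - \<mu> \<cdot>\<^sub>v y)"
      using eigen_step[OF T x, of P] x V1x ne unfolding P_def by blast
    have y: "y \<in> carrier_vec a" "V1 *\<^sub>v y = 0\<^sub>v n" "y \<noteq> 0\<^sub>v a" using Py by (auto simp: P_def)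
    have "V1 *\<^sub>v (T *\<^sub>v y - \<mu> \<cdot>\<^sub>v y) = 0\<^sub>v n"
      using ker[OF y(1,2)] y V1 T by (simp add: mat_vec_linear)
    hence "T *\<^sub>v y - \<mu> \<cdot>\<^sub>v y = 0\<^sub>v a" using nP y by (simp add: P_def)
    hence Ty: "T *\<^sub>v y = \<mu> \<cdot>\<^sub>v y" using y T by (simp add: vec_diff_eq_0_iff)
    define p where "p = V2 *\<^sub>v y"
    have p: "p \<in> carrier_vec n" using V2 by (simp add: p_def)
    have "- (mat_adjoint G *\<^sub>v p) = \<mu> \<cdot>\<^sub>v p"
      using inv2[OF y(1)] y V2 Q G unfolding Ty by (simp add: p_def mat_vec_linear)
    hence eq: "- (mat_adjoint G *\<^sub>v p) = \<mu> \<cdot>\<^sub>v p" .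
    have "mat_adjoint G *\<^sub>v p = - (- (mat_adjoint G *\<^sub>v p))" by simp
    also have "\<dots> = (- \<mu>) \<cdot>\<^sub>v p" unfolding eq by (intro eq_vecI) auto
    finally have "mat_adjoint G *\<^sub>v p = (- \<mu>) \<cdot>\<^sub>v p" .
    hence "p = 0\<^sub>v n"
      using ctrb[unfolded controllable_pair_def] ker(1)[OF y(1,2)] p unfolding p_def[symmetric] by blast
    thus False using inj[OF y(1,2)] y(3) by (simp add: p_def)
  qed
qed

lemma injective_mat_dim_le:
  fixes V :: "complex mat"
  assumes V: "V \<in> carrier_mat n a"
    and inj: "\<And>x. x \<in> carrier_vec a \<Longrightarrow> V *\<^sub>v x = 0\<^sub>v n \<Longrightarrow> x = 0\<^sub>v a"
  shows "a \<le> n"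
proof (rule ccontr)
  assume "\<not> a \<le> n"
  hence na: "n < a" by simp
  define K where "K = Matrix.mat a a (\<lambda>(i, j). if i < n then V $$ (i, j) else 0)"
  have K: "K \<in> carrier_mat a a" by (simp add: K_def)
  have "transpose_mat K *\<^sub>v unit_vec a n = 0\<^sub>v a"
    using na by (intro eq_vecI) (auto simp: K_def)
  hence "Determinant.det (transpose_mat K) = 0"
    using det_0_iff_vec_prod_zero[of "transpose_mat K" a] K na
    by (metis transpose_carrier_mat unit_vec_carrier unit_vec_nonzero)
  hence "Determinant.det K = 0" by (simp add: det_transpose[OF K])
  then obtain v where v: "v \<in> carrier_vec a" "v \<noteq> 0\<^sub>v a" "K *\<^sub>v v = 0\<^sub>v a"
    using det_0_iff_vec_prod_zero[OF K] by blast
  have "V *\<^sub>v v = 0\<^sub>v n"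
  proof (rule eq_vecI)
    fix i assume "i < dim_vec (0\<^sub>v n :: complex Matrix.vec)"
    hence i: "i < n" by simp
    have "vec_index (V *\<^sub>v v) i = vec_index (K *\<^sub>v v) i"
      using i na v(1) V K by (simp add: mult_mat_vec_index K_def del: index_mult_mat_vec)
    thus "vec_index (V *\<^sub>v v) i = vec_index (0\<^sub>v n) i" using i na by (simp add: v(3))
  qed (use V in auto)
  with inj v show False by blast
qed

lemma riccati_residual_mult_vec:
  assumes "G \<in> carrier_mat n n" "S \<in> carrier_mat n n" "Q \<in> carrier_mat n n" "X \<in> carrier_mat n n"
    and "x \<in> carrier_vec n"
  shows "riccati_residual G S Q X *\<^sub>v x =
    X *\<^sub>v (G *\<^sub>v x) + mat_adjoint G *\<^sub>v (X *\<^sub>v x) + Q *\<^sub>v x + X *\<^sub>v (S *\<^sub>v (X *\<^sub>v x))"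
  using assms by (simp add: riccati_residual_def mat_vec_linear)


text \<open>The state component is injective on the subspace spanned by the columns of \<open>(V1, V2)\<close>, which bounds
  its dimension by \<open>n\<close>. If the dimension is \<open>n\<close>, the subspace is the graph of \<open>X = V2 V1\<^sup>-\<^sup>1\<close>:
  isotropy says that \<open>X\<close> is Hermitian, and invariance is the Riccati equation.\<close>
lemma hamiltonian_subspace_solution:
  fixes G S Q :: "complex mat"
  assumes G: "G \<in> carrier_mat n n" and S: "S \<in> carrier_mat n n" and Q: "Q \<in> carrier_mat n n"
    and psd: "psd_mat S" and hermQ: "hermitian_mat Q" and ctrb: "controllable_pair n G S"
    and cp: "char_poly (four_block_mat G S (- Q) (- mat_adjoint G)) = (\<Prod>e\<leftarrow>es1 @ es2. [:- e, 1:])"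
    and nonres: "\<And>\<mu> \<nu>. \<mu> \<in> set es1 \<Longrightarrow> \<nu> \<in> set es1 \<Longrightarrow> \<mu> + cnj \<nu> \<noteq> 0"
  shows "length es1 \<le> n"
    and "length es1 = n \<Longrightarrow> \<exists>X\<in>carrier_mat n n. hermitian_mat X \<and>
      riccati_residual G S Q X = 0\<^sub>m n n \<and> spectrum (G + S * X) \<subseteq> set es1"
proof -
  define H where "H = four_block_mat G S (- Q) (- mat_adjoint G)"
  define a where "a = length es1"
  have H: "H \<in> carrier_mat (n + n) (n + n)" using G S Q by (simp add: H_def)
  obtain V T where V: "V \<in> carrier_mat (n + n) a" and T: "T \<in> carrier_mat a a"
    and spT: "spectrum T \<subseteq> set es1"
    and HV: "\<And>x. x \<in> carrier_vec a \<Longrightarrow> H *\<^sub>v (V *\<^sub>v x) = V *\<^sub>v (T *\<^sub>v x)"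
    and injV: "\<And>x. x \<in> carrier_vec a \<Longrightarrow> V *\<^sub>v x = 0\<^sub>v (n + n) \<Longrightarrow> x = 0\<^sub>v a"
    using leading_invariant_subspace[OF H cp[folded H_def]] unfolding a_def by metis
  define V1 where "V1 = Matrix.mat n a (\<lambda>(i, j). V $$ (i, j))"
  define V2 where "V2 = Matrix.mat n a (\<lambda>(i, j). V $$ (i + n, j))"
  have V1: "V1 \<in> carrier_mat n a" and V2: "V2 \<in> carrier_mat n a" by (auto simp: V1_def V2_def)
  have Vx: "V *\<^sub>v x = (V1 *\<^sub>v x) @\<^sub>v (V2 *\<^sub>v x)" if "x \<in> carrier_vec a" for x
  proof (rule eq_vecI)
    fix i assume "i < dim_vec ((V1 *\<^sub>v x) @\<^sub>v (V2 *\<^sub>v x))"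
    hence "i < n + n" using V1 V2 by simp
    thus "vec_index (V *\<^sub>v x) i = vec_index ((V1 *\<^sub>v x) @\<^sub>v (V2 *\<^sub>v x)) i"
      using that V V1 V2
      by (auto simp: mult_mat_vec_index V1_def V2_def simp del: index_mult_mat_vec)
  qed (use V V1 V2 in auto)
  have inv: "G *\<^sub>v (V1 *\<^sub>v x) + S *\<^sub>v (V2 *\<^sub>v x) = V1 *\<^sub>v (T *\<^sub>v x)"
    "- (Q *\<^sub>v (V1 *\<^sub>v x)) - mat_adjoint G *\<^sub>v (V2 *\<^sub>v x) = V2 *\<^sub>v (T *\<^sub>v x)"
    if x: "x \<in> carrier_vec a" for x
  proof -
    have "H *\<^sub>v (V *\<^sub>v x) = (G *\<^sub>v (V1 *\<^sub>v x) + S *\<^sub>v (V2 *\<^sub>v x)) @\<^sub>v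
        ((- Q) *\<^sub>v (V1 *\<^sub>v x) + (- mat_adjoint G) *\<^sub>v (V2 *\<^sub>v x))"
      unfolding Vx[OF x] H_def using G S Q V1 V2
      by (intro four_block_mat_mult_vec[of _ n n _ n _ n]) auto
    moreover have "V *\<^sub>v (T *\<^sub>v x) = (V1 *\<^sub>v (T *\<^sub>v x)) @\<^sub>v (V2 *\<^sub>v (T *\<^sub>v x))"
      using T by (intro Vx) simp
    ultimately have "(G *\<^sub>v (V1 *\<^sub>v x) + S *\<^sub>v (V2 *\<^sub>v x)) @\<^sub>v
        ((- Q) *\<^sub>v (V1 *\<^sub>v x) + (- mat_adjoint G) *\<^sub>v (V2 *\<^sub>v x)) =
        (V1 *\<^sub>v (T *\<^sub>v x)) @\<^sub>v (V2 *\<^sub>v (T *\<^sub>v x))" using HV[OF x] by simp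
    hence eqs: "G *\<^sub>v (V1 *\<^sub>v x) + S *\<^sub>v (V2 *\<^sub>v x) = V1 *\<^sub>v (T *\<^sub>v x)"
      "(- Q) *\<^sub>v (V1 *\<^sub>v x) + (- mat_adjoint G) *\<^sub>v (V2 *\<^sub>v x) = V2 *\<^sub>v (T *\<^sub>v x)"
      using append_vec_eq[of "G *\<^sub>v (V1 *\<^sub>v x) + S *\<^sub>v (V2 *\<^sub>v x)" n "V1 *\<^sub>v (T *\<^sub>v x)"] S V1 by auto
    show "G *\<^sub>v (V1 *\<^sub>v x) + S *\<^sub>v (V2 *\<^sub>v x) = V1 *\<^sub>v (T *\<^sub>v x)" by (rule eqs(1))
    show "- (Q *\<^sub>v (V1 *\<^sub>v x)) - mat_adjoint G *\<^sub>v (V2 *\<^sub>v x) = V2 *\<^sub>v (T *\<^sub>v x)"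
      unfolding eqs(2)[symmetric] using Q G V1 V2
      by (intro eq_vecI) (auto simp: mat_vec_linear simp del: index_mult_mat_vec)
  qed
  have inj: "x = 0\<^sub>v a" if "x \<in> carrier_vec a" "V1 *\<^sub>v x = 0\<^sub>v n" "V2 *\<^sub>v x = 0\<^sub>v n" for x
  proof (rule injV[OF that(1)])
    show "V *\<^sub>v x = 0\<^sub>v (n + n)" unfolding Vx[OF that(1)] that(2,3) by (intro eq_vecI) auto
  qed
  have nonresT: "\<mu> + cnj \<nu> \<noteq> 0" if "\<mu> \<in> spectrum T" "\<nu> \<in> spectrum T" for \<mu> \<nu>
    using that spT nonres by blast
  have inj1: "x = 0\<^sub>v a" if "x \<in> carrier_vec a" "V1 *\<^sub>v x = 0\<^sub>v n" for x
    by (rule hamiltonian_subspace(2)[OF G S Q psd hermQ ctrb V1 V2 T])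
      (fact inv inj nonresT that)+
  have iso: "(V2 *\<^sub>v x) \<bullet>c (V1 *\<^sub>v y) = (V1 *\<^sub>v x) \<bullet>c (V2 *\<^sub>v y)"
    if "x \<in> carrier_vec a" "y \<in> carrier_vec a" for x y
    by (rule hamiltonian_subspace(1)[OF G S Q psd hermQ ctrb V1 V2 T])
      (fact inv inj nonresT that)+
  show "length es1 \<le> n" using injective_mat_dim_le[OF V1 inj1] by (simp add: a_def)
  assume "length es1 = n"
  hence an: "a = n" by (simp add: a_def)
  note V1 = V1[unfolded an] and V2 = V2[unfolded an] and T = T[unfolded an]
  obtain W where W: "W \<in> carrier_mat n n" and VW: "V1 * W = 1\<^sub>m n" and WV: "W * V1 = 1\<^sub>m n"
    using injective_mat_inverse[OF V1 inj1[unfolded an]] by metis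
  have V1W: "V1 *\<^sub>v (W *\<^sub>v u) = u" and WV1: "W *\<^sub>v (V1 *\<^sub>v u) = u" if "u \<in> carrier_vec n" for u
    using that V1 W VW WV by (simp_all flip: mat_vec_linear(10))
  define X where "X = V2 * W"
  have X: "X \<in> carrier_mat n n" using V2 W by (simp add: X_def)
  have XV1: "X *\<^sub>v (V1 *\<^sub>v x) = V2 *\<^sub>v x" if "x \<in> carrier_vec n" for x
    using that V1 V2 W WV1 by (simp add: X_def mat_vec_linear)
  have herm: "hermitian_mat X"
  proof (rule hermitian_matI[OF X])
    fix u w :: "complex Matrix.vec" assume u: "u \<in> carrier_vec n" and w: "w \<in> carrier_vec n"
    have "W *\<^sub>v u \<in> carrier_vec n" "W *\<^sub>v w \<in> carrier_vec n" using W by auto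
    thus "(X *\<^sub>v u) \<bullet>c w = u \<bullet>c (X *\<^sub>v w)"
      using iso[of "W *\<^sub>v u" "W *\<^sub>v w"] XV1[of "W *\<^sub>v u"] XV1[of "W *\<^sub>v w"] V1W[OF u] V1W[OF w]
      by (simp add: an)
  qed
  have closed: "(G + S * X) *\<^sub>v (V1 *\<^sub>v x) = V1 *\<^sub>v (T *\<^sub>v x)" if x: "x \<in> carrier_vec n" for x
    using inv(1)[unfolded an, OF x] XV1[OF x] G S X V1 by (simp add: mat_vec_linear)
  have "riccati_residual G S Q X = 0\<^sub>m n n"
  proof (rule mat_eq_by_mult_vec[of _ n n])
    fix u :: "complex Matrix.vec" assume u: "u \<in> carrier_vec n"
    define x where "x = W *\<^sub>v u"
    have x: "x \<in> carrier_vec n" "V1 *\<^sub>v x = u" using W V1W[OF u] by (auto simp: x_def)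
    have Tx: "T *\<^sub>v x \<in> carrier_vec n" using T by simp
    have Xu: "X *\<^sub>v u = V2 *\<^sub>v x" using XV1[OF x(1)] x(2) by simp
    have "X *\<^sub>v (G *\<^sub>v u + S *\<^sub>v (X *\<^sub>v u)) = V2 *\<^sub>v (T *\<^sub>v x)"
      using inv(1)[unfolded an, OF x(1)] XV1[OF Tx] by (simp add: Xu x(2))
    hence 1: "X *\<^sub>v (G *\<^sub>v u) + X *\<^sub>v (S *\<^sub>v (X *\<^sub>v u)) = V2 *\<^sub>v (T *\<^sub>v x)"
      using X G S by (simp add: mat_vec_linear)
    have 2: "- (Q *\<^sub>v u) - mat_adjoint G *\<^sub>v (X *\<^sub>v u) = V2 *\<^sub>v (T *\<^sub>v x)"
      using inv(2)[unfolded an, OF x(1)] by (simp add: Xu x(2))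
    show "riccati_residual G S Q X *\<^sub>v u = 0\<^sub>m n n *\<^sub>v u"
    proof (rule eq_vecI)
      fix i assume "i < dim_vec (0\<^sub>m n n *\<^sub>v u)"
      hence i: "i < n" by simp
      have "vec_index (X *\<^sub>v (G *\<^sub>v u) + X *\<^sub>v (S *\<^sub>v (X *\<^sub>v u))) i =
          vec_index (- (Q *\<^sub>v u) - mat_adjoint G *\<^sub>v (X *\<^sub>v u)) i" by (simp only: 1 2)
      thus "vec_index (riccati_residual G S Q X *\<^sub>v u) i = vec_index (0\<^sub>m n n *\<^sub>v u) i"
        unfolding riccati_residual_mult_vec[OF G S Q X u]
        using i u G S Q X by (simp add: algebra_simps del: index_mult_mat_vec)
    qed (use X u in \<open>auto simp: riccati_residual_def\<close>)
  qed (use G S Q X in \<open>auto simp: riccati_residual_def\<close>)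
  moreover have "spectrum (G + S * X) \<subseteq> set es1"
  proof
    fix \<mu> assume mu: "\<mu> \<in> spectrum (G + S * X)"
    have GSX: "G + S * X \<in> carrier_mat n n" using S X by simp
    obtain u where u: "u \<in> carrier_vec n" "u \<noteq> 0\<^sub>v n" "(G + S * X) *\<^sub>v u = \<mu> \<cdot>\<^sub>v u"
      using mu spectrum_iff[OF GSX] by blast
    define x where "x = W *\<^sub>v u"
    have x: "x \<in> carrier_vec n" "V1 *\<^sub>v x = u" using W V1W[OF u(1)] by (auto simp: x_def)
    have Tx: "T *\<^sub>v x \<in> carrier_vec n" using T by simp
    have "T *\<^sub>v x = W *\<^sub>v (V1 *\<^sub>v (T *\<^sub>v x))" using WV1[OF Tx] by simp
    also have "\<dots> = W *\<^sub>v (\<mu> \<cdot>\<^sub>v u)" using closed[OF x(1)] u(3) by (simp add: x(2))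
    also have "\<dots> = \<mu> \<cdot>\<^sub>v x" using W u(1) by (simp add: mat_vec_linear x_def)
    finally have "T *\<^sub>v x = \<mu> \<cdot>\<^sub>v x" .
    moreover have "x \<noteq> 0\<^sub>v n" using u(2) x(2) V1 by (auto simp: mat_vec_linear)
    ultimately have "\<mu> \<in> spectrum T" using x(1) by (auto simp: spectrum_iff[OF T])
    thus "\<mu> \<in> set es1" using spT by blast
  qed
  ultimately show "\<exists>X\<in>carrier_mat n n. hermitian_mat X \<and>
      riccati_residual G S Q X = 0\<^sub>m n n \<and> spectrum (G + S * X) \<subseteq> set es1"
    using X herm by blast
qed

lemma prod_list_filter_compl:
  fixes f :: "'a \<Rightarrow> 'b :: comm_monoid_mult"
  shows "prod_list (map f xs) =
    prod_list (map f (filter P xs)) * prod_list (map f (filter (\<lambda>x. \<not> P x) xs))"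
  by (induction xs) (auto simp: mult_ac)

text \<open>The \<open>2 n\<close> eigenvalues are distributed over the two open half-planes, and neither half-plane can
  contain more than \<open>n\<close> of them. So each contains exactly \<open>n\<close>.\<close>
lemma hamiltonian_solutions:
  fixes G S Q :: "complex mat"
  assumes G: "G \<in> carrier_mat n n" and S: "S \<in> carrier_mat n n" and Q: "Q \<in> carrier_mat n n"
    and psd: "psd_mat S" and hermQ: "hermitian_mat Q" and ctrb: "controllable_pair n G S"
    and no_imag: "\<And>x p \<mu>. x \<in> carrier_vec n \<Longrightarrow> p \<in> carrier_vec n \<Longrightarrow> Re \<mu> = 0 \<Longrightarrow>
      G *\<^sub>v x + S *\<^sub>v p = \<mu> \<cdot>\<^sub>v x \<Longrightarrow> - (Q *\<^sub>v x) - mat_adjoint G *\<^sub>v p = \<mu> \<cdot>\<^sub>v p \<Longrightarrow>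
      x = 0\<^sub>v n \<and> p = 0\<^sub>v n"
  shows "\<exists>X\<in>carrier_mat n n. hermitian_mat X \<and> riccati_residual G S Q X = 0\<^sub>m n n \<and>
      spectrum (G + S * X) \<subseteq> {z. Re z < 0}"
    and "\<exists>X\<in>carrier_mat n n. hermitian_mat X \<and> riccati_residual G S Q X = 0\<^sub>m n n \<and>
      spectrum (G + S * X) \<subseteq> {z. 0 < Re z}"
proof -
  define H where "H = four_block_mat G S (- Q) (- mat_adjoint G)"
  have H: "H \<in> carrier_mat (n + n) (n + n)" using G S Q by (simp add: H_def)
  obtain es where es: "char_poly H = (\<Prod>e\<leftarrow>es. [:- e, 1:])" and len: "length es = n + n"
    using char_poly_factorized[OF H] by blast
  have Re_nz: "Re \<mu> \<noteq> 0" if "\<mu> \<in> set es" for \<mu>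
  proof
    assume re: "Re \<mu> = 0"
    have "poly (char_poly H) \<mu> = 0" unfolding es by (rule linear_poly_root[OF that])
    hence "\<mu> \<in> spectrum H" using spectrum_root_char_poly[OF H] by auto
    then obtain v where v: "v \<in> carrier_vec (n + n)" "v \<noteq> 0\<^sub>v (n + n)" "H *\<^sub>v v = \<mu> \<cdot>\<^sub>v v"
      using spectrum_iff[OF H] by blast
    define x p where "x = vec_first v n" and "p = vec_last v n"
    have x: "x \<in> carrier_vec n" and p: "p \<in> carrier_vec n" by (simp_all add: x_def p_def)
    have vxp: "v = x @\<^sub>v p" using v(1) by (simp add: x_def p_def)
    have "H *\<^sub>v v = (G *\<^sub>v x + S *\<^sub>v p) @\<^sub>v ((- Q) *\<^sub>v x + (- mat_adjoint G) *\<^sub>v p)"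
      unfolding vxp H_def using G S Q x p
      by (intro four_block_mat_mult_vec[of _ n n _ n _ n]) auto
    moreover have "\<mu> \<cdot>\<^sub>v v = (\<mu> \<cdot>\<^sub>v x) @\<^sub>v (\<mu> \<cdot>\<^sub>v p)"
      unfolding vxp by (intro eq_vecI) auto
    ultimately have "(G *\<^sub>v x + S *\<^sub>v p) @\<^sub>v ((- Q) *\<^sub>v x + (- mat_adjoint G) *\<^sub>v p) =
        (\<mu> \<cdot>\<^sub>v x) @\<^sub>v (\<mu> \<cdot>\<^sub>v p)" using v(3) by simp
    hence eqs: "G *\<^sub>v x + S *\<^sub>v p = \<mu> \<cdot>\<^sub>v x" "(- Q) *\<^sub>v x + (- mat_adjoint G) *\<^sub>v p = \<mu> \<cdot>\<^sub>v p"
      using append_vec_eq[of "G *\<^sub>v x + S *\<^sub>v p" n "\<mu> \<cdot>\<^sub>v x"] S x by auto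
    have "- (Q *\<^sub>v x) - mat_adjoint G *\<^sub>v p = \<mu> \<cdot>\<^sub>v p"
      unfolding eqs(2)[symmetric] using Q G x p
      by (intro eq_vecI) (auto simp: mat_vec_linear simp del: index_mult_mat_vec)
    from no_imag[OF x p re eqs(1) this] have "v = 0\<^sub>v (n + n)"
      unfolding vxp by (intro eq_vecI) auto
    with v(2) show False by simp
  qed
  define neg where "neg = filter (\<lambda>e. Re e < 0) es"
  define pos where "pos = filter (\<lambda>e. \<not> Re e < 0) es"
  have neg: "Re \<mu> < 0" if "\<mu> \<in> set neg" for \<mu> using that by (simp add: neg_def)
  have pos: "0 < Re \<mu>" if "\<mu> \<in> set pos" for \<mu>
    using that Re_nz[of \<mu>] by (auto simp: pos_def)
  have prod_part: "(\<Prod>e\<leftarrow>es. [:- e, 1:]) = (\<Prod>e\<leftarrow>neg. [:- e, 1:]) * (\<Prod>e\<leftarrow>pos. [:- e, 1 :: complex:])"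
    unfolding neg_def pos_def by (rule prod_list_filter_compl)
  have cpn: "char_poly (four_block_mat G S (- Q) (- mat_adjoint G)) = (\<Prod>e\<leftarrow>neg @ pos. [:- e, 1:])"
    and cpp: "char_poly (four_block_mat G S (- Q) (- mat_adjoint G)) = (\<Prod>e\<leftarrow>pos @ neg. [:- e, 1:])"
    using es prod_part by (simp_all only: H_def map_append prod_list.append mult.commute)
  have nn: "\<mu> + cnj \<nu> \<noteq> 0" if "\<mu> \<in> set neg" "\<nu> \<in> set neg" for \<mu> \<nu>
    using neg[OF that(1)] neg[OF that(2)] by (auto simp: complex_eq_iff)
  have pp: "\<mu> + cnj \<nu> \<noteq> 0" if "\<mu> \<in> set pos" "\<nu> \<in> set pos" for \<mu> \<nu>
    using pos[OF that(1)] pos[OF that(2)] by (auto simp: complex_eq_iff)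
  note soln = hamiltonian_subspace_solution[OF G S Q psd hermQ ctrb cpn nn]
  note solp = hamiltonian_subspace_solution[OF G S Q psd hermQ ctrb cpp pp]
  have "length neg + length pos = n + n"
    unfolding len[symmetric] neg_def pos_def by (rule sum_length_filter_compl)
  hence ln: "length neg = n" "length pos = n" using soln(1) solp(1) by auto
  show "\<exists>X\<in>carrier_mat n n. hermitian_mat X \<and> riccati_residual G S Q X = 0\<^sub>m n n \<and>
      spectrum (G + S * X) \<subseteq> {z. Re z < 0}"
    using soln(2) ln(1) neg by blast
  show "\<exists>X\<in>carrier_mat n n. hermitian_mat X \<and> riccati_residual G S Q X = 0\<^sub>m n n \<and>
      spectrum (G + S * X) \<subseteq> {z. 0 < Re z}"
    using solp(2) ln(2) pos by blast
qed

section \<open>Comparison of solutions\<close>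

lemma riccati_residual_form:
  assumes G: "G \<in> carrier_mat n n" and S: "S \<in> carrier_mat n n" and Q: "Q \<in> carrier_mat n n"
    and X: "X \<in> carrier_mat n n" and herm: "hermitian_mat X" and x: "x \<in> carrier_vec n"
  shows "Re ((riccati_residual G S Q X *\<^sub>v x) \<bullet>c x) =
    2 * Re ((G *\<^sub>v x) \<bullet>c (X *\<^sub>v x)) + qform Q x + Re ((S *\<^sub>v (X *\<^sub>v x)) \<bullet>c (X *\<^sub>v x))"
proof -
  have "(X *\<^sub>v (G *\<^sub>v x)) \<bullet>c x = (G *\<^sub>v x) \<bullet>c (X *\<^sub>v x)"
    "(X *\<^sub>v (S *\<^sub>v (X *\<^sub>v x))) \<bullet>c x = (S *\<^sub>v (X *\<^sub>v x)) \<bullet>c (X *\<^sub>v x)"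
    using hermitian_cprod[OF herm X _ x] G S by simp_all
  moreover have "(mat_adjoint G *\<^sub>v (X *\<^sub>v x)) \<bullet>c x = cnj ((G *\<^sub>v x) \<bullet>c (X *\<^sub>v x))"
    using G X x cprod_adjoint[of "X *\<^sub>v x" "mat_adjoint G" x]
      cprod_commute[of "X *\<^sub>v x" "G *\<^sub>v x"] by simp
  ultimately show ?thesis
    using G S Q X x by (simp add: riccati_residual_mult_vec[OF G S Q X x] cprod_linear)
qed

text \<open>The difference of a solution and a subsolution satisfies a Lyapunov inequality for the closed
  loop matrix of the solution.\<close>
lemma riccati_comparison:
  assumes G: "G \<in> carrier_mat n n" and S: "S \<in> carrier_mat n n" and Q: "Q \<in> carrier_mat n n"
    and psdS: "psd_mat S"
    and X: "X \<in> carrier_mat n n" and hermX: "hermitian_mat X"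
    and solX: "riccati_residual G S Q X = 0\<^sub>m n n"
    and Z: "Z \<in> carrier_mat n n" and hermZ: "hermitian_mat Z"
    and subZ: "\<And>x. x \<in> carrier_vec n \<Longrightarrow> Re ((riccati_residual G S Q Z *\<^sub>v x) \<bullet>c x) \<le> 0"
  shows "spectrum (G + S * X) \<subseteq> {z. Re z < 0} \<Longrightarrow> psd_mat (Z - X)"
    and "spectrum (G + S * X) \<subseteq> {z. 0 < Re z} \<Longrightarrow> psd_mat (X - Z)"
proof -
  have hermS: "hermitian_mat S" using psdS by (simp add: psd_mat_def)
  have decr: "Re (((G + S * X) *\<^sub>v x) \<bullet>c ((Z - X) *\<^sub>v x)) \<le> 0" if x: "x \<in> carrier_vec n" for x
  proof -
    define a b c where "a = G *\<^sub>v x" and "b = X *\<^sub>v x" and "c = Z *\<^sub>v x"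
    have abc: "a \<in> carrier_vec n" "b \<in> carrier_vec n" "c \<in> carrier_vec n"
      using G X Z by (auto simp: a_def b_def c_def)
    have 1: "2 * Re (a \<bullet>c b) + qform Q x + qform S b = 0"
      using riccati_residual_form[OF G S Q X hermX x] x
      by (simp add: solX a_def b_def cprod_linear)
    have 2: "2 * Re (a \<bullet>c c) + qform Q x + qform S c \<le> 0"
      using riccati_residual_form[OF G S Q Z hermZ x] subZ[OF x] by (simp add: a_def c_def)
    have "0 \<le> Re ((S *\<^sub>v (c - b)) \<bullet>c (c - b))"
      using psdS abc psd_mat_iff[OF S] by auto
    also have "(S *\<^sub>v (c - b)) \<bullet>c (c - b) =
        (S *\<^sub>v c) \<bullet>c c - (S *\<^sub>v c) \<bullet>c b - (S *\<^sub>v b) \<bullet>c c + (S *\<^sub>v b) \<bullet>c b"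
      using S abc by (simp add: mat_vec_linear cprod_linear)
    also have "(S *\<^sub>v c) \<bullet>c b = cnj ((S *\<^sub>v b) \<bullet>c c)"
      using hermitian_cprod[OF hermS S abc(3,2)] cprod_commute[of c "S *\<^sub>v b"] S abc
      by simp
    finally have 3: "0 \<le> qform S c - 2 * Re ((S *\<^sub>v b) \<bullet>c c) + qform S b"
      by simp
    have "((G + S * X) *\<^sub>v x) \<bullet>c ((Z - X) *\<^sub>v x) =
        a \<bullet>c c - a \<bullet>c b + (S *\<^sub>v b) \<bullet>c c - (S *\<^sub>v b) \<bullet>c b"
      using G S X Z x by (simp add: mat_vec_linear cprod_linear a_def b_def c_def)
    thus ?thesis using 1 2 3 by simp
  qed
  have M: "G + S * X \<in> carrier_mat n n" using S X by simp
  have herm1: "hermitian_mat (Z - X)" and herm2: "hermitian_mat (X - Z)"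
    using hermX hermZ X Z by (auto simp: hermitian_mat_def mat_adjoint_linear)
  have D: "Z - X \<in> carrier_mat n n" "X - Z \<in> carrier_mat n n" using X Z by auto
  show "psd_mat (Z - X)" if "spectrum (G + S * X) \<subseteq> {z. Re z < 0}"
    using lyapunov_nonneg[OF M _ D(1) herm1 decr] that herm1
    by (simp add: psd_mat_iff[OF D(1)] hurwitz_mat_def)
  assume anti: "spectrum (G + S * X) \<subseteq> {z. 0 < Re z}"
  have M': "- (G + S * X) \<in> carrier_mat n n" using M by simp
  have "hurwitz_mat (- (G + S * X))"
    unfolding hurwitz_mat_def
  proof
    fix \<mu> assume "\<mu> \<in> spectrum (- (G + S * X))"
    then obtain v where v: "v \<in> carrier_vec n" "v \<noteq> 0\<^sub>v n" "(- (G + S * X)) *\<^sub>v v = \<mu> \<cdot>\<^sub>v v"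
      using spectrum_iff[OF M'] by blast
    have "(G + S * X) *\<^sub>v v = - ((- (G + S * X)) *\<^sub>v v)"
      using M v(1) by (subst mat_vec_linear(9)) auto
    also have "\<dots> = (- \<mu>) \<cdot>\<^sub>v v" unfolding v(3) by (intro eq_vecI) auto
    finally have "- \<mu> \<in> spectrum (G + S * X)" using v(1,2) spectrum_iff[OF M] by blast
    thus "\<mu> \<in> {z. Re z < 0}" using anti by auto
  qed
  moreover have "Re (((- (G + S * X)) *\<^sub>v x) \<bullet>c ((X - Z) *\<^sub>v x)) \<le> 0" if x: "x \<in> carrier_vec n" for x
  proof -
    have neg: "(- (G + S * X)) *\<^sub>v x = - ((G + S * X) *\<^sub>v x)" "(X - Z) *\<^sub>v x = - ((Z - X) *\<^sub>v x)"
      using M X Z x by (auto intro!: eq_vecI simp: mat_vec_linear simp del: index_mult_mat_vec)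
    show ?thesis unfolding neg using decr[OF x] S X Z x by (simp add: cprod_linear del: index_mult_mat_vec)
  qed
  ultimately show "psd_mat (X - Z)"
    using lyapunov_nonneg[OF M' _ D(2) herm2] herm2 by (simp add: psd_mat_iff[OF D(2)])
qed

section \<open>Limits of matrices\<close>

text \<open>Since matrices of all dimensions share one type, the dimension is a parameter and convergence is
  entrywise convergence.\<close>
definition mat_tendsto :: "nat \<Rightarrow> (nat \<Rightarrow> complex mat) \<Rightarrow> complex mat \<Rightarrow> bool" where
  "mat_tendsto n M L \<longleftrightarrow> (\<forall>k. M k \<in> carrier_mat n n) \<and> L \<in> carrier_mat n n \<and>
     (\<forall>i<n. \<forall>j<n. (\<lambda>k. M k $$ (i, j)) \<longlonglongrightarrow> L $$ (i, j))"

lemma mat_tendstoD: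
  assumes "mat_tendsto n M L"
  shows "M k \<in> carrier_mat n n" "L \<in> carrier_mat n n"
    and "dim_row (M k) = n" "dim_col (M k) = n" "dim_row L = n" "dim_col L = n"
    and "i < n \<Longrightarrow> j < n \<Longrightarrow> (\<lambda>k. M k $$ (i, j)) \<longlonglongrightarrow> L $$ (i, j)"
proof -
  have c: "\<forall>k. M k \<in> carrier_mat n n" "L \<in> carrier_mat n n"
    using assms by (simp_all add: mat_tendsto_def)
  show "M k \<in> carrier_mat n n" "L \<in> carrier_mat n n" using c by simp_all
  thus "dim_row (M k) = n" "dim_col (M k) = n" "dim_row L = n" "dim_col L = n" by simp_all
  show "i < n \<Longrightarrow> j < n \<Longrightarrow> (\<lambda>k. M k $$ (i, j)) \<longlonglongrightarrow> L $$ (i, j)"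
    using assms by (simp add: mat_tendsto_def)
qed

lemma mat_tendsto_const: "M \<in> carrier_mat n n \<Longrightarrow> mat_tendsto n (\<lambda>_. M) M"
  by (simp add: mat_tendsto_def)

lemma mat_tendsto_add:
  assumes "mat_tendsto n M L" "mat_tendsto n M' L'"
  shows "mat_tendsto n (\<lambda>k. M k + M' k) (L + L')"
  unfolding mat_tendsto_def
  by (simp add: mat_tendstoD[OF assms(1)] mat_tendstoD[OF assms(2)] tendsto_add)

lemma mat_tendsto_diff:
  assumes "mat_tendsto n M L" "mat_tendsto n M' L'"
  shows "mat_tendsto n (\<lambda>k. M k - M' k) (L - L')"
  unfolding mat_tendsto_def
  by (simp add: mat_tendstoD[OF assms(1)] mat_tendstoD[OF assms(2)] tendsto_diff)

lemma mat_tendsto_smult: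
  assumes "a \<longlonglongrightarrow> b" "M \<in> carrier_mat n n"
  shows "mat_tendsto n (\<lambda>k. a k \<cdot>\<^sub>m M) (b \<cdot>\<^sub>m M)"
  using assms by (auto simp: mat_tendsto_def intro!: tendsto_mult)

lemma mat_tendsto_mult:
  assumes "mat_tendsto n M L" "mat_tendsto n M' L'"
  shows "mat_tendsto n (\<lambda>k. M k * M' k) (L * L')"
proof -
  note lim = mat_tendstoD[OF assms(1)] mat_tendstoD[OF assms(2)]
  have idx: "(N * N') $$ (i, j) = (\<Sum>l<n. N $$ (i, l) * N' $$ (l, j))"
    if "N \<in> carrier_mat n n" "N' \<in> carrier_mat n n" "i < n" "j < n"
    for N N' :: "complex mat" and i j
    using that by (simp add: scalar_prod_def lessThan_atLeast0)
  have "(\<lambda>k. (M k * M' k) $$ (i, j)) \<longlonglongrightarrow> (L * L') $$ (i, j)" if ij: "i < n" "j < n" for i j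
    unfolding idx[OF lim(1,8) ij] idx[OF lim(2,9) ij]
    by (intro tendsto_sum tendsto_mult lim ij) auto
  thus ?thesis unfolding mat_tendsto_def by (simp add: lim del: index_mult_mat(1))
qed

lemma mat_tendsto_adjoint:
  assumes "mat_tendsto n M L"
  shows "mat_tendsto n (\<lambda>k. mat_adjoint (M k)) (mat_adjoint L)"
  unfolding mat_tendsto_def by (simp add: mat_tendstoD[OF assms] tendsto_cnj)

lemma mat_tendsto_unique:
  assumes "mat_tendsto n M L" "mat_tendsto n M L'"
  shows "L = L'"
proof (rule eq_matI)
  fix i j assume "i < dim_row L'" "j < dim_col L'"
  hence "i < n" "j < n" using assms by (auto simp: mat_tendsto_def)
  thus "L $$ (i, j) = L' $$ (i, j)"
    by (metis LIMSEQ_unique mat_tendstoD(7)[OF assms(1)] mat_tendstoD(7)[OF assms(2)])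
qed (use assms in \<open>auto simp: mat_tendsto_def\<close>)

lemma mat_tendsto_form:
  assumes lim: "mat_tendsto n M L" and x: "x \<in> carrier_vec n"
  shows "(\<lambda>k. Re ((M k *\<^sub>v x) \<bullet>c x)) \<longlonglongrightarrow> qform L x"
proof -
  have form: "(N *\<^sub>v x) \<bullet>c x = (\<Sum>i<n. (\<Sum>j<n. N $$ (i, j) * vec_index x j) * cnj (vec_index x i))"
    if "N \<in> carrier_mat n n" for N
    using that x by (simp add: cprod_sum mult_mat_vec_index del: index_mult_mat_vec)
  note c = mat_tendstoD[OF lim]
  show ?thesis
    unfolding form[OF c(1)] form[OF c(2)] using lim
    by (intro tendsto_intros) (auto simp: mat_tendsto_def)
qed

lemma mat_tendsto_psd:
  assumes lim: "mat_tendsto n M L" and psd: "\<And>k. psd_mat (M k)"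
  shows "psd_mat L"
proof -
  note c = mat_tendstoD[OF lim]
  have "mat_adjoint (M k) = M k" for k using psd by (simp add: psd_mat_def hermitian_mat_def)
  hence "mat_tendsto n M (mat_adjoint L)" using mat_tendsto_adjoint[OF lim] by simp
  hence "mat_adjoint L = L" by (rule mat_tendsto_unique[OF _ lim])
  moreover have "0 \<le> qform L x" if x: "x \<in> carrier_vec n" for x
  proof (rule LIMSEQ_le_const[OF mat_tendsto_form[OF lim x]])
    have "0 \<le> Re ((M k *\<^sub>v x) \<bullet>c x)" for k
      using psd[of k] x psd_mat_iff[OF c(1), of k] by simp
    thus "\<exists>N. \<forall>k\<ge>N. 0 \<le> Re ((M k *\<^sub>v x) \<bullet>c x)" by simp
  qed
  ultimately show ?thesis using c by (simp add: psd_mat_iff[OF c(2)] hermitian_mat_def)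
qed

lemma hermitian_polarization:
  fixes M :: "complex mat"
  assumes M: "M \<in> carrier_mat n n" and herm: "hermitian_mat M"
    and x: "x \<in> carrier_vec n" and y: "y \<in> carrier_vec n"
  defines "q \<equiv> \<lambda>v. qform M v"
  shows "4 * ((M *\<^sub>v x) \<bullet>c y) = complex_of_real (q (x + y)) - complex_of_real (q (x - y)) +
    \<i> * (complex_of_real (q (x + \<i> \<cdot>\<^sub>v y)) - complex_of_real (q (x - \<i> \<cdot>\<^sub>v y)))"
proof -
  have q: "complex_of_real (q v) = (M *\<^sub>v v) \<bullet>c v" if "v \<in> carrier_vec n" for v
    using hermitian_form_real[OF herm M that] by (simp add: q_def complex_eq_iff)
  show ?thesis using M x y
    by (simp add: q mat_vec_linear cprod_linear algebra_simps)
qed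

text \<open>The values of the form on all vectors converge, being monotone and bounded; polarization
  turns this into convergence of the entries.\<close>
lemma hermitian_monotone_limit:
  assumes M: "\<And>k. M k \<in> carrier_mat n n" and herm: "\<And>k. hermitian_mat (M k)"
    and Y: "Y \<in> carrier_mat n n"
    and mono: "\<And>k l. k \<le> l \<Longrightarrow> psd_mat (M l - M k)" and bdd: "\<And>k. psd_mat (Y - M k)"
  obtains L where "mat_tendsto n M L"
proof -
  define q where "q k v = Re ((M k *\<^sub>v v) \<bullet>c v)" for k v
  have conv: "convergent (\<lambda>k. complex_of_real (q k v))" if v: "v \<in> carrier_vec n" for v
  proof -
    have le: "q k v \<le> q l v" if "k \<le> l" for k l
    proof -
      have "0 \<le> Re (((M l - M k) *\<^sub>v v) \<bullet>c v)"
        using mono[OF that] v psd_mat_iff[of "M l - M k" n] M by simp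
      thus ?thesis using M[of k] M[of l] v by (simp add: q_def mat_vec_linear cprod_linear)
    qed
    have ub: "q k v \<le> qform Y v" for k
    proof -
      have "0 \<le> Re (((Y - M k) *\<^sub>v v) \<bullet>c v)"
        using bdd[of k] v psd_mat_iff[of "Y - M k" n] M by simp
      thus ?thesis using M[of k] Y v by (simp add: q_def mat_vec_linear cprod_linear)
    qed
    obtain L where "(\<lambda>k. q k v) \<longlonglongrightarrow> L"
      using incseq_convergent[of "\<lambda>k. q k v" "qform Y v"] le ub
      unfolding incseq_def by metis
    hence "(\<lambda>k. complex_of_real (q k v)) \<longlonglongrightarrow> complex_of_real L" by (rule tendsto_of_real)
    thus ?thesis by (auto simp: convergent_def)
  qed
  have entry: "convergent (\<lambda>k. M k $$ (i, j))" if ij: "i < n" "j < n" for i j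
  proof -
    define x y where "x = (unit_vec n j :: complex Matrix.vec)" and "y = (unit_vec n i :: complex Matrix.vec)"
    have x: "x \<in> carrier_vec n" and y: "y \<in> carrier_vec n" by (simp_all add: x_def y_def)
    have "M k $$ (i, j) = (M k *\<^sub>v x) \<bullet>c y" for k
    proof -
      have "(M k *\<^sub>v x) \<bullet>c y = (\<Sum>l<n. if l = i then vec_index (M k *\<^sub>v x) l else 0)"
        unfolding cprod_sum using ij
        by (intro sum.cong) (auto simp: y_def unit_vec_def simp del: index_mult_mat_vec)
      also have "\<dots> = M k $$ (i, j)" using ij M[of k] by (simp add: x_def)
      finally show ?thesis by simp
    qed
    hence "M k $$ (i, j) * 4 / 4 = (complex_of_real (q k (x + y)) - complex_of_real (q k (x - y)) +
        \<i> * (complex_of_real (q k (x + \<i> \<cdot>\<^sub>v y)) - complex_of_real (q k (x - \<i> \<cdot>\<^sub>v y)))) / 4" for k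
      using hermitian_polarization[OF M herm x y, of k] by (simp add: q_def algebra_simps)
    hence "(\<lambda>k. M k $$ (i, j)) = (\<lambda>k. (complex_of_real (q k (x + y)) - complex_of_real (q k (x - y)) +
        \<i> * (complex_of_real (q k (x + \<i> \<cdot>\<^sub>v y)) - complex_of_real (q k (x - \<i> \<cdot>\<^sub>v y)))) / 4)"
      by (intro ext) simp
    moreover have "convergent (\<lambda>k. (complex_of_real (q k (x + y)) - complex_of_real (q k (x - y)) +
        \<i> * (complex_of_real (q k (x + \<i> \<cdot>\<^sub>v y)) - complex_of_real (q k (x - \<i> \<cdot>\<^sub>v y)))) / 4)"
    proof -
      obtain a b c d where "(\<lambda>k. complex_of_real (q k (x + y))) \<longlonglongrightarrow> a"
        "(\<lambda>k. complex_of_real (q k (x - y))) \<longlonglongrightarrow> b"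
        "(\<lambda>k. complex_of_real (q k (x + \<i> \<cdot>\<^sub>v y))) \<longlonglongrightarrow> c"
        "(\<lambda>k. complex_of_real (q k (x - \<i> \<cdot>\<^sub>v y))) \<longlonglongrightarrow> d"
        using conv[of "x + y"] conv[of "x - y"] conv[of "x + \<i> \<cdot>\<^sub>v y"] conv[of "x - \<i> \<cdot>\<^sub>v y"] x y
        by (auto simp: convergent_def)
      hence "(\<lambda>k. (complex_of_real (q k (x + y)) - complex_of_real (q k (x - y)) +
        \<i> * (complex_of_real (q k (x + \<i> \<cdot>\<^sub>v y)) - complex_of_real (q k (x - \<i> \<cdot>\<^sub>v y)))) / 4)
        \<longlonglongrightarrow> (a - b + \<i> * (c - d)) / 4" by (intro tendsto_intros) auto
      thus ?thesis by (auto simp: convergent_def)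
    qed
    ultimately show ?thesis by (simp only:)
  qed
  define L where "L = Matrix.mat n n (\<lambda>(i, j). lim (\<lambda>k. M k $$ (i, j)))"
  have "mat_tendsto n M L"
    using M entry by (simp add: mat_tendsto_def L_def convergent_LIMSEQ_iff)
  thus thesis by (rule that)
qed

lemma det_tendsto:
  assumes lim: "mat_tendsto n M L"
  shows "(\<lambda>k. Determinant.det (M k)) \<longlonglongrightarrow> Determinant.det L"
proof -
  note c = mat_tendstoD[OF lim]
  have "(\<lambda>k. M k $$ (i, p i)) \<longlonglongrightarrow> L $$ (i, p i)" if "p permutes {0..<n}" "i \<in> {0..<n}" for p i
    using lim that permutes_in_image[OF that(1), of i] by (auto simp: mat_tendsto_def)
  thus ?thesis unfolding det_def'[OF c(1)] det_def'[OF c(2)]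
    by (intro tendsto_sum tendsto_mult tendsto_prod tendsto_const) auto
qed

text \<open>A characteristic polynomial of degree \<open>n\<close> with roots in the left half-plane has absolute value at least
  \<open>(Re \<mu>)\<^sup>n\<close> at every \<open>\<mu>\<close> in the right half-plane, so a limit of Hurwitz matrices has no
  eigenvalue there.\<close>
lemma spectrum_limit_of_hurwitz:
  assumes lim: "mat_tendsto n M L" and stable: "\<And>k. hurwitz_mat (M k)"
  shows "spectrum L \<subseteq> {z. Re z \<le> 0}"
proof (rule subsetI, rule ccontr)
  fix \<mu> assume mu: "\<mu> \<in> spectrum L" and "\<mu> \<notin> {z. Re z \<le> 0}"
  hence pos: "0 < Re \<mu>" by simp
  note c = mat_tendstoD[OF lim]
  have lb: "(Re \<mu>) ^ n \<le> cmod (poly (char_poly (M k)) \<mu>)" for k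
  proof -
    obtain as where as: "char_poly (M k) = (\<Prod>a\<leftarrow>as. [:- a, 1:])" and len: "length as = n"
      using char_poly_factorized[OF c(1)] by blast
    have "Re a < 0" if "a \<in> set as" for a
    proof -
      have "poly (char_poly (M k)) a = 0" unfolding as by (rule linear_poly_root[OF that])
      hence "a \<in> spectrum (M k)" using spectrum_root_char_poly[OF c(1)] by auto
      thus ?thesis using stable[of k] by (auto simp: hurwitz_mat_def)
    qed
    hence "(Re \<mu>) ^ length as \<le> cmod (poly (\<Prod>a\<leftarrow>as. [:- a, 1:]) \<mu>)"
    proof (induction as)
      case (Cons a as)
      have "Re \<mu> \<le> Re (\<mu> - a)" using Cons.prems[of a] by simp
      also have "\<dots> \<le> cmod (\<mu> - a)" by (rule complex_Re_le_cmod)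
      finally have "Re \<mu> \<le> cmod (\<mu> - a)" .
      hence "Re \<mu> * (Re \<mu>) ^ length as \<le> cmod (\<mu> - a) * cmod (poly (\<Prod>a\<leftarrow>as. [:- a, 1:]) \<mu>)"
        using Cons pos by (intro mult_mono) auto
      moreover have "poly (\<Prod>a\<leftarrow>a # as. [:- a, 1:]) \<mu> = (\<mu> - a) * poly (\<Prod>a\<leftarrow>as. [:- a, 1:]) \<mu>"
        by (simp add: algebra_simps)
      ultimately show ?case by (simp only: norm_mult power_Suc length_Cons)
    qed simp
    thus ?thesis by (simp add: as len)
  qed
  have cm: "- char_matrix N \<mu> = \<mu> \<cdot>\<^sub>m 1\<^sub>m n - N" if "N \<in> carrier_mat n n" for N
    using that by (intro eq_matI) (auto simp: char_matrix_def)
  have "mat_tendsto n (\<lambda>k. \<mu> \<cdot>\<^sub>m 1\<^sub>m n - M k) (\<mu> \<cdot>\<^sub>m 1\<^sub>m n - L)"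
    by (intro mat_tendsto_diff mat_tendsto_const lim) simp
  from tendsto_norm[OF det_tendsto[OF this]]
  have "(\<lambda>k. cmod (poly (char_poly (M k)) \<mu>)) \<longlonglongrightarrow> cmod (poly (char_poly L) \<mu>)"
    by (simp only: char_poly_matrix[OF c(1)] char_poly_matrix[OF c(2)] cm[OF c(1)] cm[OF c(2)])
  hence "(Re \<mu>) ^ n \<le> cmod (poly (char_poly L) \<mu>)"
    by (rule LIMSEQ_le_const) (use lb in simp)
  moreover have "poly (char_poly L) \<mu> = 0" using mu spectrum_root_char_poly[OF c(2)] by auto
  ultimately show False using pos zero_less_power[OF pos, of n] by simp
qed

section \<open>The extremal solution\<close>

text \<open>The gain from the input \<open>u\<close> to the state \<open>x\<close> at the frequency \<open>z\<close>, measured by \<open>Q\<close>, is at most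
  one. Away from the spectrum of \<open>G\<close> with \<open>Q = C\<^sup>* C\<close> this is contractivity of
  \<open>C (z - G)\<^sup>-\<^sup>1 B\<close>.\<close>
definition bounded_real_at ::
    "nat \<Rightarrow> nat \<Rightarrow> complex mat \<Rightarrow> complex mat \<Rightarrow> complex mat \<Rightarrow> complex \<Rightarrow> bool" where
  "bounded_real_at n m G B Q z \<longleftrightarrow>
     (\<forall>x\<in>carrier_vec n. \<forall>u\<in>carrier_vec m. G *\<^sub>v x + B *\<^sub>v u = z \<cdot>\<^sub>v x \<longrightarrow>
        qform Q x \<le> Re (u \<bullet>c u))"

definition observable_pair :: "nat \<Rightarrow> complex mat \<Rightarrow> complex mat \<Rightarrow> bool" where
  "observable_pair n G Q \<longleftrightarrow>
     (\<forall>x\<in>carrier_vec n. \<forall>\<mu>. G *\<^sub>v x = \<mu> \<cdot>\<^sub>v x \<longrightarrow> Q *\<^sub>v x = 0\<^sub>v n \<longrightarrow> x = 0\<^sub>v n)"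

lemma gram_psd:
  fixes B :: "complex mat"
  assumes "B \<in> carrier_mat n m"
  shows "psd_mat (B * mat_adjoint B)"
proof -
  have c: "B * mat_adjoint B \<in> carrier_mat n n" using assms by simp
  have "hermitian_mat (B * mat_adjoint B)"
    using assms by (simp add: hermitian_mat_def mat_adjoint_mult)
  moreover have "0 \<le> Re (((B * mat_adjoint B) *\<^sub>v x) \<bullet>c x)" if "x \<in> carrier_vec n" for x
    using that assms cprod_self_Re(1)[of "mat_adjoint B *\<^sub>v x"]
    by (simp add: mat_vec_linear cprod_adjoint)
  ultimately show ?thesis by (simp add: psd_mat_iff[OF c])
qed

lemma gram_form:
  fixes B :: "complex mat"
  assumes "B \<in> carrier_mat n m" "x \<in> carrier_vec n"
  shows "((B * mat_adjoint B) *\<^sub>v x) \<bullet>c x = (mat_adjoint B *\<^sub>v x) \<bullet>c (mat_adjoint B *\<^sub>v x)"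
  using assms by (simp add: mat_vec_linear cprod_adjoint)

lemma cancel_skew_terms:
  fixes a b c \<mu> \<nu> z :: complex
  assumes "a + b = \<mu> * z" "c - a = \<nu> * z" "\<mu> + \<nu> = 0"
  shows "b + c = 0"
proof -
  have "b + c = (a + b) + (c - a)" by simp
  also have "\<dots> = (\<mu> + \<nu>) * z" by (simp only: assms(1,2) distrib_right)
  finally show ?thesis by (simp add: assms(3))
qed

text \<open>At an eigenvector of the Hamiltonian matrix on the imaginary axis the gain \<open>\<langle>Q x, x\<rangle> / |u|\<^sup>2\<close>
  from \<open>u = B\<^sup>* p\<close> to the state \<open>x\<close> would be \<open>1 / r > 1\<close>, unless \<open>u = 0\<close> and \<open>Q x = 0\<close>. In
  this case \<open>x\<close> is an unobservable and \<open>p\<close> an uncontrollable eigenvector, unless they vanish.\<close>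
lemma no_imaginary_hamiltonian_eigenvalue:
  fixes G B Q :: "complex mat" and r :: real
  assumes G: "G \<in> carrier_mat n n" and B: "B \<in> carrier_mat n m" and Q: "Q \<in> carrier_mat n n"
    and psdQ: "psd_mat Q" and ctrb: "controllable_pair n G (B * mat_adjoint B)"
    and obs: "observable_pair n G Q" and r: "0 < r" "r < 1"
    and br: "\<And>z. Re z = 0 \<Longrightarrow> bounded_real_at n m G B Q z"
    and x: "x \<in> carrier_vec n" and p: "p \<in> carrier_vec n" and mu: "Re \<mu> = 0"
    and eq1: "G *\<^sub>v x + (B * mat_adjoint B) *\<^sub>v p = \<mu> \<cdot>\<^sub>v x"
    and eq2: "- ((of_real r \<cdot>\<^sub>m Q) *\<^sub>v x) - mat_adjoint G *\<^sub>v p = \<mu> \<cdot>\<^sub>v p"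
  shows "x = 0\<^sub>v n \<and> p = 0\<^sub>v n"
proof -
  define S where "S = B * mat_adjoint B"
  have S: "S \<in> carrier_mat n n" using B by (simp add: S_def)
  have psdS: "psd_mat S" unfolding S_def by (rule gram_psd[OF B])
  define u where "u = mat_adjoint B *\<^sub>v p"
  have u: "u \<in> carrier_vec m" using B by (simp add: u_def)
  define s where "s = Re (u \<bullet>c u)"
  define t where "t = qform Q x"
  have s: "(S *\<^sub>v p) \<bullet>c p = u \<bullet>c u" using gram_form[OF B p] by (simp add: S_def u_def)
  have Bu: "B *\<^sub>v u = S *\<^sub>v p" using B p by (simp add: u_def S_def mat_vec_linear)
  have "G *\<^sub>v x + B *\<^sub>v u = \<mu> \<cdot>\<^sub>v x" using eq1 by (simp add: Bu S_def)
  hence ts: "t \<le> s" using br[OF mu] x u unfolding bounded_real_at_def s_def t_def by blast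
  have "(G *\<^sub>v x) \<bullet>c p + (S *\<^sub>v p) \<bullet>c p = \<mu> * (x \<bullet>c p)"
    using arg_cong[OF eq1, of "\<lambda>v. v \<bullet>c p"] G S x p by (simp add: S_def[symmetric] cprod_linear)
  moreover have "- r * ((Q *\<^sub>v x) \<bullet>c x) - (G *\<^sub>v x) \<bullet>c p = cnj \<mu> * (x \<bullet>c p)"
    using arg_cong[OF eq2, of "\<lambda>v. x \<bullet>c v"] G Q x p
      hermitian_cprod[OF _ Q x x] psdQ
    by (simp add: mat_vec_linear cprod_linear cprod_adjoint psd_mat_def)
  moreover have "\<mu> + cnj \<mu> = 0" using mu by (simp add: complex_eq_iff)
  ultimately have "(S *\<^sub>v p) \<bullet>c p + (- r * ((Q *\<^sub>v x) \<bullet>c x)) = 0" by (rule cancel_skew_terms)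
  hence "u \<bullet>c u - r * ((Q *\<^sub>v x) \<bullet>c x) = 0" by (simp add: s)
  hence "Re (u \<bullet>c u - r * ((Q *\<^sub>v x) \<bullet>c x)) = 0" by simp
  hence st: "s = r * t" by (simp add: s_def t_def)
  have "0 \<le> t" using psdQ psd_mat_iff[OF Q] x by (simp add: t_def)
  moreover have "r * t \<le> t" using r \<open>0 \<le> t\<close> by (simp add: mult_left_le_one_le)
  ultimately have "t = 0" using st ts r by (metis antisym mult_cancel_right1 order_less_irrefl)
  hence "s = 0" using st by simp
  have Qx: "Q *\<^sub>v x = 0\<^sub>v n" using psd_mat_form_eq_0[OF Q psdQ x] \<open>t = 0\<close> by (simp add: t_def)
  have Sp: "S *\<^sub>v p = 0\<^sub>v n" using psd_mat_form_eq_0[OF S psdS p] \<open>s = 0\<close> by (simp add: s s_def)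
  have "G *\<^sub>v x = \<mu> \<cdot>\<^sub>v x" using eq1 Sp G by (simp add: S_def[symmetric])
  hence x0: "x = 0\<^sub>v n" using obs Qx x unfolding observable_pair_def by blast
  have "mat_adjoint G *\<^sub>v p = (- \<mu>) \<cdot>\<^sub>v p"
  proof (rule eq_vecI)
    fix i assume "i < dim_vec ((- \<mu>) \<cdot>\<^sub>v p)"
    hence i: "i < n" using p by simp
    have "vec_index (- ((of_real r \<cdot>\<^sub>m Q) *\<^sub>v x) - mat_adjoint G *\<^sub>v p) i = vec_index (\<mu> \<cdot>\<^sub>v p) i"
      by (simp only: eq2)
    thus "vec_index (mat_adjoint G *\<^sub>v p) i = vec_index ((- \<mu>) \<cdot>\<^sub>v p) i"
      using i G Q x p Qx by (simp add: mat_vec_linear minus_equation_iff del: index_mult_mat_vec)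
  qed (use G p in auto)
  hence "p = 0\<^sub>v n"
    using ctrb Sp p unfolding controllable_pair_def S_def by blast
  with x0 show ?thesis by simp
qed

text \<open>For \<open>0 < r < 1\<close> the equation with \<open>r Q\<close> has a stabilizing solution \<open>X\<^sub>r\<close>. It increases with \<open>r\<close>
  and stays below the antistabilizing solution for one fixed value of \<open>r\<close>, so it converges for
  \<open>r \<rightarrow> 1\<close>.\<close>
theorem riccati_minimal_solution:
  fixes G B Q :: "complex mat"
  assumes G: "G \<in> carrier_mat n n" and B: "B \<in> carrier_mat n m" and Q: "Q \<in> carrier_mat n n"
    and psdQ: "psd_mat Q" and ctrb: "controllable_pair n G (B * mat_adjoint B)"
    and obs: "observable_pair n G Q"
    and br: "\<And>z. Re z = 0 \<Longrightarrow> bounded_real_at n m G B Q z"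
  defines "S \<equiv> B * mat_adjoint B"
  obtains X where "X \<in> carrier_mat n n" "hermitian_mat X" "riccati_residual G S Q X = 0\<^sub>m n n"
    and "spectrum (G + S * X) \<subseteq> {z. Re z \<le> 0}"
    and "\<And>Z. Z \<in> carrier_mat n n \<Longrightarrow> hermitian_mat Z \<Longrightarrow> riccati_residual G S Q Z = 0\<^sub>m n n \<Longrightarrow>
      psd_mat (Z - X)"
proof -
  have S: "S \<in> carrier_mat n n" using B by (simp add: S_def)
  have psdS: "psd_mat S" unfolding S_def by (rule gram_psd[OF B])
  have hermQ: "hermitian_mat Q" using psdQ by (simp add: psd_mat_def)
  define r where "r k = 1 - 1 / real (k + 2)" for k :: nat
  have r: "0 < r k" "r k < 1" for k by (auto simp: r_def)
  have r_mono: "r k \<le> r l" if "k \<le> l" for k l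
    using that by (auto simp: r_def intro!: divide_left_mono)
  have r_lim: "r \<longlonglongrightarrow> 1"
  proof -
    have "(\<lambda>k. 1 - inverse (real (Suc (Suc k)))) \<longlonglongrightarrow> 1 - 0"
      by (intro tendsto_diff tendsto_const LIMSEQ_Suc[OF LIMSEQ_inverse_real_of_nat])
    thus ?thesis by (simp add: r_def[abs_def] field_simps)
  qed
  define Qr where "Qr k = complex_of_real (r k) \<cdot>\<^sub>m Q" for k
  have Qr: "Qr k \<in> carrier_mat n n" for k using Q by (simp add: Qr_def)
  have hermQr: "hermitian_mat (Qr k)" for k
    using hermQ Q by (simp add: hermitian_mat_def Qr_def mat_adjoint_linear)
  have no_imag: "x = 0\<^sub>v n \<and> p = 0\<^sub>v n"
    if "x \<in> carrier_vec n" "p \<in> carrier_vec n" "Re \<mu> = 0" "G *\<^sub>v x + S *\<^sub>v p = \<mu> \<cdot>\<^sub>v x"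
      "- (Qr k *\<^sub>v x) - mat_adjoint G *\<^sub>v p = \<mu> \<cdot>\<^sub>v p" for x p \<mu> k
    by (rule no_imaginary_hamiltonian_eigenvalue[OF G B Q psdQ ctrb obs r[of k] br])
      (use that in \<open>simp_all add: S_def Qr_def\<close>)
  have "\<exists>X\<in>carrier_mat n n. hermitian_mat X \<and> riccati_residual G S (Qr k) X = 0\<^sub>m n n \<and>
      spectrum (G + S * X) \<subseteq> {z. Re z < 0}" for k
    by (rule hamiltonian_solutions(1)[OF G S Qr psdS hermQr ctrb[folded S_def]]) (rule no_imag)
  then obtain X where X: "\<And>k. X k \<in> carrier_mat n n" and hermX: "\<And>k. hermitian_mat (X k)"
    and solX: "\<And>k. riccati_residual G S (Qr k) (X k) = 0\<^sub>m n n"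
    and stabX: "\<And>k. spectrum (G + S * X k) \<subseteq> {z. Re z < 0}" by metis
  have "\<exists>X\<in>carrier_mat n n. hermitian_mat X \<and> riccati_residual G S (Qr 0) X = 0\<^sub>m n n \<and>
      spectrum (G + S * X) \<subseteq> {z. 0 < Re z}"
    by (rule hamiltonian_solutions(2)[OF G S Qr psdS hermQr ctrb[folded S_def]]) (rule no_imag)
  then obtain Y where Y: "Y \<in> carrier_mat n n" and hermY: "hermitian_mat Y"
    and solY: "riccati_residual G S (Qr 0) Y = 0\<^sub>m n n"
    and stabY: "spectrum (G + S * Y) \<subseteq> {z. 0 < Re z}" by blast
  \<comment> \<open>the residuals for \<open>b Q\<close> and \<open>a Q\<close> differ by \<open>(b - a) Q \<ge> 0\<close>\<close>
  have sub: "Re ((riccati_residual G S (of_real a \<cdot>\<^sub>m Q) Z *\<^sub>v x) \<bullet>c x) \<le> 0"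
    if Z: "Z \<in> carrier_mat n n" "hermitian_mat Z" and sol: "riccati_residual G S (of_real b \<cdot>\<^sub>m Q) Z = 0\<^sub>m n n"
      and ab: "a \<le> b" and x: "x \<in> carrier_vec n" for a b :: real and Z x
  proof -
    have c: "of_real a \<cdot>\<^sub>m Q \<in> carrier_mat n n" "of_real b \<cdot>\<^sub>m Q \<in> carrier_mat n n" using Q by simp_all
    have "Re ((riccati_residual G S (of_real b \<cdot>\<^sub>m Q) Z *\<^sub>v x) \<bullet>c x) = 0"
      using x by (simp add: sol cprod_linear)
    moreover have "a * qform Q x \<le> b * qform Q x"
      using ab psdQ psd_mat_iff[OF Q] x by (intro mult_right_mono) auto
    ultimately show ?thesis
      using Q x unfolding riccati_residual_form[OF G S c(1) Z x] riccati_residual_form[OF G S c(2) Z x]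
      by (simp add: mat_vec_linear cprod_linear)
  qed
  have mono: "psd_mat (X l - X k)" if "k \<le> l" for k l
    by (rule riccati_comparison(1)[OF G S Qr psdS X hermX solX X hermX _ stabX])
      (use sub[OF X hermX solX[unfolded Qr_def] r_mono[OF that]] in \<open>simp add: Qr_def\<close>)
  have bdd: "psd_mat (Y - X k)" for k
    by (rule riccati_comparison(2)[OF G S Qr psdS Y hermY solY X hermX _ stabY])
      (use sub[OF X hermX solX[unfolded Qr_def] r_mono[of 0 k]] in \<open>simp add: Qr_def\<close>)
  obtain L where L: "mat_tendsto n X L"
    using hermitian_monotone_limit[OF X hermX Y mono bdd] .
  have Lc: "L \<in> carrier_mat n n" by (rule mat_tendstoD(2)[OF L])
  have "mat_adjoint (X k) = X k" for k using hermX by (simp add: hermitian_mat_def)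
  hence "mat_tendsto n X (mat_adjoint L)" using mat_tendsto_adjoint[OF L] by simp
  hence "mat_adjoint L = L" by (rule mat_tendsto_unique[OF _ L])
  hence hermL: "hermitian_mat L" using Lc by (simp add: hermitian_mat_def)
  have "(\<lambda>k. complex_of_real (r k)) \<longlonglongrightarrow> of_real 1" using r_lim by (rule tendsto_of_real)
  from mat_tendsto_smult[OF this Q] have "mat_tendsto n Qr (of_real 1 \<cdot>\<^sub>m Q)"
    by (simp add: Qr_def[abs_def])
  moreover have "of_real 1 \<cdot>\<^sub>m Q = Q" by (intro eq_matI) auto
  ultimately have Qlim: "mat_tendsto n Qr Q" by simp
  have Gs: "mat_adjoint G \<in> carrier_mat n n" using G by simp
  have "mat_tendsto n (\<lambda>k. riccati_residual G S (Qr k) (X k)) (riccati_residual G S Q L)"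
    unfolding riccati_residual_def
    by (intro mat_tendsto_add mat_tendsto_mult mat_tendsto_const L Qlim G Gs S)
  hence "mat_tendsto n (\<lambda>k. 0\<^sub>m n n) (riccati_residual G S Q L)" by (simp add: solX)
  hence solL: "riccati_residual G S Q L = 0\<^sub>m n n"
    by (rule mat_tendsto_unique) (rule mat_tendsto_const, simp)
  have "mat_tendsto n (\<lambda>k. G + S * X k) (G + S * L)"
    by (intro mat_tendsto_add mat_tendsto_mult mat_tendsto_const L G S)
  hence specL: "spectrum (G + S * L) \<subseteq> {z. Re z \<le> 0}"
    by (rule spectrum_limit_of_hurwitz) (use stabX in \<open>simp add: hurwitz_mat_def\<close>)
  have minL: "psd_mat (Z - L)"
    if Z: "Z \<in> carrier_mat n n" "hermitian_mat Z" "riccati_residual G S Q Z = 0\<^sub>m n n" for Z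
  proof -
    have "of_real 1 \<cdot>\<^sub>m Q = Q" by (intro eq_matI) auto
    hence solZ: "riccati_residual G S (of_real 1 \<cdot>\<^sub>m Q) Z = 0\<^sub>m n n" using Z(3) by simp
    have "psd_mat (Z - X k)" for k
      by (rule riccati_comparison(1)[OF G S Qr psdS X hermX solX Z(1,2) _ stabX])
        (use sub[OF Z(1,2) solZ, of "r k"] r(2)[of k] in \<open>simp add: Qr_def\<close>)
    thus ?thesis by (intro mat_tendsto_psd[OF mat_tendsto_diff[OF mat_tendsto_const[OF Z(1)] L]])
  qed
  show thesis by (rule that[OF Lc hermL solL specL minL])
qed

text \<open>If \<open>D = Z - X \<noteq> 0\<close>, the range of \<open>D\<close> contains an eigenvector \<open>w = D x\<close> of the adjoint closed
  loop matrix. There the equation for \<open>D\<close> gives \<open>2 Re \<mu> \<langle>D x, x\<rangle> = \<langle>S w, w\<rangle>\<close> with \<open>Re \<mu> \<le> 0\<close>, so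
  \<open>w\<close> is an uncontrollable eigenvector.\<close>
lemma riccati_solution_unique:
  fixes G S Q :: "complex mat"
  assumes G: "G \<in> carrier_mat n n" and S: "S \<in> carrier_mat n n" and Q: "Q \<in> carrier_mat n n"
    and psdS: "psd_mat S" and ctrb: "controllable_pair n G S"
    and X: "X \<in> carrier_mat n n" and hermX: "hermitian_mat X"
    and solX: "riccati_residual G S Q X = 0\<^sub>m n n"
    and Z: "Z \<in> carrier_mat n n" and hermZ: "hermitian_mat Z"
    and solZ: "riccati_residual G S Q Z = 0\<^sub>m n n"
    and specZ: "spectrum (G + S * Z) \<subseteq> {z. Re z \<le> 0}"
    and le: "psd_mat (Z - X)"
  shows "Z = X"
proof (rule ccontr)
  assume "Z \<noteq> X"
  define D where "D = Z - X"
  define M where "M = G + S * Z"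
  have D: "D \<in> carrier_mat n n" and M: "M \<in> carrier_mat n n" using X S Z by (auto simp: D_def M_def)
  have hermS: "hermitian_mat S" and hermD: "hermitian_mat D" using psdS le by (auto simp: psd_mat_def D_def)
  have "\<exists>x\<in>carrier_vec n. Z *\<^sub>v x \<noteq> X *\<^sub>v x" using mat_eq_by_mult_vec[OF Z X] \<open>Z \<noteq> X\<close> by blast
  then obtain x0 where x0: "x0 \<in> carrier_vec n" "D *\<^sub>v x0 \<noteq> 0\<^sub>v n"
    using X Z by (auto simp: D_def mat_vec_linear vec_diff_eq_0_iff)
  have Madj: "mat_adjoint M *\<^sub>v w = mat_adjoint G *\<^sub>v w + Z *\<^sub>v (S *\<^sub>v w)" if "w \<in> carrier_vec n" for w
    using that G S Z hermS hermZ
    by (simp add: M_def mat_adjoint_linear mat_adjoint_mult mat_vec_linear hermitian_mat_def)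
  have key: "mat_adjoint M *\<^sub>v (D *\<^sub>v x) + D *\<^sub>v (M *\<^sub>v x) = D *\<^sub>v (S *\<^sub>v (D *\<^sub>v x))"
    if x: "x \<in> carrier_vec n" for x
  proof (rule eq_vecI)
    fix i assume "i < dim_vec (D *\<^sub>v (S *\<^sub>v (D *\<^sub>v x)))"
    hence i: "i < n" using D by simp
    have "vec_index (riccati_residual G S Q Z *\<^sub>v x) i = vec_index (riccati_residual G S Q X *\<^sub>v x) i"
      by (simp only: solX solZ)
    thus "vec_index (mat_adjoint M *\<^sub>v (D *\<^sub>v x) + D *\<^sub>v (M *\<^sub>v x)) i =
        vec_index (D *\<^sub>v (S *\<^sub>v (D *\<^sub>v x))) i"
      unfolding riccati_residual_mult_vec[OF G S Q X x] riccati_residual_mult_vec[OF G S Q Z x]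
      using i x G S Q X Z M D
      by (simp add: Madj del: index_mult_mat_vec) (simp add: D_def M_def mat_vec_linear algebra_simps del: index_mult_mat_vec)
  qed (use D M in auto)
  define T where "T = S * D - M"
  have T: "T \<in> carrier_mat n n" using M by (simp add: T_def)
  have DT: "D *\<^sub>v (T *\<^sub>v x) = mat_adjoint M *\<^sub>v (D *\<^sub>v x)" if x: "x \<in> carrier_vec n" for x
  proof (rule eq_vecI)
    fix i assume "i < dim_vec (mat_adjoint M *\<^sub>v (D *\<^sub>v x))"
    hence i: "i < n" using M by simp
    have "vec_index (mat_adjoint M *\<^sub>v (D *\<^sub>v x) + D *\<^sub>v (M *\<^sub>v x)) i = vec_index (D *\<^sub>v (S *\<^sub>v (D *\<^sub>v x))) i"
      by (simp only: key[OF x])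
    thus "vec_index (D *\<^sub>v (T *\<^sub>v x)) i = vec_index (mat_adjoint M *\<^sub>v (D *\<^sub>v x)) i"
      using i x D M S by (simp add: T_def mat_vec_linear algebra_simps del: index_mult_mat_vec)
  qed (use D M in auto)
  obtain x \<mu> where x: "x \<in> carrier_vec n" and ne: "D *\<^sub>v x \<noteq> 0\<^sub>v n"
    and "\<not> D *\<^sub>v (T *\<^sub>v x - \<mu> \<cdot>\<^sub>v x) \<noteq> 0\<^sub>v n"
    using eigen_step[OF T x0(1), of "\<lambda>x. D *\<^sub>v x \<noteq> 0\<^sub>v n"] x0(2) D mat_vec_linear(5)[of D n]
    by (metis carrier_matD)
  hence "D *\<^sub>v (T *\<^sub>v x) - \<mu> \<cdot>\<^sub>v (D *\<^sub>v x) = 0\<^sub>v n" using D T by (simp add: mat_vec_linear)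
  hence "D *\<^sub>v (T *\<^sub>v x) = \<mu> \<cdot>\<^sub>v (D *\<^sub>v x)" using D by (simp add: vec_diff_eq_0_iff)
  hence eig: "mat_adjoint M *\<^sub>v (D *\<^sub>v x) = \<mu> \<cdot>\<^sub>v (D *\<^sub>v x)" using DT[OF x] by simp
  define w where "w = D *\<^sub>v x"
  have w: "w \<in> carrier_vec n" "w \<noteq> 0\<^sub>v n" using D ne by (auto simp: w_def)
  have M': "mat_adjoint M \<in> carrier_mat n n" using M by simp
  have "\<mu> \<in> spectrum (mat_adjoint M)"
    using eig w unfolding spectrum_iff[OF M'] w_def[symmetric] by blast
  hence "cnj \<mu> \<in> spectrum M" by (simp only: spectrum_adjoint[OF M])
  hence mu: "Re \<mu> \<le> 0" using specZ by (auto simp: M_def)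
  have "(D *\<^sub>v (M *\<^sub>v x)) \<bullet>c x = (M *\<^sub>v x) \<bullet>c w"
    using hermitian_cprod[OF hermD D _ x, of "M *\<^sub>v x"] M by (simp add: w_def)
  also have "\<dots> = cnj (w \<bullet>c (M *\<^sub>v x))" using w M by (intro cprod_commute) simp
  also have "w \<bullet>c (M *\<^sub>v x) = (mat_adjoint M *\<^sub>v w) \<bullet>c x"
    using cprod_adjoint[of w "mat_adjoint M" x] w x M by simp
  also have "\<dots> = \<mu> * (w \<bullet>c x)" using eig x w by (simp add: w_def[symmetric] cprod_linear)
  finally have 1: "(D *\<^sub>v (M *\<^sub>v x)) \<bullet>c x = cnj (\<mu> * (w \<bullet>c x))" .
  have 2: "(mat_adjoint M *\<^sub>v w) \<bullet>c x = \<mu> * (w \<bullet>c x)"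
    using eig x w by (simp add: w_def[symmetric] cprod_linear)
  have 3: "(D *\<^sub>v (S *\<^sub>v w)) \<bullet>c x = (S *\<^sub>v w) \<bullet>c w"
    using hermitian_cprod[OF hermD D _ x, of "S *\<^sub>v w"] S by (simp add: w_def)
  have "\<mu> * (w \<bullet>c x) + cnj (\<mu> * (w \<bullet>c x)) = (S *\<^sub>v w) \<bullet>c w"
    using arg_cong[OF key[OF x], of "\<lambda>v. v \<bullet>c x"] x D M 1 2 3
    by (simp add: w_def[symmetric] cprod_linear)
  moreover have "Im (w \<bullet>c x) = 0" using hermitian_form_real[OF hermD D x] by (simp add: w_def)
  ultimately have form: "2 * Re \<mu> * Re (w \<bullet>c x) = qform S w"
    by (simp add: complex_eq_iff)
  have "0 \<le> Re (w \<bullet>c x)" using le x psd_mat_iff[OF D] by (simp add: w_def D_def)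
  hence "2 * Re \<mu> * Re (w \<bullet>c x) \<le> 0" using mu by (simp add: mult_nonpos_nonneg)
  moreover have "0 \<le> qform S w" using psdS psd_mat_iff[OF S] w by simp
  ultimately have "qform S w = 0" using form by simp
  hence Sw: "S *\<^sub>v w = 0\<^sub>v n" by (rule psd_mat_form_eq_0[OF S psdS w(1)])
  have "mat_adjoint G *\<^sub>v w = \<mu> \<cdot>\<^sub>v w"
    using eig Madj[OF w(1)] Sw G Z by (simp add: w_def[symmetric] mat_vec_linear)
  hence "w = 0\<^sub>v n" using ctrb Sw w(1) unfolding controllable_pair_def by blast
  with w(2) show False by simp
qed

text \<open>The kernel of \<open>X\<close> is annihilated by \<open>Q\<close> and invariant under \<open>G\<close>, so it would contain an
  unobservable eigenvector.\<close>
lemma riccati_solution_injective: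
  fixes G S Q :: "complex mat"
  assumes G: "G \<in> carrier_mat n n" and S: "S \<in> carrier_mat n n" and Q: "Q \<in> carrier_mat n n"
    and psdQ: "psd_mat Q" and obs: "observable_pair n G Q"
    and X: "X \<in> carrier_mat n n" and hermX: "hermitian_mat X"
    and solX: "riccati_residual G S Q X = 0\<^sub>m n n"
    and x: "x \<in> carrier_vec n" and Xx: "X *\<^sub>v x = 0\<^sub>v n"
  shows "x = 0\<^sub>v n"
proof (rule ccontr)
  assume ne: "x \<noteq> 0\<^sub>v n"
  have ker: "Q *\<^sub>v y = 0\<^sub>v n" "X *\<^sub>v (G *\<^sub>v y) = 0\<^sub>v n" if y: "y \<in> carrier_vec n" "X *\<^sub>v y = 0\<^sub>v n" for y
  proof -
    have "qform Q y = 0"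
      using riccati_residual_form[OF G S Q X hermX y(1)] y G S
      by (simp add: solX cprod_linear mat_vec_linear)
    thus Qy: "Q *\<^sub>v y = 0\<^sub>v n" by (rule psd_mat_form_eq_0[OF Q psdQ y(1)])
    show "X *\<^sub>v (G *\<^sub>v y) = 0\<^sub>v n"
      using riccati_residual_mult_vec[OF G S Q X y(1)] y G S X
      by (simp add: solX Qy mat_vec_linear)
  qed
  define P where "P y \<longleftrightarrow> y \<in> carrier_vec n \<and> X *\<^sub>v y = 0\<^sub>v n \<and> y \<noteq> 0\<^sub>v n" for y
  obtain y \<mu> where "P y" and nP: "\<not> P (G *\<^sub>v y - \<mu> \<cdot>\<^sub>v y)"
    using eigen_step[OF G x, of P] x Xx ne unfolding P_def by blast
  hence y: "y \<in> carrier_vec n" "X *\<^sub>v y = 0\<^sub>v n" "y \<noteq> 0\<^sub>v n" by (auto simp: P_def)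
  have "X *\<^sub>v (G *\<^sub>v y - \<mu> \<cdot>\<^sub>v y) = 0\<^sub>v n"
    using ker(2)[OF y(1,2)] y G X by (simp add: mat_vec_linear)
  hence "G *\<^sub>v y - \<mu> \<cdot>\<^sub>v y = 0\<^sub>v n" using nP y(1) by (simp add: P_def)
  hence "G *\<^sub>v y = \<mu> \<cdot>\<^sub>v y" using y(1) G by (simp add: vec_diff_eq_0_iff)
  hence "y = 0\<^sub>v n" using obs ker(1)[OF y(1,2)] y(1) unfolding observable_pair_def by blast
  with y(3) show False by simp
qed

text \<open>This follows by completing the square: \<open>|u|\<^sup>2 - \<langle>Q x, x\<rangle> = |u - B\<^sup>* X x|\<^sup>2 + 2 Re z \<langle>X x, x\<rangle>\<close>.\<close>
lemma riccati_dissipation: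
  fixes G B Q :: "complex mat"
  assumes G: "G \<in> carrier_mat n n" and B: "B \<in> carrier_mat n m" and Q: "Q \<in> carrier_mat n n"
    and X: "X \<in> carrier_mat n n" and psdX: "psd_mat X"
    and solX: "riccati_residual G (B * mat_adjoint B) Q X = 0\<^sub>m n n"
    and z: "0 \<le> Re z"
  shows "bounded_real_at n m G B Q z"
  unfolding bounded_real_at_def
proof (intro ballI impI)
  fix x u :: "complex Matrix.vec"
  assume x: "x \<in> carrier_vec n" and u: "u \<in> carrier_vec m" and eq: "G *\<^sub>v x + B *\<^sub>v u = z \<cdot>\<^sub>v x"
  define S where "S = B * mat_adjoint B"
  have S: "S \<in> carrier_mat n n" using B by (simp add: S_def)
  have hermX: "hermitian_mat X" using psdX by (simp add: psd_mat_def)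
  define y where "y = X *\<^sub>v x"
  define b where "b = mat_adjoint B *\<^sub>v y"
  have y: "y \<in> carrier_vec n" and b: "b \<in> carrier_vec m" using X B by (auto simp: y_def b_def)
  have xy: "x \<bullet>c y = y \<bullet>c x" using hermitian_cprod[OF hermX X x x] by (simp add: y_def)
  have yx: "0 \<le> Re (y \<bullet>c x)" "Im (y \<bullet>c x) = 0"
    using psdX psd_mat_iff[OF X] x hermitian_form_real[OF hermX X x] by (auto simp: y_def)
  have "(G *\<^sub>v x) \<bullet>c y + (B *\<^sub>v u) \<bullet>c y = z * (x \<bullet>c y)"
    using arg_cong[OF eq, of "\<lambda>v. v \<bullet>c y"] G B x u y by (simp add: cprod_linear)
  moreover have "(B *\<^sub>v u) \<bullet>c y = u \<bullet>c b" using B u y by (simp add: cprod_adjoint b_def)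
  ultimately have "Re ((G *\<^sub>v x) \<bullet>c y) + Re (u \<bullet>c b) = Re (z * (y \<bullet>c x))"
    by (metis plus_complex.sel(1) xy)
  hence 1: "Re ((G *\<^sub>v x) \<bullet>c y) = Re z * Re (y \<bullet>c x) - Re (u \<bullet>c b)" using yx(2) by simp
  have 2: "2 * Re ((G *\<^sub>v x) \<bullet>c y) + qform Q x + Re (b \<bullet>c b) = 0"
    using riccati_residual_form[OF G S Q X hermX x] gram_form[OF B y] x
    by (simp add: solX S_def y_def[symmetric] b_def[symmetric] cprod_linear)
  have "0 \<le> Re ((u - b) \<bullet>c (u - b))" by (rule cprod_self_Re(1))
  also have "(u - b) \<bullet>c (u - b) = u \<bullet>c u - u \<bullet>c b - cnj (u \<bullet>c b) + b \<bullet>c b"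
    using u b cprod_commute[of b u] by (simp add: cprod_linear)
  finally have 3: "0 \<le> Re (u \<bullet>c u) - 2 * Re (u \<bullet>c b) + Re (b \<bullet>c b)" by simp
  have "0 \<le> Re z * Re (y \<bullet>c x)" using z yx(1) by simp
  thus "qform Q x \<le> Re (u \<bullet>c u)" using 1 2 3 by linarith
qed

text \<open>An eigenvector of \<open>G\<close> for an eigenvalue in the closed right half-plane is a state with input \<open>0\<close>,
  so the gain bound makes it unobservable. Hence \<open>G\<close> is a Hurwitz matrix, and the Riccati equation
  is a Lyapunov inequality for \<open>X\<close>.\<close>
lemma riccati_solution_psd:
  fixes G B Q :: "complex mat"
  assumes G: "G \<in> carrier_mat n n" and B: "B \<in> carrier_mat n m" and Q: "Q \<in> carrier_mat n n"
    and psdQ: "psd_mat Q" and obs: "observable_pair n G Q"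
    and X: "X \<in> carrier_mat n n" and hermX: "hermitian_mat X"
    and solX: "riccati_residual G (B * mat_adjoint B) Q X = 0\<^sub>m n n"
    and br: "\<And>z. 0 \<le> Re z \<Longrightarrow> bounded_real_at n m G B Q z"
  shows "psd_mat X"
proof -
  have S: "B * mat_adjoint B \<in> carrier_mat n n" using B by simp
  have "hurwitz_mat G"
    unfolding hurwitz_mat_def
  proof (rule subsetI, rule ccontr)
    fix \<mu> assume mu: "\<mu> \<in> spectrum G" and "\<mu> \<notin> {z. Re z < 0}"
    then obtain v where v: "v \<in> carrier_vec n" "v \<noteq> 0\<^sub>v n" "G *\<^sub>v v = \<mu> \<cdot>\<^sub>v v"
      using spectrum_iff[OF G] by blast
    have "bounded_real_at n m G B Q \<mu>" using \<open>\<mu> \<notin> {z. Re z < 0}\<close> by (intro br) simp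
    moreover have "G *\<^sub>v v + B *\<^sub>v 0\<^sub>v m = \<mu> \<cdot>\<^sub>v v" using v B by (simp add: mat_vec_linear)
    ultimately have "qform Q v \<le> Re ((0\<^sub>v m :: complex Matrix.vec) \<bullet>c 0\<^sub>v m)"
      using v(1) unfolding bounded_real_at_def by (metis zero_carrier_vec)
    moreover have "0 \<le> qform Q v" using psdQ psd_mat_iff[OF Q] v(1) by simp
    ultimately have "qform Q v = 0" by (simp add: cprod_linear)
    hence "Q *\<^sub>v v = 0\<^sub>v n" by (rule psd_mat_form_eq_0[OF Q psdQ v(1)])
    thus False using obs v unfolding observable_pair_def by blast
  qed
  moreover have "Re ((G *\<^sub>v x) \<bullet>c (X *\<^sub>v x)) \<le> 0" if x: "x \<in> carrier_vec n" for x
  proof -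
    have "0 \<le> qform Q x" using psdQ psd_mat_iff[OF Q] x by simp
    moreover have "0 \<le> Re (((B * mat_adjoint B) *\<^sub>v (X *\<^sub>v x)) \<bullet>c (X *\<^sub>v x))"
      using gram_psd[OF B] psd_mat_iff[OF S] X by auto
    ultimately show ?thesis
      using riccati_residual_form[OF G S Q X hermX x] x by (simp add: solX cprod_linear)
  qed
  ultimately show ?thesis
    using lyapunov_nonneg[OF G _ X hermX] hermX by (simp add: psd_mat_iff[OF X])
qed

text \<open>The equation with \<open>-I\<close> in place of \<open>Q\<close> is the one of the linear quadratic regulator. Its
  Hamiltonian matrix has no imaginary eigenvalue by controllability alone.\<close>
lemma stabilizing_feedback:
  fixes G B :: "complex mat"
  assumes G: "G \<in> carrier_mat n n" and B: "B \<in> carrier_mat n m"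
    and ctrb: "controllable_pair n G (B * mat_adjoint B)"
  obtains N where "N \<in> carrier_mat m n" "hurwitz_mat (G + B * N)"
proof -
  define S where "S = B * mat_adjoint B"
  have S: "S \<in> carrier_mat n n" using B by (simp add: S_def)
  have psdS: "psd_mat S" unfolding S_def by (rule gram_psd[OF B])
  define Q where "Q = - (1\<^sub>m n :: complex mat)"
  have Q: "Q \<in> carrier_mat n n" by (simp add: Q_def)
  have hermQ: "hermitian_mat Q" by (simp add: Q_def hermitian_mat_def mat_adjoint_linear)
  have no_imag: "x = 0\<^sub>v n \<and> p = 0\<^sub>v n"
    if x: "x \<in> carrier_vec n" and p: "p \<in> carrier_vec n" and mu: "Re \<mu> = 0"
      and eq1: "G *\<^sub>v x + S *\<^sub>v p = \<mu> \<cdot>\<^sub>v x"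
      and eq2: "- (Q *\<^sub>v x) - mat_adjoint G *\<^sub>v p = \<mu> \<cdot>\<^sub>v p" for x p \<mu>
  proof -
    have eq2': "x - mat_adjoint G *\<^sub>v p = \<mu> \<cdot>\<^sub>v p" using eq2 x by (simp add: Q_def mat_vec_linear)
    have "(G *\<^sub>v x) \<bullet>c p + (S *\<^sub>v p) \<bullet>c p = \<mu> * (x \<bullet>c p)"
      using arg_cong[OF eq1, of "\<lambda>v. v \<bullet>c p"] G S x p by (simp add: cprod_linear)
    moreover have "x \<bullet>c x - (G *\<^sub>v x) \<bullet>c p = cnj \<mu> * (x \<bullet>c p)"
      using arg_cong[OF eq2', of "\<lambda>v. x \<bullet>c v"] G x p
      by (simp add: cprod_linear cprod_adjoint)
    moreover have "\<mu> + cnj \<mu> = 0" using mu by (simp add: complex_eq_iff)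
    ultimately have "(S *\<^sub>v p) \<bullet>c p + x \<bullet>c x = 0" by (rule cancel_skew_terms)
    hence "qform S p + Re (x \<bullet>c x) = 0" by (metis plus_complex.sel(1) zero_complex.sel(1))
    moreover have "0 \<le> qform S p" using psdS psd_mat_iff[OF S] p by simp
    ultimately have z: "qform S p = 0" "Re (x \<bullet>c x) = 0"
      using cprod_self_Re(1)[of x] by linarith+
    have x0: "x = 0\<^sub>v n" using z(2) x cprod_self_eq_0(2)[of x] by simp
    have Sp: "S *\<^sub>v p = 0\<^sub>v n" by (rule psd_mat_form_eq_0[OF S psdS p z(1)])
    have "mat_adjoint G *\<^sub>v p = (- \<mu>) \<cdot>\<^sub>v p"
    proof (rule eq_vecI)
      fix i assume "i < dim_vec ((- \<mu>) \<cdot>\<^sub>v p)"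
      hence i: "i < n" using p by simp
      have "vec_index (x - mat_adjoint G *\<^sub>v p) i = vec_index (\<mu> \<cdot>\<^sub>v p) i" by (simp only: eq2')
      thus "vec_index (mat_adjoint G *\<^sub>v p) i = vec_index ((- \<mu>) \<cdot>\<^sub>v p) i"
        using i G p by (simp add: x0 minus_equation_iff del: index_mult_mat_vec)
    qed (use G p in auto)
    hence "p = 0\<^sub>v n" using ctrb Sp p unfolding controllable_pair_def S_def by blast
    with x0 show ?thesis by simp
  qed
  have "\<exists>X\<in>carrier_mat n n. hermitian_mat X \<and> riccati_residual G S Q X = 0\<^sub>m n n \<and>
      spectrum (G + S * X) \<subseteq> {z. Re z < 0}"
    by (rule hamiltonian_solutions(1)[OF G S Q psdS hermQ ctrb[folded S_def]]) (rule no_imag)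
  then obtain X where X: "X \<in> carrier_mat n n" and stab: "spectrum (G + S * X) \<subseteq> {z. Re z < 0}"
    by blast
  show thesis
  proof (rule that)
    show "mat_adjoint B * X \<in> carrier_mat m n" using B X by simp
    have "S * X = B * (mat_adjoint B * X)" unfolding S_def
      using B X by (intro assoc_mult_mat[of _ n m _ n _ n]) auto
    thus "hurwitz_mat (G + B * (mat_adjoint B * X))" using stab by (simp add: hurwitz_mat_def)
  qed
qed

section \<open>Realizations\<close>

abbreviation transfer_mat :: "nat \<Rightarrow> complex mat \<Rightarrow> complex mat \<Rightarrow> complex mat \<Rightarrow> complex \<Rightarrow> complex mat" where
  "transfer_mat n A B C z \<equiv> C * the (mat_inverse (z \<cdot>\<^sub>m 1\<^sub>m n - A)) * B"

lemma resolvent: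
  fixes A :: "complex mat"
  assumes A: "A \<in> carrier_mat n n" and z: "z \<notin> spectrum A"
  defines "N \<equiv> the (mat_inverse (z \<cdot>\<^sub>m 1\<^sub>m n - A))"
  shows "N \<in> carrier_mat n n"
    and "x \<in> carrier_vec n \<Longrightarrow> N *\<^sub>v (z \<cdot>\<^sub>v x - A *\<^sub>v x) = x"
    and "y \<in> carrier_vec n \<Longrightarrow> z \<cdot>\<^sub>v (N *\<^sub>v y) - A *\<^sub>v (N *\<^sub>v y) = y"
proof -
  define K where "K = z \<cdot>\<^sub>m 1\<^sub>m n - A"
  have K: "K \<in> carrier_mat n n" using A by (simp add: K_def)
  have Kv: "K *\<^sub>v v = z \<cdot>\<^sub>v v - A *\<^sub>v v" if "v \<in> carrier_vec n" for v
    using that A by (simp add: K_def mat_vec_linear)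
  have "v = 0\<^sub>v n" if v: "v \<in> carrier_vec n" "K *\<^sub>v v = 0\<^sub>v n" for v
  proof (rule ccontr)
    assume "v \<noteq> 0\<^sub>v n"
    moreover have "A *\<^sub>v v = z \<cdot>\<^sub>v v"
      using v(2) Kv[OF v(1)] v(1) A vec_diff_eq_0_iff[of "z \<cdot>\<^sub>v v" n "A *\<^sub>v v"] by simp
    ultimately show False using z v(1) by (auto simp: spectrum_iff[OF A])
  qed
  hence "Determinant.det K \<noteq> 0" using det_0_iff_vec_prod_zero[OF K] by blast
  hence "K \<in> Units (ring_mat TYPE(complex) n ())" by (rule det_non_zero_imp_unit[OF K])
  with mat_inverse(1)[OF K, where b = "()"] obtain N' where N': "mat_inverse K = Some N'"
    by (cases "mat_inverse K") auto
  hence NN: "N = N'" by (simp add: N_def K_def)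
  have inv: "K * N = 1\<^sub>m n" "N * K = 1\<^sub>m n" and N: "N \<in> carrier_mat n n"
    using mat_inverse(2)[OF K N'] NN by auto
  show "N \<in> carrier_mat n n" by (rule N)
  show "N *\<^sub>v (z \<cdot>\<^sub>v x - A *\<^sub>v x) = x" if "x \<in> carrier_vec n"
    using that inv(2) N K by (simp flip: Kv mat_vec_linear(10))
  show "z \<cdot>\<^sub>v (N *\<^sub>v y) - A *\<^sub>v (N *\<^sub>v y) = y" if "y \<in> carrier_vec n"
  proof -
    have "N *\<^sub>v y \<in> carrier_vec n" using N by simp
    from Kv[OF this] show ?thesis using that inv(1) N K by (simp flip: mat_vec_linear(10))
  qed
qed

text \<open>Pairs of a state and an input replace the inverse matrix in all later arguments. They remain
  meaningful at eigenvalues of \<open>A\<close>.\<close>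
lemma transfer_state:
  fixes A B C :: "complex mat"
  assumes A: "A \<in> carrier_mat n n" and B: "B \<in> carrier_mat n m1" and C: "C \<in> carrier_mat m2 n"
    and z: "z \<notin> spectrum A" and x: "x \<in> carrier_vec n" and u: "u \<in> carrier_vec m1"
    and eq: "A *\<^sub>v x + B *\<^sub>v u = z \<cdot>\<^sub>v x"
  shows "transfer_mat n A B C z *\<^sub>v u = C *\<^sub>v x"
proof -
  note res = resolvent[OF A z]
  have "B *\<^sub>v u = z \<cdot>\<^sub>v x - A *\<^sub>v x"
    unfolding eq[symmetric] using A B by (intro eq_vecI) auto
  hence "the (mat_inverse (z \<cdot>\<^sub>m 1\<^sub>m n - A)) *\<^sub>v (B *\<^sub>v u) = x" using res(2)[OF x] by simp
  thus ?thesis using B C u res(1) by (simp add: mat_vec_linear)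
qed

lemma transfer_state_exists:
  fixes A B :: "complex mat"
  assumes A: "A \<in> carrier_mat n n" and B: "B \<in> carrier_mat n m1"
    and z: "z \<notin> spectrum A" and u: "u \<in> carrier_vec m1"
  obtains x where "x \<in> carrier_vec n" "A *\<^sub>v x + B *\<^sub>v u = z \<cdot>\<^sub>v x"
proof -
  define x where "x = the (mat_inverse (z \<cdot>\<^sub>m 1\<^sub>m n - A)) *\<^sub>v (B *\<^sub>v u)"
  have x: "x \<in> carrier_vec n" using resolvent(1)[OF A z] by (simp add: x_def)
  have Bu: "B *\<^sub>v u \<in> carrier_vec n" using B by simp
  have "B *\<^sub>v u = z \<cdot>\<^sub>v x - A *\<^sub>v x" using resolvent(3)[OF A z Bu] by (simp add: x_def)
  hence "A *\<^sub>v x + B *\<^sub>v u = z \<cdot>\<^sub>v x" using A x by (intro eq_vecI) auto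
  with x show thesis by (rule that)
qed

lemma adj_mat_tendsto:
  assumes lim: "mat_tendsto n M L"
  shows "mat_tendsto n (\<lambda>k. adj_mat (M k)) (adj_mat L)"
proof -
  note c = mat_tendstoD[OF lim]
  have "(\<lambda>k. adj_mat (M k) $$ (i, j)) \<longlonglongrightarrow> adj_mat L $$ (i, j)" if ij: "i < n" "j < n" for i j
  proof -
    have "mat_tendsto (n - 1) (\<lambda>k. mat_delete (M k) j i) (mat_delete L j i)"
      unfolding mat_tendsto_def
    proof (intro conjI allI impI)
      show "mat_delete (M k) j i \<in> carrier_mat (n - 1) (n - 1)" for k
        by (rule mat_delete_carrier[OF c(1)])
      show "mat_delete L j i \<in> carrier_mat (n - 1) (n - 1)" by (rule mat_delete_carrier[OF c(2)])
      fix a b assume "a < n - 1" "b < n - 1"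
      thus "(\<lambda>k. mat_delete (M k) j i $$ (a, b)) \<longlonglongrightarrow> mat_delete L j i $$ (a, b)"
        by (simp add: mat_delete_def c)
    qed
    from det_tendsto[OF this]
    have "(\<lambda>k. (- 1) ^ (j + i) * Determinant.det (mat_delete (M k) j i))
        \<longlonglongrightarrow> (- 1) ^ (j + i) * Determinant.det (mat_delete L j i)"
      by (intro tendsto_mult tendsto_const)
    thus ?thesis using ij by (simp add: adj_mat_def c cofactor_def)
  qed
  thus ?thesis unfolding mat_tendsto_def using adj_mat(1)[OF c(1)] adj_mat(1)[OF c(2)] by blast
qed

lemma mult_mat_vec_tendsto:
  fixes M :: "complex mat"
  assumes M: "M \<in> carrier_mat m n" and v: "\<And>k. v k \<in> carrier_vec n" and w: "w \<in> carrier_vec n"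
    and lim: "\<And>j. j < n \<Longrightarrow> (\<lambda>k. vec_index (v k) j) \<longlonglongrightarrow> vec_index w j" and i: "i < m"
  shows "(\<lambda>k. vec_index (M *\<^sub>v v k) i) \<longlonglongrightarrow> vec_index (M *\<^sub>v w) i"
proof -
  have idx: "vec_index (M *\<^sub>v x) i = (\<Sum>j<n. M $$ (i, j) * vec_index x j)" if "x \<in> carrier_vec n" for x
    using that M i by (simp add: mult_mat_vec_index del: index_mult_mat_vec)
  show ?thesis unfolding idx[OF v] idx[OF w] by (intro tendsto_sum tendsto_mult tendsto_const lim) auto
qed

lemma mat_tendsto_mult_vec:
  assumes lim: "mat_tendsto n M L" and v: "v \<in> carrier_vec n" and i: "i < n"
  shows "(\<lambda>k. vec_index (M k *\<^sub>v v) i) \<longlonglongrightarrow> vec_index (L *\<^sub>v v) i"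
proof -
  note c = mat_tendstoD[OF lim]
  have idx: "vec_index (K *\<^sub>v v) i = (\<Sum>j<n. K $$ (i, j) * vec_index v j)" if "K \<in> carrier_mat n n" for K
    using that v i by (simp add: mult_mat_vec_index del: index_mult_mat_vec)
  show ?thesis unfolding idx[OF c(1)] idx[OF c(2)]
    by (intro tendsto_sum tendsto_mult tendsto_const c(7) i) auto
qed

text \<open>A state that depends continuously on \<open>z\<close>, also at eigenvalues of \<open>A\<close>. The price is the factor
  \<open>det (z - A)\<close> of the input.\<close>
lemma adj_mat_state:
  fixes A :: "complex mat"
  assumes A: "A \<in> carrier_mat n n" and b: "b \<in> carrier_vec n"
  shows "A *\<^sub>v (adj_mat (z \<cdot>\<^sub>m 1\<^sub>m n - A) *\<^sub>v b) + Determinant.det (z \<cdot>\<^sub>m 1\<^sub>m n - A) \<cdot>\<^sub>v b =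
    z \<cdot>\<^sub>v (adj_mat (z \<cdot>\<^sub>m 1\<^sub>m n - A) *\<^sub>v b)"
proof -
  define K where "K = z \<cdot>\<^sub>m 1\<^sub>m n - A"
  have K: "K \<in> carrier_mat n n" using A by (simp add: K_def)
  note adj = adj_mat[OF K]
  have y: "adj_mat K *\<^sub>v b \<in> carrier_vec n" using adj(1) by simp
  have "K *\<^sub>v (adj_mat K *\<^sub>v b) = (K * adj_mat K) *\<^sub>v b"
    using K adj(1) b by (simp add: mat_vec_linear)
  also have "\<dots> = Determinant.det K \<cdot>\<^sub>v b" using b by (simp add: adj(2) mat_vec_linear)
  finally have "z \<cdot>\<^sub>v (adj_mat K *\<^sub>v b) - A *\<^sub>v (adj_mat K *\<^sub>v b) = Determinant.det K \<cdot>\<^sub>v b"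
    using y A unfolding K_def by (simp add: mat_vec_linear)
  hence "Determinant.det K \<cdot>\<^sub>v b = z \<cdot>\<^sub>v (adj_mat K *\<^sub>v b) - A *\<^sub>v (adj_mat K *\<^sub>v b)" by simp
  hence "A *\<^sub>v (adj_mat K *\<^sub>v b) + Determinant.det K \<cdot>\<^sub>v b = z \<cdot>\<^sub>v (adj_mat K *\<^sub>v b)"
    using y A b by (intro eq_vecI) auto
  thus ?thesis by (simp add: K_def)
qed

lemma det_resolvent_nonzero:
  fixes A :: "complex mat"
  assumes A: "A \<in> carrier_mat n n"
  shows "Determinant.det (z \<cdot>\<^sub>m 1\<^sub>m n - A) = 0 \<longleftrightarrow> z \<in> spectrum A"
proof -
  have "- char_matrix A z = z \<cdot>\<^sub>m 1\<^sub>m n - A"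
    using A by (intro eq_matI) (auto simp: char_matrix_def)
  thus ?thesis using char_poly_matrix[OF A, of z] spectrum_root_char_poly[OF A] by auto
qed

lemma sequence_avoiding_finite_set:
  fixes z :: complex
  assumes "z islimpt S" "finite F"
  obtains f where "\<And>k::nat. f k \<in> S - F" "f \<longlonglongrightarrow> z"
proof -
  have "z islimpt (F \<union> (S - F))" using assms(1) by (rule islimpt_subset) auto
  hence "z islimpt (S - F)" using islimpt_Un_finite[OF assms(2)] by blast
  then obtain f where "\<forall>k::nat. f k \<in> (S - F) - {z}" "f \<longlonglongrightarrow> z"
    unfolding islimpt_sequential by blast
  thus thesis using that by blast
qed

lemma char_mat_tendsto:
  assumes "f \<longlonglongrightarrow> z" "A \<in> carrier_mat n n"
  shows "mat_tendsto n (\<lambda>k. f k \<cdot>\<^sub>m 1\<^sub>m n - A) (z \<cdot>\<^sub>m 1\<^sub>m n - A)"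
  using assms by (intro mat_tendsto_diff mat_tendsto_smult mat_tendsto_const) auto

text \<open>The entries of \<open>R\<close> are reduced fractions, so by continuity the identity extends to the finitely
  many exceptional points: where the transfer function is finite, a zero of the denominator would
  also be a zero of the numerator.\<close>
lemma realizationI_cofinite:
  assumes R: "rational_mat_function m2 m1 R"
    and A: "A \<in> carrier_mat n n" and B: "B \<in> carrier_mat n m1" and C: "C \<in> carrier_mat m2 n"
    and F: "finite F"
    and agree: "\<And>z. z \<notin> F \<Longrightarrow> z \<notin> spectrum A \<Longrightarrow> R z = transfer_mat n A B C z"
  shows "realization m2 m1 n A B C R"
  unfolding realization_def
proof (intro conjI A B C allI impI)
  fix z assume z: "z \<notin> spectrum A"
  define T where "T w = transfer_mat n A B C w" for w
  have Rc: "R w \<in> carrier_mat m2 m1" for w using R by (simp add: rational_mat_function_def)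
  have "R z $$ (i, j) = T z $$ (i, j)" if ij: "i < m2" "j < m1" for i j
  proof -
    obtain p q where q: "q \<noteq> 0" and cop: "coprime p q"
      and pq: "\<And>w. poly q w \<noteq> 0 \<Longrightarrow> R w $$ (i, j) = poly p w / poly q w"
      using R ij unfolding rational_mat_function_def rational_function_def by metis
    define b where "b = B *\<^sub>v unit_vec m1 j"
    have b: "b \<in> carrier_vec n" using B by (simp add: b_def)
    define y where "y w = adj_mat (w \<cdot>\<^sub>m 1\<^sub>m n - A) *\<^sub>v b" for w
    define d where "d w = Determinant.det (w \<cdot>\<^sub>m 1\<^sub>m n - A)" for w
    have wA: "w \<cdot>\<^sub>m 1\<^sub>m n - A \<in> carrier_mat n n" for w using A by simp
    have y: "y w \<in> carrier_vec n" for w using carrier_matD(1)[OF adj_mat(1)[OF wA]] by (simp add: y_def)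
    have Tij: "d w * T w $$ (i, j) = vec_index (C *\<^sub>v y w) i" if w: "w \<notin> spectrum A" for w
    proof -
      have u: "d w \<cdot>\<^sub>v unit_vec m1 j \<in> carrier_vec m1" by simp
      have "A *\<^sub>v y w + B *\<^sub>v (d w \<cdot>\<^sub>v unit_vec m1 j) = w \<cdot>\<^sub>v y w"
        using adj_mat_state[OF A b, of w] B by (simp add: y_def d_def b_def mat_vec_linear)
      from transfer_state[OF A B C w y u this]
      have "T w *\<^sub>v (d w \<cdot>\<^sub>v unit_vec m1 j) = C *\<^sub>v y w" by (simp add: T_def)
      moreover have Tw: "T w \<in> carrier_mat m2 m1" using B C by (simp add: T_def)
      ultimately show ?thesis using ij by (auto simp: mat_vec_linear dest: arg_cong[of _ _ "\<lambda>v. vec_index v i"])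
    qed
    have finF: "finite (F \<union> spectrum A \<union> {w. poly q w = 0})"
      using F card_finite_spectrum(1)[OF A] poly_roots_finite[OF q] by simp
    have "z islimpt (UNIV :: complex set)" by (simp add: islimpt_UNIV)
    then obtain f where f: "\<And>k::nat. f k \<in> UNIV - (F \<union> spectrum A \<union> {w. poly q w = 0})" "f \<longlonglongrightarrow> z"
      using sequence_avoiding_finite_set[OF _ finF] by metis
    have "d (f k) * poly p (f k) = vec_index (C *\<^sub>v y (f k)) i * poly q (f k)" for k
    proof -
      have "poly p (f k) = T (f k) $$ (i, j) * poly q (f k)"
        using pq[of "f k"] agree[of "f k"] f(1)[of k] by (auto simp: T_def field_simps)
      hence "d (f k) * poly p (f k) = d (f k) * T (f k) $$ (i, j) * poly q (f k)"
        by (simp only: mult.assoc)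
      also have "d (f k) * T (f k) $$ (i, j) = vec_index (C *\<^sub>v y (f k)) i"
        using f(1)[of k] by (intro Tij) simp
      finally show ?thesis .
    qed
    moreover have "(\<lambda>k. d (f k) * poly p (f k)) \<longlonglongrightarrow> d z * poly p z"
      unfolding d_def
      by (intro tendsto_mult det_tendsto[OF char_mat_tendsto[OF f(2) A]] tendsto_poly f(2))
    moreover have "(\<lambda>k. vec_index (C *\<^sub>v y (f k)) i * poly q (f k)) \<longlonglongrightarrow> vec_index (C *\<^sub>v y z) i * poly q z"
    proof (intro tendsto_mult mult_mat_vec_tendsto[OF C y y _ ij(1)] tendsto_poly f(2))
      fix l assume "l < n"
      thus "(\<lambda>k. vec_index (y (f k)) l) \<longlonglongrightarrow> vec_index (y z) l" unfolding y_def
        by (intro mat_tendsto_mult_vec[OF adj_mat_tendsto[OF char_mat_tendsto[OF f(2) A]] b])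
    qed
    \<comment> \<open>the identity \<open>T = p / q\<close> multiplied by both denominators, in the limit\<close>
    ultimately have lim: "d z * poly p z = vec_index (C *\<^sub>v y z) i * poly q z"
      using LIMSEQ_unique by auto
    have dz: "d z \<noteq> 0" using det_resolvent_nonzero[OF A] z by (simp add: d_def)
    have qz: "poly q z \<noteq> 0"
    proof
      assume "poly q z = 0"
      hence "poly p z = 0" using lim dz by simp
      hence "[:- z, 1:] dvd p" "[:- z, 1:] dvd q" using \<open>poly q z = 0\<close> by (simp_all add: poly_eq_0_iff_dvd)
      hence "is_unit [:- z, 1:]" using cop by (rule coprime_common_divisor[rotated])
      thus False by (simp add: is_unit_iff_degree)
    qed
    have "d z * T z $$ (i, j) = d z * (poly p z / poly q z)"
      using Tij[OF z] lim qz by (simp add: field_simps)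
    hence "T z $$ (i, j) = poly p z / poly q z" using dz by (simp only: mult_cancel_left) simp
    thus ?thesis using pq[OF qz] by simp
  qed
  thus "R z = transfer_mat n A B C z"
    using Rc[of z] B C by (intro eq_matI) (auto simp: T_def)
qed

section \<open>Minimal realizations\<close>

text \<open>A nonzero \<open>p\<close> with \<open>A\<^sup>* p = \<mu> p\<close> and \<open>B\<^sup>* p = 0\<close> makes the hyperplane \<open>p\<^sup>\<bottom>\<close> invariant under
  \<open>A\<close> and a superspace of the range of \<open>B\<close>. The columns of \<open>L\<close> are a basis of this hyperplane,
  namely the unit vectors other than \<open>e\<^sub>j\<close>, each corrected in a coordinate \<open>j\<close> where \<open>p\<close> does not
  vanish.\<close>
lemma uncontrollable_compression:
  fixes A B :: "complex mat"
  assumes A: "A \<in> carrier_mat n n" and B: "B \<in> carrier_mat n m"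
    and p: "p \<in> carrier_vec n" "p \<noteq> 0\<^sub>v n"
    and eig: "mat_adjoint A *\<^sub>v p = \<mu> \<cdot>\<^sub>v p" and Bp: "mat_adjoint B *\<^sub>v p = 0\<^sub>v m"
  obtains k L A1 B1 where "n = Suc k" "L \<in> carrier_mat n k" "A1 \<in> carrier_mat k k" "B1 \<in> carrier_mat k m"
    "A * L = L * A1" "B = L * B1"
proof -
  obtain j where j: "j < n" "vec_index p j \<noteq> 0"
    using p by (metis carrier_vecD eq_vecI index_zero_vec)
  then obtain k where n: "n = Suc k" by (cases n) auto
  define s where "s = insert_index j"
  have s: "s c < n" if "c < k" for c using that n by (auto simp: s_def insert_index_def)
  have sum_split: "(\<Sum>i<n. f i) = f j + (\<Sum>c<k. f (s c))" for f :: "nat \<Rightarrow> complex"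
  proof -
    have "(\<Sum>i<n. f i) = f j + (\<Sum>i\<in>{..<n} - {j}. f i)" using j by (simp add: sum.remove)
    also have "{..<n} - {j} = s ` {..<k}"
      using insert_index_image[of j k] j n by (simp add: s_def lessThan_atLeast0)
    also have "(\<Sum>i\<in>s ` {..<k}. f i) = (\<Sum>c<k. f (s c))"
      unfolding s_def by (subst sum.reindex[OF insert_index_inj_on]) simp
    finally show ?thesis .
  qed
  define L where "L = Matrix.mat n k (\<lambda>(i, c).
    if i = j then - cnj (vec_index p (s c)) / cnj (vec_index p j) else if i = s c then 1 else 0)"
  \<comment> \<open>a left inverse of \<open>L\<close>: deletion of the coordinate \<open>j\<close>\<close>
  define P where "P = Matrix.mat k n (\<lambda>(c, i). if i = s c then (1 :: complex) else 0)"
  have L: "L \<in> carrier_mat n k" and P: "P \<in> carrier_mat k n" by (auto simp: L_def P_def)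
  have Lj: "vec_index (L *\<^sub>v y) j * cnj (vec_index p j) = - (\<Sum>c<k. vec_index y c * cnj (vec_index p (s c)))"
    if "y \<in> carrier_vec k" for y
  proof -
    have "vec_index (L *\<^sub>v y) j = (\<Sum>c<k. - cnj (vec_index p (s c)) / cnj (vec_index p j) * vec_index y c)"
      using that j L by (simp add: mult_mat_vec_index L_def del: index_mult_mat_vec)
    hence "vec_index (L *\<^sub>v y) j * cnj (vec_index p j) =
        (\<Sum>c<k. - cnj (vec_index p (s c)) / cnj (vec_index p j) * vec_index y c * cnj (vec_index p j))"
      by (simp only: sum_distrib_right)
    also have "\<dots> = (\<Sum>c<k. - (vec_index y c * cnj (vec_index p (s c))))"
      using j(2) by (intro sum.cong) auto
    finally show ?thesis by (simp only: sum_negf)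
  qed
  have Ls: "vec_index (L *\<^sub>v y) (s c) = vec_index y c" if "y \<in> carrier_vec k" "c < k" for y c
  proof -
    have "L $$ (s c, c') = (if c' = c then 1 else 0)" if "c' < k" for c'
    proof -
      have "s c \<noteq> j" by (simp add: s_def)
      moreover have "s c = s c' \<longleftrightarrow> c' = c" unfolding s_def by (metis delete_insert_index)
      ultimately show ?thesis using that s[OF \<open>c < k\<close>] by (simp add: L_def)
    qed
    thus ?thesis
      using that s L by (simp add: mult_mat_vec_index mult_delta_left del: index_mult_mat_vec)
  qed
  have Lp: "(L *\<^sub>v y) \<bullet>c p = 0" if "y \<in> carrier_vec k" for y
    using p(1) Lj[OF that] Ls[OF that]
    by (simp add: cprod_sum sum_split del: index_mult_mat_vec)
  have Pv: "vec_index (P *\<^sub>v v) c = vec_index v (s c)" if "v \<in> carrier_vec n" "c < k" for v c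
    using that P s[OF that(2)]
    by (simp add: mult_mat_vec_index P_def mult_delta_left del: index_mult_mat_vec)
  have LP: "L *\<^sub>v (P *\<^sub>v v) = v" if v: "v \<in> carrier_vec n" "v \<bullet>c p = 0" for v
  proof (rule eq_vecI)
    have Pvc: "P *\<^sub>v v \<in> carrier_vec k" using P by simp
    fix i assume "i < dim_vec v"
    hence i: "i < n" using v by simp
    show "vec_index (L *\<^sub>v (P *\<^sub>v v)) i = vec_index v i"
    proof (cases "i = j")
      case True
      have "vec_index v j * cnj (vec_index p j) + (\<Sum>c<k. vec_index v (s c) * cnj (vec_index p (s c))) = 0"
        using v p(1) by (simp add: cprod_sum sum_split)
      hence "vec_index (L *\<^sub>v (P *\<^sub>v v)) j * cnj (vec_index p j) = vec_index v j * cnj (vec_index p j)"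
        using Lj[OF Pvc] Pv[OF v(1)] by (simp add: eq_neg_iff_add_eq_0[symmetric] del: index_mult_mat_vec)
      thus ?thesis using j(2) True by simp
    next
      case False
      hence "i \<in> s ` {..<k}"
        using insert_index_image[of j k] i j n by (simp add: s_def lessThan_atLeast0)
      then obtain c where c: "c < k" "i = s c" by auto
      show ?thesis using Ls[OF Pvc c(1)] Pv[OF v(1) c(1)] c(2) by simp
    qed
  qed (use L v in auto)
  have 1: "A * L = L * (P * (A * L))"
  proof (rule mat_eq_by_mult_vec[of _ n k])
    fix y :: "complex Matrix.vec" assume y: "y \<in> carrier_vec k"
    have Ly: "L *\<^sub>v y \<in> carrier_vec n" using L by simp
    have "(A *\<^sub>v (L *\<^sub>v y)) \<bullet>c p = (L *\<^sub>v y) \<bullet>c (\<mu> \<cdot>\<^sub>v p)"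
      using A Ly p(1) cprod_adjoint[of "L *\<^sub>v y" A p] by (simp add: eig)
    also have "\<dots> = 0" using Lp[OF y] by (simp add: cprod_linear)
    finally have "L *\<^sub>v (P *\<^sub>v (A *\<^sub>v (L *\<^sub>v y))) = A *\<^sub>v (L *\<^sub>v y)" using A by (intro LP) auto
    thus "(A * L) *\<^sub>v y = (L * (P * (A * L))) *\<^sub>v y" using A L P y by (simp add: mat_vec_linear)
  qed (use A L P in auto)
  have 2: "B = L * (P * B)"
  proof (rule mat_eq_by_mult_vec[of _ n m])
    fix u :: "complex Matrix.vec" assume u: "u \<in> carrier_vec m"
    have "(B *\<^sub>v u) \<bullet>c p = 0"
      using B u p(1) by (simp add: cprod_adjoint Bp cprod_linear)
    hence "L *\<^sub>v (P *\<^sub>v (B *\<^sub>v u)) = B *\<^sub>v u" using B by (intro LP) auto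
    thus "B *\<^sub>v u = (L * (P * B)) *\<^sub>v u" using B L P u by (simp add: mat_vec_linear)
  qed (use B L P in auto)
  show thesis
    by (rule that[OF n L _ _ 1 2]) (use A B L P in auto)
qed

lemma mult_mat_vec_cong:
  fixes M N K M' :: "complex mat"
  assumes "M * N = K * M'" "N \<in> carrier_mat a b" "M \<in> carrier_mat c a" "M' \<in> carrier_mat d b"
    "K \<in> carrier_mat c d" "x \<in> carrier_vec b"
  shows "M *\<^sub>v (N *\<^sub>v x) = K *\<^sub>v (M' *\<^sub>v x)"
proof -
  have "M *\<^sub>v (N *\<^sub>v x) = (M * N) *\<^sub>v x" using assms(2-6) by (simp add: mat_vec_linear)
  also have "\<dots> = K *\<^sub>v (M' *\<^sub>v x)" using assms(2-6) by (simp add: assms(1) mat_vec_linear)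
  finally show ?thesis .
qed

lemma transfer_eqI:
  fixes T :: "complex mat"
  assumes "T \<in> carrier_mat m2 m1" and A: "A \<in> carrier_mat n n" and B: "B \<in> carrier_mat n m1"
    and C: "C \<in> carrier_mat m2 n" and z: "z \<notin> spectrum A"
    and T: "\<And>x u. x \<in> carrier_vec n \<Longrightarrow> u \<in> carrier_vec m1 \<Longrightarrow> A *\<^sub>v x + B *\<^sub>v u = z \<cdot>\<^sub>v x \<Longrightarrow>
      T *\<^sub>v u = C *\<^sub>v x"
  shows "T = transfer_mat n A B C z"
proof (rule mat_eq_by_mult_vec[of _ m2 m1])
  fix u :: "complex Matrix.vec" assume u: "u \<in> carrier_vec m1"
  obtain x where x: "x \<in> carrier_vec n" "A *\<^sub>v x + B *\<^sub>v u = z \<cdot>\<^sub>v x"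
    using transfer_state_exists[OF A B z u] .
  show "T *\<^sub>v u = transfer_mat n A B C z *\<^sub>v u"
    using T[OF x(1) u x(2)] transfer_state[OF A B C z x(1) u x(2)] by simp
qed (use assms in auto)

lemma realization_state:
  assumes re: "realization m2 m1 n A B C R" and z: "z \<notin> spectrum A"
    and "x \<in> carrier_vec n" "u \<in> carrier_vec m1" "A *\<^sub>v x + B *\<^sub>v u = z \<cdot>\<^sub>v x"
  shows "R z *\<^sub>v u = C *\<^sub>v x"
proof -
  have A: "A \<in> carrier_mat n n" and B: "B \<in> carrier_mat n m1" and C: "C \<in> carrier_mat m2 n"
    and Rz: "R z = transfer_mat n A B C z"
    using re z by (auto simp: realization_def)
  show ?thesis unfolding Rz by (rule transfer_state[OF A B C z assms(3-5)])
qed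

text \<open>The next two lemmas transport a realization along an intertwining matrix: states of the small
  system are embedded by \<open>L\<close>, or states of the large system are projected by \<open>P\<close>.\<close>
lemma realization_restrict:
  assumes R: "rational_mat_function m2 m1 R" and re: "realization m2 m1 n A B C R"
    and L: "L \<in> carrier_mat n k" and A1: "A1 \<in> carrier_mat k k" and B1: "B1 \<in> carrier_mat k m1"
    and AL: "A * L = L * A1" and BL: "B = L * B1"
  shows "realization m2 m1 k A1 B1 (C * L) R"
proof -
  have A: "A \<in> carrier_mat n n" and B: "B \<in> carrier_mat n m1" and C: "C \<in> carrier_mat m2 n"
    using re by (auto simp: realization_def)
  have CL: "C * L \<in> carrier_mat m2 k" using C L by simp
  show ?thesis
  proof (rule realizationI_cofinite[OF R A1 B1 CL card_finite_spectrum(1)[OF A]])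
    fix z assume z: "z \<notin> spectrum A" "z \<notin> spectrum A1"
    show "R z = transfer_mat k A1 B1 (C * L) z"
    proof (rule transfer_eqI[OF _ A1 B1 CL z(2)])
      show "R z \<in> carrier_mat m2 m1" using R by (simp add: rational_mat_function_def)
      fix y u :: "complex Matrix.vec"
      assume y: "y \<in> carrier_vec k" and u: "u \<in> carrier_vec m1" and eq: "A1 *\<^sub>v y + B1 *\<^sub>v u = z \<cdot>\<^sub>v y"
      have "A *\<^sub>v (L *\<^sub>v y) + B *\<^sub>v u = L *\<^sub>v (A1 *\<^sub>v y + B1 *\<^sub>v u)"
        using mult_mat_vec_cong[OF AL L A A1 L y] L A1 B1 y u by (simp add: BL mat_vec_linear)
      also have "\<dots> = z \<cdot>\<^sub>v (L *\<^sub>v y)" using L y by (simp add: eq mat_vec_linear)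
      finally have "R z *\<^sub>v u = C *\<^sub>v (L *\<^sub>v y)" using L u by (intro realization_state[OF re z(1)]) auto
      thus "R z *\<^sub>v u = (C * L) *\<^sub>v y" using C L y by (simp add: mat_vec_linear)
    qed
  qed
qed

lemma realization_project:
  assumes R: "rational_mat_function m2 m1 R" and re: "realization m2 m1 n A B C R"
    and P: "P \<in> carrier_mat k n" and A1: "A1 \<in> carrier_mat k k" and C1: "C1 \<in> carrier_mat m2 k"
    and PA: "P * A = A1 * P" and CP: "C = C1 * P"
  shows "realization m2 m1 k A1 (P * B) C1 R"
proof -
  have A: "A \<in> carrier_mat n n" and B: "B \<in> carrier_mat n m1" and C: "C \<in> carrier_mat m2 n"
    using re by (auto simp: realization_def)
  have PB: "P * B \<in> carrier_mat k m1" using P B by simp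
  show ?thesis
  proof (rule realizationI_cofinite[OF R A1 PB C1 card_finite_spectrum(1)[OF A]])
    fix z assume z: "z \<notin> spectrum A" "z \<notin> spectrum A1"
    have Rz: "R z = transfer_mat n A B C z" using re z by (simp add: realization_def)
    have T: "transfer_mat k A1 (P * B) C1 z \<in> carrier_mat m2 m1" using C1 B by simp
    show "R z = transfer_mat k A1 (P * B) C1 z"
      unfolding Rz
    proof (rule transfer_eqI[OF T A B C z(1), symmetric])
      fix x u :: "complex Matrix.vec"
      assume x: "x \<in> carrier_vec n" and u: "u \<in> carrier_vec m1" and eq: "A *\<^sub>v x + B *\<^sub>v u = z \<cdot>\<^sub>v x"
      have "A1 *\<^sub>v (P *\<^sub>v x) + (P * B) *\<^sub>v u = P *\<^sub>v (A *\<^sub>v x + B *\<^sub>v u)"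
        using mult_mat_vec_cong[OF PA A P P A1 x] P A B x u by (simp add: mat_vec_linear)
      also have "\<dots> = z \<cdot>\<^sub>v (P *\<^sub>v x)" using P x by (simp add: eq mat_vec_linear)
      finally have "transfer_mat k A1 (P * B) C1 z *\<^sub>v u = C1 *\<^sub>v (P *\<^sub>v x)"
        using P u by (intro transfer_state[OF A1 PB C1 z(2)]) auto
      thus "transfer_mat k A1 (P * B) C1 z *\<^sub>v u = C *\<^sub>v x"
        using C1 P x by (simp add: CP mat_vec_linear)
    qed
  qed
qed

lemma minimal_realization_controllable:
  assumes R: "rational_mat_function m2 m1 R" and mr: "minimal_realization m2 m1 n A B C R"
    and p: "p \<in> carrier_vec n" and eig: "mat_adjoint A *\<^sub>v p = \<mu> \<cdot>\<^sub>v p"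
    and Bp: "mat_adjoint B *\<^sub>v p = 0\<^sub>v m1"
  shows "p = 0\<^sub>v n"
proof (rule ccontr)
  assume ne: "p \<noteq> 0\<^sub>v n"
  have re: "realization m2 m1 n A B C R"
    and min: "\<And>n' A' B' C'. realization m2 m1 n' A' B' C' R \<Longrightarrow> n \<le> n'"
    using mr by (auto simp: minimal_realization_def)
  have A: "A \<in> carrier_mat n n" and B: "B \<in> carrier_mat n m1"
    using re by (auto simp: realization_def)
  obtain k L A1 B1 where n: "n = Suc k" and L: "L \<in> carrier_mat n k" and A1: "A1 \<in> carrier_mat k k"
    and B1: "B1 \<in> carrier_mat k m1" and AL: "A * L = L * A1" and BL: "B = L * B1"
    using uncontrollable_compression[OF A B p ne eig Bp] .
  from min[OF realization_restrict[OF R re L A1 B1 AL BL]] n show False by simp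
qed

text \<open>An unobservable eigenvector of \<open>(C, A)\<close> is an uncontrollable one of \<open>(A\<^sup>*, C\<^sup>*)\<close>. The adjoint of its
  compression is a projection of the system.\<close>
lemma minimal_realization_observable:
  assumes R: "rational_mat_function m2 m1 R" and mr: "minimal_realization m2 m1 n A B C R"
    and x: "x \<in> carrier_vec n" and eig: "A *\<^sub>v x = \<mu> \<cdot>\<^sub>v x" and Cx: "C *\<^sub>v x = 0\<^sub>v m2"
  shows "x = 0\<^sub>v n"
proof (rule ccontr)
  assume ne: "x \<noteq> 0\<^sub>v n"
  have re: "realization m2 m1 n A B C R"
    and min: "\<And>n' A' B' C'. realization m2 m1 n' A' B' C' R \<Longrightarrow> n \<le> n'"
    using mr by (auto simp: minimal_realization_def)
  have A: "A \<in> carrier_mat n n" and C: "C \<in> carrier_mat m2 n"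
    using re by (auto simp: realization_def)
  have A': "mat_adjoint A \<in> carrier_mat n n" and C': "mat_adjoint C \<in> carrier_mat n m2" using A C by auto
  have eig': "mat_adjoint (mat_adjoint A) *\<^sub>v x = \<mu> \<cdot>\<^sub>v x"
    and Cx': "mat_adjoint (mat_adjoint C) *\<^sub>v x = 0\<^sub>v m2" using eig Cx by simp_all
  obtain k L A1 B1 where n: "n = Suc k" and L: "L \<in> carrier_mat n k" and A1: "A1 \<in> carrier_mat k k"
    and B1: "B1 \<in> carrier_mat k m2"
    and AL: "mat_adjoint A * L = L * A1" and CL: "mat_adjoint C = L * B1"
    using uncontrollable_compression[OF A' C' x ne eig' Cx'] .
  have "mat_adjoint (mat_adjoint A * L) = mat_adjoint (L * A1)" by (simp only: AL)
  hence PA: "mat_adjoint L * A = mat_adjoint A1 * mat_adjoint L"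
    using A L A1 by (simp add: mat_adjoint_mult)
  have "mat_adjoint (mat_adjoint C) = mat_adjoint (L * B1)" by (simp only: CL)
  hence CP: "C = mat_adjoint B1 * mat_adjoint L" using L B1 by (simp add: mat_adjoint_mult)
  have "realization m2 m1 k (mat_adjoint A1) (mat_adjoint L * B) (mat_adjoint B1) R"
    by (rule realization_project[OF R re _ _ _ PA CP]) (use L A1 B1 in auto)
  from min[OF this] n show False by simp
qed

section \<open>Contractivity and the bounded real inequality\<close>

lemma loewner_contraction_iff:
  fixes M :: "complex mat"
  assumes M: "M \<in> carrier_mat m2 m1"
  shows "loewner_le (mat_adjoint M * M) (1\<^sub>m m1) \<longleftrightarrow>
    (\<forall>u\<in>carrier_vec m1. Re ((M *\<^sub>v u) \<bullet>c (M *\<^sub>v u)) \<le> Re (u \<bullet>c u))"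
proof -
  define K where "K = 1\<^sub>m m1 - mat_adjoint M * M"
  have K: "K \<in> carrier_mat m1 m1" using M by (simp add: K_def)
  have "hermitian_mat K"
    using M by (simp add: hermitian_mat_def K_def mat_adjoint_linear mat_adjoint_mult)
  moreover have "(K *\<^sub>v u) \<bullet>c u = u \<bullet>c u - (M *\<^sub>v u) \<bullet>c (M *\<^sub>v u)" if u: "u \<in> carrier_vec m1" for u
    using u M cprod_adjoint[of "M *\<^sub>v u" "mat_adjoint M" u]
    by (simp add: K_def mat_vec_linear cprod_linear)
  ultimately show ?thesis unfolding loewner_le_def K_def[symmetric] psd_mat_iff[OF K] by auto
qed

lemma contraction_entry_le_1:
  fixes M :: "complex mat"
  assumes M: "M \<in> carrier_mat m2 m1" and ij: "i < m2" "j < m1"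
    and con: "\<And>u. u \<in> carrier_vec m1 \<Longrightarrow> Re ((M *\<^sub>v u) \<bullet>c (M *\<^sub>v u)) \<le> Re (u \<bullet>c u)"
  shows "cmod (M $$ (i, j)) \<le> 1"
proof -
  have sq: "Re (x \<bullet>c x) = (\<Sum>i<dim_vec x. (cmod (vec_index x i))\<^sup>2)" for x :: "complex Matrix.vec"
    unfolding cprod_sum by (simp only: Re_sum complex_norm_square[symmetric] Re_complex_of_real)
  define e where "e = (unit_vec m1 j :: complex Matrix.vec)"
  have "(cmod (M $$ (i, j)))\<^sup>2 = (cmod (vec_index (M *\<^sub>v e) i))\<^sup>2"
    using M ij by (simp add: e_def)
  also have "\<dots> \<le> (\<Sum>i<m2. (cmod (vec_index (M *\<^sub>v e) i))\<^sup>2)"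
    using ij by (intro member_le_sum) auto
  also have "\<dots> = Re ((M *\<^sub>v e) \<bullet>c (M *\<^sub>v e))" using M by (simp add: sq)
  also have "\<dots> \<le> Re (e \<bullet>c e)" by (rule con) (simp add: e_def)
  also have "\<dots> = (\<Sum>l<m1. if l = j then 1 else 0)"
    unfolding sq by (intro sum.cong) (auto simp: e_def unit_vec_def)
  also have "\<dots> = 1\<^sup>2" using ij by simp
  finally show ?thesis by (rule power2_le_imp_le) simp
qed

lemma cprod_self_tendsto:
  assumes v: "\<And>k. v k \<in> carrier_vec n" and w: "w \<in> carrier_vec n"
    and lim: "\<And>i. i < n \<Longrightarrow> (\<lambda>k. vec_index (v k) i) \<longlonglongrightarrow> (vec_index w i :: complex)"
  shows "(\<lambda>k. Re (v k \<bullet>c v k)) \<longlonglongrightarrow> Re (w \<bullet>c w)"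
proof -
  have d: "dim_vec (v k) = n" "dim_vec w = n" for k using v[of k] w by auto
  show ?thesis unfolding cprod_sum d by (intro tendsto_intros lim) auto
qed

text \<open>At points of \<open>D\<close> that are not eigenvalues of \<open>A\<close> the bound is contractivity itself. By
  continuity it extends to eigenvalues and limit points. To parametrize the pairs \<open>(x, u)\<close> with
  \<open>z x = A x + B u\<close> continuously near an eigenvalue, a feedback \<open>u = N x + w\<close> moves the spectrum of
  \<open>A\<close> away from \<open>z\<close>, and \<open>w\<close> becomes the free parameter.\<close>
lemma contractive_imp_gain_le:
  assumes re: "realization m2 m1 n A B C R" and R: "\<And>z. R z \<in> carrier_mat m2 m1"
    and con: "contractive_on m2 m1 D R" and z: "z islimpt D"
    and N: "N \<in> carrier_mat m1 n" and zN: "z \<notin> spectrum (A + B * N)"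
    and x: "x \<in> carrier_vec n" and u: "u \<in> carrier_vec m1" and eq: "A *\<^sub>v x + B *\<^sub>v u = z \<cdot>\<^sub>v x"
  shows "Re ((C *\<^sub>v x) \<bullet>c (C *\<^sub>v x)) \<le> Re (u \<bullet>c u)"
proof -
  have A: "A \<in> carrier_mat n n" and B: "B \<in> carrier_mat n m1" and C: "C \<in> carrier_mat m2 n"
    using re by (auto simp: realization_def)
  define M where "M = A + B * N"
  have M: "M \<in> carrier_mat n n" using B N by (simp add: M_def)
  define w where "w = u - N *\<^sub>v x"
  have w: "w \<in> carrier_vec m1" using N by (simp add: w_def)
  define b where "b = B *\<^sub>v w"
  have b: "b \<in> carrier_vec n" using B by (simp add: b_def)
  define y where "y s = adj_mat (s \<cdot>\<^sub>m 1\<^sub>m n - M) *\<^sub>v b" for s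
  define d where "d s = Determinant.det (s \<cdot>\<^sub>m 1\<^sub>m n - M)" for s
  define v where "v s = N *\<^sub>v y s + d s \<cdot>\<^sub>v w" for s
  have sM: "s \<cdot>\<^sub>m 1\<^sub>m n - M \<in> carrier_mat n n" for s using M by simp
  have y: "y s \<in> carrier_vec n" for s using carrier_matD(1)[OF adj_mat(1)[OF sM]] by (simp add: y_def)
  have v: "v s \<in> carrier_vec m1" for s using w by (simp add: v_def)
  have My: "M *\<^sub>v y s + d s \<cdot>\<^sub>v b = s \<cdot>\<^sub>v y s" for s
    unfolding y_def d_def by (rule adj_mat_state[OF M b])
  have state: "A *\<^sub>v y s + B *\<^sub>v v s = s \<cdot>\<^sub>v y s" for s
  proof -
    have "A *\<^sub>v y s + B *\<^sub>v v s = M *\<^sub>v y s + d s \<cdot>\<^sub>v b"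
      using A B N w y[of s] carrier_vecD[OF y[of s]]
      by (intro eq_vecI) (auto simp: M_def b_def v_def mat_vec_linear simp del: index_mult_mat_vec)
    thus ?thesis using My[of s] by simp
  qed
  have gain: "Re ((C *\<^sub>v y s) \<bullet>c (C *\<^sub>v y s)) \<le> Re (v s \<bullet>c v s)" if s: "s \<in> D" "s \<notin> spectrum A" for s
  proof -
    have "R s *\<^sub>v v s = C *\<^sub>v y s" by (rule realization_state[OF re s(2) y v state])
    moreover have "Re ((R s *\<^sub>v v s) \<bullet>c (R s *\<^sub>v v s)) \<le> Re (v s \<bullet>c v s)"
      using con s(1) v[of s] unfolding contractive_on_def loewner_contraction_iff[OF R] by blast
    ultimately show ?thesis by simp
  qed
  obtain f where f: "\<And>k::nat. f k \<in> D - spectrum A" "f \<longlonglongrightarrow> z"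
    using sequence_avoiding_finite_set[OF z card_finite_spectrum(1)[OF A]] by metis
  have ylim: "(\<lambda>k. vec_index (y (f k)) l) \<longlonglongrightarrow> vec_index (y z) l" if "l < n" for l
    unfolding y_def
    by (intro mat_tendsto_mult_vec[OF adj_mat_tendsto[OF char_mat_tendsto[OF f(2) M]] b] that)
  have dlim: "(\<lambda>k. d (f k)) \<longlonglongrightarrow> d z"
    unfolding d_def by (intro det_tendsto[OF char_mat_tendsto[OF f(2) M]])
  have "(\<lambda>k. vec_index (v (f k)) i) \<longlonglongrightarrow> vec_index (v z) i" if i: "i < m1" for i
  proof -
    have "vec_index (v s) i = vec_index (N *\<^sub>v y s) i + d s * vec_index w i" for s
      using i w by (simp add: v_def del: index_mult_mat_vec)
    thus ?thesis
      by (simp only:) (intro tendsto_intros dlim mult_mat_vec_tendsto[OF N y y ylim i])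
  qed
  hence vlim: "(\<lambda>k. Re (v (f k) \<bullet>c v (f k))) \<longlonglongrightarrow> Re (v z \<bullet>c v z)"
    by (intro cprod_self_tendsto[OF v v])
  have "(\<lambda>k. Re ((C *\<^sub>v y (f k)) \<bullet>c (C *\<^sub>v y (f k)))) \<longlonglongrightarrow> Re ((C *\<^sub>v y z) \<bullet>c (C *\<^sub>v y z))"
    by (intro cprod_self_tendsto[of _ m2] mult_mat_vec_tendsto[OF C y y ylim])
      (use C in auto)
  hence lim: "Re ((C *\<^sub>v y z) \<bullet>c (C *\<^sub>v y z)) \<le> Re (v z \<bullet>c v z)"
    by (rule LIMSEQ_le[OF _ vlim]) (use gain f(1) in auto)
  have dz: "d z \<noteq> 0" using det_resolvent_nonzero[OF M] zN by (simp add: d_def M_def)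
  have Mx: "M *\<^sub>v x + b = z \<cdot>\<^sub>v x"
  proof -
    have "M *\<^sub>v x + b = A *\<^sub>v x + B *\<^sub>v u"
      using A B N u x
      by (intro eq_vecI) (auto simp: M_def b_def w_def mat_vec_linear simp del: index_mult_mat_vec)
    thus ?thesis using eq by simp
  qed
  \<comment> \<open>at the limit point the only state with input \<open>d z w\<close> is \<open>d z x\<close>\<close>
  have yz: "y z = d z \<cdot>\<^sub>v x"
  proof -
    define e where "e = y z - d z \<cdot>\<^sub>v x"
    have e: "e \<in> carrier_vec n" using x by (simp add: e_def)
    have "M *\<^sub>v e = z \<cdot>\<^sub>v e"
    proof (rule eq_vecI)
      fix i assume "i < dim_vec (z \<cdot>\<^sub>v e)"
      hence i: "i < n" using e by simp
      have "vec_index (M *\<^sub>v y z + d z \<cdot>\<^sub>v b) i = vec_index (z \<cdot>\<^sub>v y z) i"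
        "vec_index (M *\<^sub>v x + b) i = vec_index (z \<cdot>\<^sub>v x) i" by (simp_all only: My Mx)
      hence h: "vec_index (M *\<^sub>v y z) i = z * vec_index (y z) i - d z * vec_index b i"
        "vec_index (M *\<^sub>v x) i = z * vec_index x i - vec_index b i"
        using i M b x carrier_vecD[OF y[of z]] by (simp_all add: algebra_simps del: index_mult_mat_vec)
      have "vec_index (M *\<^sub>v e) i = vec_index (M *\<^sub>v y z) i - d z * vec_index (M *\<^sub>v x) i"
        using i M x carrier_vecD[OF y[of z]] by (simp add: e_def mat_vec_linear del: index_mult_mat_vec)
      also have "\<dots> = z * vec_index (y z) i - d z * (z * vec_index x i)"
        unfolding h by (simp add: algebra_simps)
      also have "\<dots> = vec_index (z \<cdot>\<^sub>v e) i"
        using i x carrier_vecD[OF y[of z]] by (simp add: e_def algebra_simps)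
      finally show "vec_index (M *\<^sub>v e) i = vec_index (z \<cdot>\<^sub>v e) i" .
    qed (use M e in auto)
    hence "e = 0\<^sub>v n" using zN e spectrum_iff[OF M] unfolding M_def[symmetric] by blast
    thus ?thesis using y[of z] x vec_diff_eq_0_iff[of "y z" n "d z \<cdot>\<^sub>v x"] by (simp add: e_def)
  qed
  have "v z = d z \<cdot>\<^sub>v u"
    unfolding v_def yz w_def using N x u
    by (intro eq_vecI) (auto simp: mat_vec_linear algebra_simps simp del: index_mult_mat_vec)
  moreover have "C *\<^sub>v y z = d z \<cdot>\<^sub>v (C *\<^sub>v x)" unfolding yz using C x by (simp add: mat_vec_linear)
  moreover have scale: "Re ((a \<cdot>\<^sub>v t) \<bullet>c (a \<cdot>\<^sub>v t)) = (cmod a)\<^sup>2 * Re (t \<bullet>c t)" for a and t :: "complex Matrix.vec"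
  proof -
    have "(a \<cdot>\<^sub>v t) \<bullet>c (a \<cdot>\<^sub>v t) = complex_of_real ((cmod a)\<^sup>2) * (t \<bullet>c t)"
      unfolding complex_norm_square by (simp add: cprod_linear)
    thus ?thesis by (simp only: Re_complex_of_real times_complex.sel Im_complex_of_real)
  qed
  ultimately have "(cmod (d z))\<^sup>2 * Re ((C *\<^sub>v x) \<bullet>c (C *\<^sub>v x)) \<le> (cmod (d z))\<^sup>2 * Re (u \<bullet>c u)"
    using lim by (simp only: scale)
  thus ?thesis using dz by simp
qed

section \<open>The theorem\<close>

lemma spectrum_smult:
  fixes M :: "complex mat"
  assumes M: "M \<in> carrier_mat n n" and c: "c \<noteq> 0" and mu: "\<mu> \<in> spectrum (c \<cdot>\<^sub>m M)"
  shows "\<mu> / c \<in> spectrum M"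
proof -
  have cM: "c \<cdot>\<^sub>m M \<in> carrier_mat n n" using M by simp
  obtain v where v: "v \<in> carrier_vec n" "v \<noteq> 0\<^sub>v n" "(c \<cdot>\<^sub>m M) *\<^sub>v v = \<mu> \<cdot>\<^sub>v v"
    using mu spectrum_iff[OF cM] by blast
  have "M *\<^sub>v v = (\<mu> / c) \<cdot>\<^sub>v v"
  proof (rule eq_vecI)
    fix i assume "i < dim_vec ((\<mu> / c) \<cdot>\<^sub>v v)"
    moreover have "vec_index ((c \<cdot>\<^sub>m M) *\<^sub>v v) i = vec_index (\<mu> \<cdot>\<^sub>v v) i" by (simp only: v(3))
    ultimately show "vec_index (M *\<^sub>v v) i = vec_index ((\<mu> / c) \<cdot>\<^sub>v v) i"
      using v(1) M c by (simp add: mat_vec_linear field_simps del: index_mult_mat_vec)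
  qed (use v M in auto)
  thus ?thesis using v spectrum_iff[OF M] by blast
qed

lemma riccati_equation_iff_residual:
  assumes A: "A \<in> carrier_mat n n" and B: "B \<in> carrier_mat n m1" and C: "C \<in> carrier_mat m2 n"
    and X: "X \<in> carrier_mat n n"
  shows "riccati_equation A B C X \<longleftrightarrow>
    riccati_residual ((- \<i>) \<cdot>\<^sub>m A) (B * mat_adjoint B) (mat_adjoint C * C) X = 0\<^sub>m n n"
proof -
  define lhs where "lhs = \<i> \<cdot>\<^sub>m (X * A - mat_adjoint A * X)"
  define rhs where "rhs = mat_adjoint C * C + X * B * mat_adjoint B * X"
  define res where "res = riccati_residual ((- \<i>) \<cdot>\<^sub>m A) (B * mat_adjoint B) (mat_adjoint C * C) X"
  have l: "lhs \<in> carrier_mat n n" and r: "rhs \<in> carrier_mat n n"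
    using A B C X by (auto simp: lhs_def rhs_def)
  have G: "(- \<i>) \<cdot>\<^sub>m A \<in> carrier_mat n n" and S: "B * mat_adjoint B \<in> carrier_mat n n"
    and Q: "mat_adjoint C * C \<in> carrier_mat n n" using A B C by auto
  have res: "res = rhs - lhs"
  proof (rule mat_eq_by_mult_vec[of _ n n])
    fix x :: "complex Matrix.vec" assume x: "x \<in> carrier_vec n"
    show "res *\<^sub>v x = (rhs - lhs) *\<^sub>v x"
      unfolding res_def riccati_residual_mult_vec[OF G S Q X x] using A B C X x
      by (intro eq_vecI)
        (auto simp: lhs_def rhs_def mat_vec_linear mat_adjoint_linear algebra_simps
          simp del: index_mult_mat_vec)
  qed (use A B C X in \<open>auto simp: res_def riccati_residual_def lhs_def rhs_def\<close>)
  have "rhs - lhs = 0\<^sub>m n n \<longleftrightarrow> lhs = rhs"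
  proof
    assume eq: "rhs - lhs = 0\<^sub>m n n"
    show "lhs = rhs"
    proof (rule eq_matI)
      fix i j assume "i < dim_row rhs" "j < dim_col rhs"
      moreover have "(rhs - lhs) $$ (i, j) = 0\<^sub>m n n $$ (i, j)" by (simp only: eq)
      ultimately show "lhs $$ (i, j) = rhs $$ (i, j)" using l r by simp
    qed (use l r in auto)
  qed (use r in auto)
  thus ?thesis unfolding riccati_equation_def using res by (simp add: lhs_def rhs_def res_def)
qed

lemma islimpt_real_line:
  assumes "Im z = 0" shows "z islimpt (\<real> :: complex set)"
  unfolding islimpt_sequential
proof (intro exI[of _ "\<lambda>k. z + of_real (inverse (real (Suc k)))"] conjI allI)
  have "z \<in> \<real>" using assms by (simp add: complex_is_Real_iff)
  thus "z + of_real (inverse (real (Suc k))) \<in> \<real> - {z}" for k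
    by (intro DiffI Reals_add Reals_of_real) (auto simp del: of_nat_Suc of_real_inverse)
  have "(\<lambda>k. z + complex_of_real (inverse (real (Suc k)))) \<longlonglongrightarrow> z + of_real 0"
    by (intro tendsto_intros LIMSEQ_inverse_real_of_nat)
  thus "(\<lambda>k. z + complex_of_real (inverse (real (Suc k)))) \<longlonglongrightarrow> z" by simp
qed

lemma islimpt_upper_half_plane:
  assumes "0 \<le> Im z" shows "z islimpt {z. Im z > 0}"
  unfolding islimpt_sequential
proof (intro exI[of _ "\<lambda>k. z + \<i> * of_real (inverse (real (Suc k)))"] conjI allI)
  show "z + \<i> * of_real (inverse (real (Suc k))) \<in> {z. Im z > 0} - {z}" for k
    using assms by (auto intro!: add_nonneg_pos simp del: of_nat_Suc of_real_inverse)
  have "(\<lambda>k. z + \<i> * complex_of_real (inverse (real (Suc k)))) \<longlonglongrightarrow> z + \<i> * of_real 0"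
    by (intro tendsto_intros LIMSEQ_inverse_real_of_nat)
  thus "(\<lambda>k. z + \<i> * complex_of_real (inverse (real (Suc k)))) \<longlonglongrightarrow> z" by simp
qed

text \<open>At a pole in \<open>D\<close> an entry would be unbounded near a point where contractivity bounds it by one.\<close>
lemma contractive_onI_open:
  assumes "open D" and R: "\<And>z. R z \<in> carrier_mat m2 m1"
    and con: "\<And>z u. z \<in> D \<Longrightarrow> u \<in> carrier_vec m1 \<Longrightarrow> Re ((R z *\<^sub>v u) \<bullet>c (R z *\<^sub>v u)) \<le> Re (u \<bullet>c u)"
  shows "contractive_on m2 m1 D R"
  unfolding contractive_on_def loewner_contraction_iff[OF R]
proof (intro ballI conjI con)
  fix z assume z: "z \<in> D"
  show "\<not> has_pole_at m2 m1 R z"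
  proof
    assume "has_pole_at m2 m1 R z"
    then obtain i j where ij: "i < m2" "j < m1" and pole: "is_pole (\<lambda>w. R w $$ (i, j)) z"
      by (auto simp: has_pole_at_def)
    have "\<forall>\<^sub>F w in at z. 2 \<le> cmod (R w $$ (i, j))"
      using pole unfolding is_pole_def filterlim_at_infinity[OF order_refl] by auto
    moreover have "\<forall>\<^sub>F w in at z. w \<in> D"
      using \<open>open D\<close> z by (rule eventually_at_in_open')
    ultimately have "\<forall>\<^sub>F w in at z. False"
    proof eventually_elim
      case (elim w)
      have "cmod (R w $$ (i, j)) \<le> 1"
        by (rule contraction_entry_le_1[OF R ij con[OF elim(2)]])
      with elim(1) show False by simp
    qed
    thus False by simp
  qed
qed

theorem lemma1p2:
  fixes R :: "complex \<Rightarrow> complex mat"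
    and A B C :: "complex mat"
    and n m1 m2 :: nat
  assumes "rational_mat_function m2 m1 R"
    and "contractive_on m2 m1 \<real> R"
    and "vanishes_at_infinity m2 m1 R"
    and "minimal_realization m2 m1 n A B C R"
  shows "(\<exists>!X. spectral_riccati_solution n A B C X) \<and>
         (\<forall>X. spectral_riccati_solution n A B C X \<longrightarrow>
            invertible_mat X \<and>
            (pos_def_mat X \<longleftrightarrow> contractive_on m2 m1 {z. Im z > 0} R))"
proof -
  note rat = assms(1) and min = assms(4)
  have re: "realization m2 m1 n A B C R" using min by (simp add: minimal_realization_def)
  have A: "A \<in> carrier_mat n n" and B: "B \<in> carrier_mat n m1" and C: "C \<in> carrier_mat m2 n"
    using re by (auto simp: realization_def)
  have R: "R z \<in> carrier_mat m2 m1" for z using rat by (simp add: rational_mat_function_def)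
  \<comment> \<open>rotation of the upper half-plane to the right half-plane\<close>
  define G where "G = (- \<i>) \<cdot>\<^sub>m A"
  define S where "S = B * mat_adjoint B"
  define Q where "Q = mat_adjoint C * C"
  have G: "G \<in> carrier_mat n n" and S: "S \<in> carrier_mat n n" and Q: "Q \<in> carrier_mat n n"
    using A B C by (auto simp: G_def S_def Q_def)
  have psdS: "psd_mat S" unfolding S_def by (rule gram_psd[OF B])
  have C': "mat_adjoint C \<in> carrier_mat n m2" using C by simp
  have psdQ: "psd_mat Q" using gram_psd[OF C'] by (simp add: Q_def)
  have formQ: "(Q *\<^sub>v x) \<bullet>c x = (C *\<^sub>v x) \<bullet>c (C *\<^sub>v x)" if "x \<in> carrier_vec n" for x
    using gram_form[OF C' that] by (simp add: Q_def)
  have Gv: "G *\<^sub>v x = (- \<i>) \<cdot>\<^sub>v (A *\<^sub>v x)" if "x \<in> carrier_vec n" for x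
    using that A by (simp add: G_def mat_vec_linear)
  have times_i: "- \<i> * \<i> = 1" "\<i> * - \<i> = 1" by simp_all

  have ctrb: "controllable_pair n G S"
    unfolding controllable_pair_def
  proof (intro ballI allI impI)
    fix p :: "complex Matrix.vec" and \<mu>
    assume p: "p \<in> carrier_vec n" and eig: "mat_adjoint G *\<^sub>v p = \<mu> \<cdot>\<^sub>v p" and Sp: "S *\<^sub>v p = 0\<^sub>v n"
    have "(mat_adjoint B *\<^sub>v p) \<bullet>c (mat_adjoint B *\<^sub>v p) = 0"
      using gram_form[OF B p] Sp p by (simp add: S_def cprod_linear)
    hence Bp: "mat_adjoint B *\<^sub>v p = 0\<^sub>v m1" using B by (simp add: cprod_self_eq_0(1))
    have "\<i> \<cdot>\<^sub>v (mat_adjoint A *\<^sub>v p) = \<mu> \<cdot>\<^sub>v p"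
      using eig A p by (simp add: G_def mat_adjoint_linear mat_vec_linear)
    hence "(- \<i>) \<cdot>\<^sub>v (\<i> \<cdot>\<^sub>v (mat_adjoint A *\<^sub>v p)) = (- \<i>) \<cdot>\<^sub>v (\<mu> \<cdot>\<^sub>v p)" by (simp only:)
    hence "mat_adjoint A *\<^sub>v p = (- \<i> * \<mu>) \<cdot>\<^sub>v p" by (simp only: times_i smult_smult_assoc one_smult_vec)
    thus "p = 0\<^sub>v n" by (rule minimal_realization_controllable[OF rat min p _ Bp])
  qed
  have obs: "observable_pair n G Q"
    unfolding observable_pair_def
  proof (intro ballI allI impI)
    fix x :: "complex Matrix.vec" and \<mu>
    assume x: "x \<in> carrier_vec n" and eig: "G *\<^sub>v x = \<mu> \<cdot>\<^sub>v x" and Qx: "Q *\<^sub>v x = 0\<^sub>v n"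
    have "(C *\<^sub>v x) \<bullet>c (C *\<^sub>v x) = 0" using formQ[OF x] Qx x by (simp add: cprod_linear)
    hence Cx: "C *\<^sub>v x = 0\<^sub>v m2" using C by (simp add: cprod_self_eq_0(1))
    have "\<i> \<cdot>\<^sub>v ((- \<i>) \<cdot>\<^sub>v (A *\<^sub>v x)) = \<i> \<cdot>\<^sub>v (\<mu> \<cdot>\<^sub>v x)" using eig Gv[OF x] by simp
    hence "A *\<^sub>v x = (\<i> * \<mu>) \<cdot>\<^sub>v x" by (simp only: times_i smult_smult_assoc one_smult_vec)
    thus "x = 0\<^sub>v n" by (rule minimal_realization_observable[OF rat min x _ Cx])
  qed

  obtain N where N: "N \<in> carrier_mat m1 n" and stabN: "hurwitz_mat (G + B * N)"
    using stabilizing_feedback[OF G B ctrb[unfolded S_def]] .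
  have bounded_real: "bounded_real_at n m1 G B Q z"
    if con: "contractive_on m2 m1 D R" and lim: "(\<i> * z) islimpt D" and z: "0 \<le> Re z" for D z
    unfolding bounded_real_at_def
  proof (intro ballI impI)
    fix x u :: "complex Matrix.vec"
    assume x: "x \<in> carrier_vec n" and u: "u \<in> carrier_vec m1" and eq: "G *\<^sub>v x + B *\<^sub>v u = z \<cdot>\<^sub>v x"
    have iN: "\<i> \<cdot>\<^sub>m N \<in> carrier_mat m1 n" and iu: "\<i> \<cdot>\<^sub>v u \<in> carrier_vec m1" using N u by auto
    \<comment> \<open>The feedback \<open>N\<close> is stabilizing for \<open>G\<close>. In the coordinates of \<open>A\<close> it is \<open>\<i> N\<close>.\<close>
    have "A + B * (\<i> \<cdot>\<^sub>m N) = \<i> \<cdot>\<^sub>m (G + B * N)"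
    proof (rule mat_eq_by_mult_vec[of _ n n])
      fix v :: "complex Matrix.vec" assume v: "v \<in> carrier_vec n"
      show "(A + B * (\<i> \<cdot>\<^sub>m N)) *\<^sub>v v = (\<i> \<cdot>\<^sub>m (G + B * N)) *\<^sub>v v"
        using v A B N G by (intro eq_vecI) (auto simp: mat_vec_linear Gv algebra_simps simp del: index_mult_mat_vec)
    qed (use A B N G in auto)
    moreover have "G + B * N \<in> carrier_mat n n" using G B N by simp
    ultimately have zN: "\<i> * z \<notin> spectrum (A + B * (\<i> \<cdot>\<^sub>m N))"
      using spectrum_smult[of "G + B * N" n \<i> "\<i> * z"] stabN z by (auto simp: hurwitz_mat_def)
    have "A *\<^sub>v x + B *\<^sub>v (\<i> \<cdot>\<^sub>v u) = \<i> \<cdot>\<^sub>v (G *\<^sub>v x + B *\<^sub>v u)"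
      using A B x u by (intro eq_vecI) (auto simp: mat_vec_linear Gv algebra_simps simp del: index_mult_mat_vec)
    also have "\<dots> = (\<i> * z) \<cdot>\<^sub>v x" unfolding eq by (simp add: smult_smult_assoc)
    finally have "Re ((C *\<^sub>v x) \<bullet>c (C *\<^sub>v x)) \<le> Re ((\<i> \<cdot>\<^sub>v u) \<bullet>c (\<i> \<cdot>\<^sub>v u))"
      by (rule contractive_imp_gain_le[OF re R con lim iN zN x iu])
    also have "(\<i> \<cdot>\<^sub>v u) \<bullet>c (\<i> \<cdot>\<^sub>v u) = u \<bullet>c u" by (simp add: cprod_linear)
    finally show "qform Q x \<le> Re (u \<bullet>c u)" by (simp only: formQ[OF x])
  qed
  have br: "bounded_real_at n m1 G B Q z" if "Re z = 0" for z
    using that by (intro bounded_real[OF assms(2)] islimpt_real_line) auto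

  have solution_iff: "spectral_riccati_solution n A B C X \<longleftrightarrow>
      X \<in> carrier_mat n n \<and> hermitian_mat X \<and> riccati_residual G S Q X = 0\<^sub>m n n \<and>
      spectrum (G + S * X) \<subseteq> {z. Re z \<le> 0}" for X
  proof (cases "X \<in> carrier_mat n n")
    case X: True
    define M where "M = A + \<i> \<cdot>\<^sub>m (B * mat_adjoint B * X)"
    have M: "M \<in> carrier_mat n n" and GSX: "G + S * X \<in> carrier_mat n n" using S B X by (auto simp: M_def)
    have 1: "M = \<i> \<cdot>\<^sub>m (G + S * X)"
      using A B X by (intro eq_matI) (auto simp: M_def G_def S_def algebra_simps simp del: index_mult_mat(1))
    have 2: "G + S * X = (- \<i>) \<cdot>\<^sub>m M"
      using A B X by (intro eq_matI) (auto simp: M_def G_def S_def algebra_simps simp del: index_mult_mat(1))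
    have "spectrum M \<subseteq> {z. Im z \<le> 0} \<longleftrightarrow> spectrum (G + S * X) \<subseteq> {z. Re z \<le> 0}"
    proof
      assume sub: "spectrum M \<subseteq> {z. Im z \<le> 0}"
      show "spectrum (G + S * X) \<subseteq> {z. Re z \<le> 0}"
      proof
        fix \<mu> assume "\<mu> \<in> spectrum (G + S * X)"
        hence "\<mu> / (- \<i>) \<in> spectrum M" unfolding 2 by (intro spectrum_smult[OF M]) auto
        thus "\<mu> \<in> {z. Re z \<le> 0}" using sub by auto
      qed
    next
      assume sub: "spectrum (G + S * X) \<subseteq> {z. Re z \<le> 0}"
      show "spectrum M \<subseteq> {z. Im z \<le> 0}"
      proof
        fix \<mu> assume "\<mu> \<in> spectrum M"
        hence "\<mu> / \<i> \<in> spectrum (G + S * X)" unfolding 1 by (intro spectrum_smult[OF GSX]) auto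
        thus "\<mu> \<in> {z. Im z \<le> 0}" using sub by auto
      qed
    qed
    thus ?thesis
      using X riccati_equation_iff_residual[OF A B C X]
      by (simp add: spectral_riccati_solution_def M_def G_def S_def Q_def)
  qed (simp add: spectral_riccati_solution_def)

  obtain X0 where X0: "X0 \<in> carrier_mat n n" "hermitian_mat X0" "riccati_residual G S Q X0 = 0\<^sub>m n n"
    and spec0: "spectrum (G + S * X0) \<subseteq> {z. Re z \<le> 0}"
    and min0: "\<And>Z. Z \<in> carrier_mat n n \<Longrightarrow> hermitian_mat Z \<Longrightarrow> riccati_residual G S Q Z = 0\<^sub>m n n \<Longrightarrow>
      psd_mat (Z - X0)"
    using riccati_minimal_solution[OF G B Q psdQ ctrb[unfolded S_def] obs br] unfolding S_def by metis
  have "\<exists>!X. spectral_riccati_solution n A B C X"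
  proof (rule ex1I)
    show "spectral_riccati_solution n A B C X0" using X0 spec0 by (simp add: solution_iff)
    fix Z assume "spectral_riccati_solution n A B C Z"
    hence Z: "Z \<in> carrier_mat n n" "hermitian_mat Z" "riccati_residual G S Q Z = 0\<^sub>m n n"
      and specZ: "spectrum (G + S * Z) \<subseteq> {z. Re z \<le> 0}" by (auto simp: solution_iff)
    show "Z = X0"
      by (rule riccati_solution_unique[OF G S Q psdS ctrb X0 Z specZ min0[OF Z]])
  qed
  moreover have "invertible_mat X \<and> (pos_def_mat X \<longleftrightarrow> contractive_on m2 m1 {z. Im z > 0} R)"
    if "spectral_riccati_solution n A B C X" for X
  proof -
    have X: "X \<in> carrier_mat n n" and hermX: "hermitian_mat X"
      and solX: "riccati_residual G S Q X = 0\<^sub>m n n"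
      using that by (auto simp: solution_iff)
    have inj: "x = 0\<^sub>v n" if "x \<in> carrier_vec n" "X *\<^sub>v x = 0\<^sub>v n" for x
      using riccati_solution_injective[OF G S Q psdQ obs X hermX solX that] .
    obtain Y where Y: "Y \<in> carrier_mat n n" "X * Y = 1\<^sub>m n" "Y * X = 1\<^sub>m n"
      using injective_mat_inverse[OF X inj] by metis
    have "invertible_mat X"
      unfolding invertible_mat_def inverts_mat_def square_mat.simps using X Y by auto
    moreover have "pos_def_mat X \<longleftrightarrow> contractive_on m2 m1 {z. Im z > 0} R"
    proof
      assume pd: "pos_def_mat X"
      have pos: "0 < qform X x" if "x \<in> carrier_vec n" "x \<noteq> 0\<^sub>v n" for x
        using pd that X by (auto simp: pos_def_mat_def less_complex_def)
      have "0 \<le> qform X x" if "x \<in> carrier_vec n" for x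
        using pos[OF that] X by (cases "x = 0\<^sub>v n") (auto simp: mat_vec_linear cprod_linear)
      hence psdX: "psd_mat X" using hermX by (simp add: psd_mat_iff[OF X])
      show "contractive_on m2 m1 {z. Im z > 0} R"
      proof (rule contractive_onI_open[OF open_halfspace_Im_gt R])
        fix z and u :: "complex Matrix.vec"
        assume "z \<in> {z. Im z > 0}" and u: "u \<in> carrier_vec m1"
        hence z: "Im z > 0" by simp
        have br: "bounded_real_at n m1 G B Q (- \<i> * z)"
          using z by (intro riccati_dissipation[OF G B Q X psdX solX[unfolded S_def]]) simp
        have zA: "z \<notin> spectrum A"
        proof
          assume "z \<in> spectrum A"
          then obtain v where v: "v \<in> carrier_vec n" "v \<noteq> 0\<^sub>v n" "A *\<^sub>v v = z \<cdot>\<^sub>v v"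
            using spectrum_iff[OF A] by blast
          have Gvv: "G *\<^sub>v v = (- \<i> * z) \<cdot>\<^sub>v v" using Gv[OF v(1)] v(3) by (simp add: smult_smult_assoc)
          have "v \<bullet>c (X *\<^sub>v v) = (X *\<^sub>v v) \<bullet>c v" using hermitian_cprod[OF hermX X v(1) v(1)] by simp
          hence "(G *\<^sub>v v) \<bullet>c (X *\<^sub>v v) = (- \<i> * z) * ((X *\<^sub>v v) \<bullet>c v)"
            unfolding Gvv using v(1) X by (simp add: cprod_linear)
          hence "Re ((G *\<^sub>v v) \<bullet>c (X *\<^sub>v v)) = Im z * qform X v"
            using hermitian_form_real[OF hermX X v(1)] by simp
          moreover have "0 < Im z * qform X v" using z pos[OF v(1,2)] by simp
          moreover have "0 \<le> qform Q v" using psdQ psd_mat_iff[OF Q] v(1) by simp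
          moreover have "0 \<le> Re ((S *\<^sub>v (X *\<^sub>v v)) \<bullet>c (X *\<^sub>v v))" using psdS psd_mat_iff[OF S] X by auto
          moreover have "2 * Re ((G *\<^sub>v v) \<bullet>c (X *\<^sub>v v)) + qform Q v +
              Re ((S *\<^sub>v (X *\<^sub>v v)) \<bullet>c (X *\<^sub>v v)) = 0"
            using riccati_residual_form[OF G S Q X hermX v(1)] v(1) by (simp add: solX cprod_linear)
          ultimately show False by linarith
        qed
        obtain x where x: "x \<in> carrier_vec n" "A *\<^sub>v x + B *\<^sub>v u = z \<cdot>\<^sub>v x"
          using transfer_state_exists[OF A B zA u] .
        have mu: "(- \<i>) \<cdot>\<^sub>v u \<in> carrier_vec m1" using u by simp
        have "G *\<^sub>v x + B *\<^sub>v ((- \<i>) \<cdot>\<^sub>v u) = (- \<i>) \<cdot>\<^sub>v (A *\<^sub>v x + B *\<^sub>v u)"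
          using A B x(1) u
          by (intro eq_vecI) (auto simp: mat_vec_linear Gv algebra_simps simp del: index_mult_mat_vec)
        also have "\<dots> = (- \<i> * z) \<cdot>\<^sub>v x" unfolding x(2) by (simp add: smult_smult_assoc)
        finally have "qform Q x \<le> Re (((- \<i>) \<cdot>\<^sub>v u) \<bullet>c ((- \<i>) \<cdot>\<^sub>v u))"
          using br x(1) mu unfolding bounded_real_at_def by blast
        also have "((- \<i>) \<cdot>\<^sub>v u) \<bullet>c ((- \<i>) \<cdot>\<^sub>v u) = u \<bullet>c u" by (simp add: cprod_linear)
        finally show "Re ((R z *\<^sub>v u) \<bullet>c (R z *\<^sub>v u)) \<le> Re (u \<bullet>c u)"
          unfolding realization_state[OF re zA x(1) u x(2)] by (simp only: formQ[OF x(1)])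
      qed
    next
      assume con: "contractive_on m2 m1 {z. Im z > 0} R"
      have "bounded_real_at n m1 G B Q z" if "0 \<le> Re z" for z
        using that by (intro bounded_real[OF con] islimpt_upper_half_plane) auto
      hence psdX: "psd_mat X"
        by (intro riccati_solution_psd[OF G B Q psdQ obs X hermX solX[unfolded S_def]])
      have "0 < (X *\<^sub>v x) \<bullet>c x" if x: "x \<in> carrier_vec n" "x \<noteq> 0\<^sub>v n" for x
      proof -
        have "qform X x \<noteq> 0" using psd_mat_form_eq_0[OF X psdX x(1)] inj[OF x(1)] x(2) by blast
        moreover have "0 \<le> qform X x" using psdX psd_mat_iff[OF X] x(1) by simp
        ultimately show ?thesis
          using hermitian_form_real[OF hermX X x(1)] by (simp add: less_complex_def)
      qed
      thus "pos_def_mat X" using X hermX by (auto simp: pos_def_mat_def)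
    qed
    ultimately show ?thesis by blast
  qed
  ultimately show ?thesis by blast
qed

end
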